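(* Let $g=\sum_{n\ge 0}x^{n^{2}}\in\mathbb{Z}/2[[x]]$, write $\frac{1}{g}=\sum_{i\ge 0}b_{i}x^{i}$ with $b_{i}\in\mathbb{Z}/2$, and let $B=\{n\ge 0: b_{n}=1\}$. Then the number of $n\in B$ with $n\le y$ and $n\not\equiv 15\pmod{16}$ is $O\!\left(y\log\log(y)/\log(y)\right)$ as $y\to\infty$. In particular the upper density of $B$, namely $\limsup_{y\to\infty}\frac{\#\{n\in B: n\le y\}}{y}$, is at most $\frac{1}{16}$.
   Context: $\mathbb{Z}/2[[x]]$ is the ring of formal power series over the field with two elements; $g$ has constant term $1$ and so is invertible there. *)

theory Defs
  imports
    "HOL-Library.Z2"
    "HOL-Library.Landau_Symbols"
    "HOL-Library.Extended_Real"
    "HOL-Library.Liminf_Limsup"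
    "HOL-Computational_Algebra.Formal_Power_Series"
    "HOL-Number_Theory.Cong"
begin

(* The two-element field is the type bit of HOL-Library.Z2; the infinite sum is taken in the
   X-adic topology of the library, in which it converges (lemma g_series_sums). *)
definition g_series :: "bit fps" where
  "g_series = (\<Sum>n. fps_X ^ (n\<^sup>2))"

definition b_coeff :: "nat \<Rightarrow> bit" where
  "b_coeff i = fps_nth (inverse g_series) i"

definition B_set :: "nat set" where
  "B_set = {n. b_coeff n = 1}"

definition upper_density :: "nat set \<Rightarrow> ereal" where
  "upper_density A = Limsup at_top (\<lambda>y::real. ereal (real (card {n \<in> A. real n \<le> y}) / y))"

lemma g_series_sums: "(\<lambda>n. fps_X ^ (n\<^sup>2) :: bit fps) sums Abs_fps (\<lambda>k. if \<exists>n. k = n\<^sup>2 then 1 else 0)"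
  unfolding sums_def
proof (rule tendsto_fpsI)
  fix k :: nat
  have "fps_nth (\<Sum>i<m. fps_X ^ (i\<^sup>2) :: bit fps) k = (if \<exists>n. k = n\<^sup>2 then 1 else 0)"
    if "m > k" for m
  proof (cases "\<exists>n. k = n\<^sup>2")
    case True
    then obtain n where n: "k = n\<^sup>2" by blast
    have "n \<le> n\<^sup>2" by (simp add: power2_eq_square)
    with n that have "n < m" by linarith
    have "fps_nth (\<Sum>i<m. fps_X ^ (i\<^sup>2) :: bit fps) k = (\<Sum>i<m. if i = n then 1 else 0)"
      unfolding fps_sum_nth by (intro sum.cong) (auto simp: n fps_X_power_nth)
    with True \<open>n < m\<close> show ?thesis by simp
  next
    case False
    then show ?thesis by (auto simp: fps_sum_nth fps_X_power_nth intro!: sum.neutral)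
  qed
  then show "\<forall>\<^sub>F m in sequentially. fps_nth (\<Sum>i<m. fps_X ^ (i\<^sup>2) :: bit fps) k =
      fps_nth (Abs_fps (\<lambda>k. if \<exists>n. k = n\<^sup>2 then 1 else 0)) k"
    by (intro eventually_mono[OF eventually_gt_at_top[of k]]) (simp only: fps_nth_Abs_fps)
qed

lemma g_series_nth: "fps_nth g_series k = (if \<exists>n. k = n\<^sup>2 then 1 else 0)"
  unfolding g_series_def sums_unique[OF g_series_sums, symmetric] by simp

lemma g_series_mult_inverse: "g_series * inverse g_series = 1"
proof -
  have "\<exists>n::nat. 0 = n\<^sup>2" by (rule exI[of _ 0]) simp
  then have "fps_nth g_series 0 = 1" unfolding g_series_nth by simp
  then show ?thesis by (simp add: inverse_mult_eq_1')
qed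

end

(*
  Let h be the sum of x^(a^2) over odd a > 0 (odd_theta below). In characteristic 2, g = g^4 + h,
  and substituting 1/g = g^2 + h (1/g)^2 into itself gives
    1/g = g^2 + h g^4 + h^3 g^8 + h^7 / g^8.
  If h1 and h9 are the parts of h with exponents 1 and 9 modulo 16 (odd_theta1 and odd_theta3), then
  h1 h9 = h^10, whence h9 = h (g^8 + g^16), and the last summand is h^6 h1 plus a series supported on
  15 mod 16. So for n not 15 mod 16 the coefficient of 1/g is the parity of the number of
  representations of n by 2 a^2, a^2 + 4 b^2, a^2 + 2 b^2 + 8 c^2 or a^2 + 2 b^2 + 4 c^2, depending on
  n mod 16.

  These numbers are even as soon as three odd primes divide n to an odd power. For the binary form
  this follows from Zagier's involution. The ternary representations are pure quaternions alpha of
  norm N (N = n or 2 n); for an odd unitary divisor d of N the left ideal of all beta with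
  d | beta alpha is generated by an element beta of norm d, and alpha -> beta alpha beta^-1 is an
  involution on the representations modulo signs. Two such involutions and their product have no
  fixed points, so the numbers of representations, and of those with c = 0, are divisible by 4.

  The remaining n are of the form m^2 t with t = 1, p or p q, and Chebyshev's upper bound shows that
  there are O(y log log y / log y) of them up to y.
*)

theory Submission
  imports
    Defs
    "HOL-Computational_Algebra.Squarefree"
    "HOL-Real_Asymp.Real_Asymp"
begin

section \<open>Counting modulo 2 and 4 by involutions\<close>

text \<open>The theta products count the ternary representations with a fixed sign of c, whereas
  conjugation mixes the signs of c. The wanted number is therefore half of a sum: all
  representations plus those with c = 0. Evenness needs both summands divisible by 4, and this is
  what calls for two commuting free involutions. Two of the three primes provide them. The third one
  keeps N / (d e) at least 3, and the resulting bound N > 2 d e excludes fixed points.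

  In characteristic 2 squaring is additive, so the powers h^2, h^4, h^8 are again theta series, and
  a product of such powers counts representations by a diagonal form with powers of 2 as
  coefficients.

  Conjugation by an ideal generator is the classical action of ideal classes of order two of
  \<int>[\<surd>-N] on the embeddings of \<surd>-N into a quaternion order. Only odd d occur, so an
  order with integer coordinates is good enough.

  The exponents 15 modulo 16 are all counted, whatever their coefficients; they alone account for
  the density 1/16.\<close>

lemma dvd_card_blocks:
  assumes "finite A"
    and P: "\<And>x. x \<in> A \<Longrightarrow> x \<in> P x \<and> P x \<subseteq> A \<and> card (P x) = k"
    and eq: "\<And>x y. x \<in> A \<Longrightarrow> y \<in> P x \<Longrightarrow> P y = P x"
  shows "k dvd card A"
proof -
  have U: "\<Union> (P ` A) = A" using P by blast
  have "k * card (P ` A) = card (\<Union> (P ` A))"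
  proof (rule card_partition)
    show "finite (P ` A)" "finite (\<Union> (P ` A))" using assms(1) U by auto
    show "card c = k" if "c \<in> P ` A" for c using that P by auto
    show "c \<inter> c' = {}" if "c \<in> P ` A" "c' \<in> P ` A" "c \<noteq> c'" for c c'
      using that eq by (metis disjoint_iff imageE)
  qed
  with U show ?thesis by (metis dvd_triv_left)
qed

lemma even_card_involution:
  assumes "finite A" "\<And>x. x \<in> A \<Longrightarrow> f x \<in> A \<and> f (f x) = x \<and> f x \<noteq> x"
  shows "even (card A)"
proof (rule dvd_card_blocks)
  show "x \<in> {x, f x} \<and> {x, f x} \<subseteq> A \<and> card {x, f x} = 2" if "x \<in> A" for x
    using assms(2)[OF that] that by auto
  show "{y, f y} = {x, f x}" if "x \<in> A" "y \<in> {x, f x}" for x y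
    using assms(2)[OF that(1)] that(2) by auto
qed fact

lemma card_involution_fixed:
  assumes "finite A" "\<And>x. x \<in> A \<Longrightarrow> f x \<in> A \<and> f (f x) = x"
  shows "even (card A) \<longleftrightarrow> even (card {x \<in> A. f x = x})"
proof -
  have "even (card {x \<in> A. f x \<noteq> x})"
    by (rule even_card_involution[of _ f]) (use assms in auto)
  moreover have "card A = card {x \<in> A. f x = x} + card {x \<in> A. f x \<noteq> x}"
    using assms(1) by (subst card_Un_disjoint[symmetric]) (auto intro: arg_cong[of _ _ card])
  ultimately show ?thesis by simp
qed

text \<open>The maps \<open>f\<close>, \<open>g\<close> and their product form a Klein four-group
  acting without fixed points, so every orbit has four elements.\<close>

lemma four_dvd_card_involutions:
  assumes "finite A"
    and f: "\<And>x. x \<in> A \<Longrightarrow> f x \<in> A \<and> f (f x) = x \<and> f x \<noteq> x"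
    and g: "\<And>x. x \<in> A \<Longrightarrow> g x \<in> A \<and> g (g x) = x \<and> g x \<noteq> x"
    and fg: "\<And>x. x \<in> A \<Longrightarrow> f (g x) = g (f x) \<and> f (g x) \<noteq> x"
  shows "4 dvd card A"
proof (rule dvd_card_blocks)
  fix x assume x: "x \<in> A"
  have ne: "f x \<noteq> x" "g x \<noteq> x" "f (g x) \<noteq> x" "g (f x) \<noteq> x" "f (g x) \<noteq> g x" "g (f x) \<noteq> f x"
    "f x \<noteq> g x"
    using x f g fg by metis+
  then have "card {x, f x, g x, f (g x)} = 4"
    using fg[OF x] by auto
  then show "x \<in> {x, f x, g x, f (g x)} \<and> {x, f x, g x, f (g x)} \<subseteq> A \<and> card {x, f x, g x, f (g x)} = 4"
    using x f g by auto
  fix y assume "y \<in> {x, f x, g x, f (g x)}"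
  moreover have "f (f x) = x" "g (g x) = x" "g (f x) = f (g x)" "f (f (g x)) = g x"
    "g (f (g x)) = f x" "f (g (f x)) = g x" "f (g (g x)) = f x" "f (g (f (g x))) = x"
    using x f g fg by metis+
  ultimately show "{y, f y, g y, f (g y)} = {x, f x, g x, f (g x)}" by auto
qed fact

lemma le_square_int: "x \<le> (x::int)\<^sup>2"
proof (cases "x \<le> 0")
  case False
  then show ?thesis by (simp add: power2_eq_square mult_le_cancel_left1)
qed (use zero_le_power2[of x] in linarith)

section \<open>Lipschitz quaternions\<close>

text \<open>Integer coordinates instead of the maximal Hurwitz order keep all computations
  polynomial identities over the integers. The price is a division with remainder that can fail by a
  factor 2, which is harmless modulo odd numbers.\<close>

datatype quat = Quat (qre: int) (qi: int) (qj: int) (qk: int)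

instantiation quat :: ring_1
begin
definition "0 = Quat 0 0 0 0"
definition "1 = Quat 1 0 0 0"
definition "x + y = Quat (qre x + qre y) (qi x + qi y) (qj x + qj y) (qk x + qk y)"
definition "x - y = Quat (qre x - qre y) (qi x - qi y) (qj x - qj y) (qk x - qk y)"
definition "- x = Quat (- qre x) (- qi x) (- qj x) (- qk x)"
definition "x * y = Quat
   (qre x * qre y - qi x * qi y - qj x * qj y - qk x * qk y)
   (qre x * qi y + qi x * qre y + qj x * qk y - qk x * qj y)
   (qre x * qj y - qi x * qk y + qj x * qre y + qk x * qi y)
   (qre x * qk y + qi x * qj y - qj x * qi y + qk x * qre y)"
instance
  by standard
    (simp_all add: zero_quat_def one_quat_def plus_quat_def minus_quat_def uminus_quat_def
      times_quat_def algebra_simps)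
end

text \<open>Multiplication is not commutative, so \<open>dvd\<close> asks for a left factor. Here
  the divisor is always some \<open>of_int d\<close>, which is central.\<close>

instance quat :: Rings.dvd ..

lemmas quat_defs = zero_quat_def one_quat_def plus_quat_def minus_quat_def uminus_quat_def
  times_quat_def

lemma of_int_quat: "of_int d = Quat d 0 0 0"
proof -
  have nat: "of_nat n = Quat (int n) 0 0 0" for n
    by (induction n) (simp_all add: quat_defs)
  show ?thesis
    by (cases d rule: int_cases2) (simp_all add: nat quat_defs)
qed

lemma of_int_times_quat:
  "of_int d * x = Quat (d * qre x) (d * qi x) (d * qj x) (d * qk x)"
  by (simp add: of_int_quat times_quat_def)

lemma of_int_dvd_quat:
  "of_int d dvd x \<longleftrightarrow> d dvd qre x \<and> d dvd qi x \<and> d dvd qj x \<and> d dvd qk x"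
proof
  assume "of_int d dvd x"
  then obtain y where "x = of_int d * y" by (auto simp: dvd_def)
  then show "d dvd qre x \<and> d dvd qi x \<and> d dvd qj x \<and> d dvd qk x"
    by (simp add: of_int_times_quat)
next
  assume "d dvd qre x \<and> d dvd qi x \<and> d dvd qj x \<and> d dvd qk x"
  then obtain a b c e where "qre x = d * a" "qi x = d * b" "qj x = d * c" "qk x = d * e"
    by (auto simp: dvd_def)
  then have "x = of_int d * Quat a b c e"
    by (cases x) (simp add: of_int_times_quat)
  then show "of_int d dvd x" by (rule dvdI)
qed

lemma of_int_dvd_triv [simp]: "of_int d dvd of_int d * (x::quat)"
  by (rule dvdI) (rule refl)

lemma quat_sel_scalar [simp]:
  "qre (of_int d * x) = d * qre x" "qi (of_int d * x) = d * qi x"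
  "qj (of_int d * x) = d * qj x" "qk (of_int d * x) = d * qk x"
  "qre (numeral n * x) = numeral n * qre x" "qi (numeral n * x) = numeral n * qi x"
  "qj (numeral n * x) = numeral n * qj x" "qk (numeral n * x) = numeral n * qk x"
  "qre 1 = 1" "qi 1 = 0" "qj 1 = 0" "qk 1 = 0"
  using of_int_times_quat[of "numeral n" x] by (simp_all add: of_int_times_quat one_quat_def)

lemma quat_sel [simp]:
  "qre (x + y) = qre x + qre y" "qi (x + y) = qi x + qi y"
  "qj (x + y) = qj x + qj y" "qk (x + y) = qk x + qk y"
  "qre (x - y) = qre x - qre y" "qi (x - y) = qi x - qi y"
  "qj (x - y) = qj x - qj y" "qk (x - y) = qk x - qk y"
  "qre (- x) = - qre x" "qi (- x) = - qi x" "qj (- x) = - qj x" "qk (- x) = - qk x"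
  "qre 0 = 0" "qi 0 = 0" "qj 0 = 0" "qk 0 = 0"
  "qre (of_int d) = d" "qi (of_int d) = 0" "qj (of_int d) = 0" "qk (of_int d) = 0"
  by (simp_all add: quat_defs of_int_quat)

lemma of_int_dvd_mult_right: "of_int d dvd x \<Longrightarrow> of_int d dvd x * (y::quat)"
  by (auto simp: dvd_def mult.assoc)

lemma of_int_dvd_mult_left:
  assumes "of_int d dvd y" shows "of_int d dvd (x::quat) * y"
proof -
  from assms obtain z where "y = of_int d * z" by (auto simp: dvd_def)
  then have "x * y = of_int d * (x * z)"
    by (metis mult.assoc mult_of_int_commute)
  then show ?thesis by simp
qed

lemma of_int_mult_cancel_quat:
  assumes "d \<noteq> 0" "of_int d * x = of_int d * (y::quat)" shows "x = y"
  using assms by (cases x; cases y) (simp add: of_int_times_quat)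

lemma of_int_dvd_cancel_quat:
  assumes "coprime d m" "of_int d dvd of_int m * x" shows "of_int d dvd (x::quat)"
  using assms by (simp add: of_int_dvd_quat of_int_times_quat coprime_dvd_mult_right_iff)

definition qconj :: "quat \<Rightarrow> quat" where
  "qconj x = Quat (qre x) (- qi x) (- qj x) (- qk x)"

definition qnorm :: "quat \<Rightarrow> int" where
  "qnorm x = (qre x)\<^sup>2 + (qi x)\<^sup>2 + (qj x)\<^sup>2 + (qk x)\<^sup>2"

lemma qconj_sel [simp]:
  "qre (qconj x) = qre x" "qi (qconj x) = - qi x" "qj (qconj x) = - qj x" "qk (qconj x) = - qk x"
  by (simp_all add: qconj_def)

lemma qconj_mult: "qconj (x * y) = qconj y * qconj x"
  by (simp add: qconj_def times_quat_def algebra_simps)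

lemma qconj_qconj [simp]: "qconj (qconj x) = x"
  by (cases x) (simp add: qconj_def)

lemma qconj_of_int [simp]: "qconj (of_int d) = of_int d"
  by (simp add: qconj_def of_int_quat)

lemma qconj_pure: "qre x = 0 \<Longrightarrow> qconj x = - x"
  by (simp add: qconj_def uminus_quat_def)

lemma mult_qconj: "x * qconj x = of_int (qnorm x)" "qconj x * x = of_int (qnorm x)"
  by (simp_all add: qconj_def qnorm_def of_int_quat times_quat_def power2_eq_square algebra_simps)

lemma qnorm_mult: "qnorm (x * y) = qnorm x * qnorm y"
  by (simp add: qnorm_def times_quat_def power2_eq_square algebra_simps)

lemma qnorm_qconj [simp]: "qnorm (qconj x) = qnorm x"
  by (simp add: qnorm_def)

lemma qnorm_of_int [simp]: "qnorm (of_int d) = d\<^sup>2"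
  by (simp add: qnorm_def)

lemma qnorm_nonneg: "qnorm x \<ge> 0"
  by (simp add: qnorm_def)

lemma qnorm_eq_0_iff: "qnorm x = 0 \<longleftrightarrow> x = 0"
proof
  assume *: "qnorm x = 0"
  have "(qre x)\<^sup>2 = 0" "(qi x)\<^sup>2 = 0" "(qj x)\<^sup>2 = 0" "(qk x)\<^sup>2 = 0"
    using * zero_le_power2[of "qre x"] zero_le_power2[of "qi x"] zero_le_power2[of "qj x"]
      zero_le_power2[of "qk x"] unfolding qnorm_def by linarith+
  then show "x = 0" by (cases x) (simp add: zero_quat_def)
qed (simp add: qnorm_def)

lemma of_int_dvd_qconj: "of_int d dvd qconj x \<longleftrightarrow> of_int d dvd x"
  by (simp add: of_int_dvd_quat)

lemma of_int_dvd_uminus_quat: "of_int d dvd - x \<longleftrightarrow> of_int d dvd (x::quat)"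
  by (simp add: of_int_dvd_quat)

section \<open>Primitive quaternions and left ideals modulo an odd number\<close>

definition qprim :: "quat \<Rightarrow> bool" where
  "qprim x \<longleftrightarrow> (\<forall>e. of_int e dvd x \<longrightarrow> is_unit e)"

text \<open>The gcd of the coordinates of \<open>x\<close> is 1, and multiplying the coordinates by
  \<open>m\<close> multiplies their gcd by \<open>m\<close>.\<close>

lemma qprim_dvd_scalar:
  assumes "qprim x" "of_int d dvd of_int m * x" shows "d dvd m"
proof -
  have g: "gcd (qre x) (gcd (qi x) (gcd (qj x) (qk x))) = 1" (is "?g = 1")
  proof -
    have "of_int ?g dvd x"
      unfolding of_int_dvd_quat by (meson dvd_trans gcd_dvd1 gcd_dvd2)
    with assms(1) have "is_unit ?g" unfolding qprim_def by blast
    then show ?thesis by simp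
  qed
  have *: "d dvd m * gcd a b \<longleftrightarrow> d dvd m * a \<and> d dvd m * b" for a b
  proof -
    have "d dvd m * gcd a b \<longleftrightarrow> d dvd gcd (m * a) (m * b)"
      by (simp only: gcd_mult_left dvd_normalize_iff)
    then show ?thesis by simp
  qed
  have "d dvd m * ?g" unfolding * using assms(2) by (simp add: of_int_dvd_quat)
  then show ?thesis by (simp only: g mult_1_right)
qed

text \<open>The left ideal of all \<open>\<beta>\<close> with \<open>\<beta> \<alpha> \<equiv> 0\<close> modulo \<open>d\<close> is, for odd \<open>d\<close>,
  generated by an element of norm \<open>d\<close>: the remainder of a division in the Lipschitz order has at
  most the norm of the divisor, with equality only if the quotient is half-integral.\<close>

lemma ideal_norm_dvd:
  assumes "qprim \<alpha>" "of_int d dvd \<beta> * \<alpha>" shows "d dvd qnorm \<beta>"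
proof -
  have "of_int d dvd qconj \<beta> * (\<beta> * \<alpha>)" using assms(2) by (rule of_int_dvd_mult_left)
  also have "qconj \<beta> * (\<beta> * \<alpha>) = of_int (qnorm \<beta>) * \<alpha>"
    by (simp add: mult.assoc[symmetric] mult_qconj)
  finally show ?thesis using assms(1) qprim_dvd_scalar by blast
qed

text \<open>Polarisation: \<open>d\<close> divides the norm on the whole left ideal, hence also
  \<open>2 * qre (u * \<beta> * qconj \<gamma>)\<close>, and the 2 cancels for odd \<open>d\<close>.
  Letting \<open>u\<close> be 1, -i, -j, -k reads off the four coordinates. For
  \<open>qnorm \<beta> = d\<close> the result says that the quotient of \<open>\<gamma>\<close> by
  \<open>\<beta>\<close> is integral.\<close>

lemma ideal_mult_qconj_dvd:
  assumes "qprim \<alpha>" "odd d" and b: "of_int d dvd \<beta> * \<alpha>" "of_int d dvd \<gamma> * \<alpha>"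
  shows "of_int d dvd \<gamma> * qconj \<beta>"
proof -
  have tr: "d dvd qre (u * (\<beta> * qconj \<gamma>))" for u
  proof -
    have "of_int d dvd (u * \<beta> + \<gamma>) * \<alpha>"
    proof -
      have 1: "of_int d dvd u * (\<beta> * \<alpha>)" using b(1) by (rule of_int_dvd_mult_left)
      have "(u * \<beta> + \<gamma>) * \<alpha> = u * (\<beta> * \<alpha>) + \<gamma> * \<alpha>" by (simp add: algebra_simps)
      with 1 b(2) show ?thesis unfolding of_int_dvd_quat by simp
    qed
    then have "d dvd qnorm (u * \<beta> + \<gamma>)" by (rule ideal_norm_dvd[OF assms(1)])
    moreover have "d dvd qnorm (u * \<beta>)"
      using ideal_norm_dvd[OF assms(1) b(1)] by (simp add: qnorm_mult)
    moreover have "d dvd qnorm \<gamma>" using ideal_norm_dvd[OF assms(1) b(2)] .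
    moreover have "qnorm (u * \<beta> + \<gamma>) = qnorm (u * \<beta>) + qnorm \<gamma> + 2 * qre (u * \<beta> * qconj \<gamma>)"
      by (simp add: qnorm_def times_quat_def power2_eq_square algebra_simps)
    ultimately have "d dvd 2 * qre (u * \<beta> * qconj \<gamma>)"
      by (metis dvd_add_right_iff dvd_add)
    with \<open>odd d\<close> show ?thesis by (simp add: mult.assoc coprime_dvd_mult_right_iff)
  qed
  have "of_int d dvd \<beta> * qconj \<gamma>"
    using tr[of 1] tr[of "Quat 0 (-1) 0 0"] tr[of "Quat 0 0 (-1) 0"] tr[of "Quat 0 0 0 (-1)"]
    by (simp add: of_int_dvd_quat times_quat_def algebra_simps)
  then have "of_int d dvd qconj (\<beta> * qconj \<gamma>)" by (simp add: of_int_dvd_qconj)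
  then show ?thesis by (simp add: qconj_mult)
qed

lemma nearest_int:
  fixes y M :: int assumes "M > 0" obtains q where "2 * \<bar>y - M * q\<bar> \<le> M"
proof
  define q where "q = (2 * y + M) div (2 * M)"
  have "(2 * M) * q + (2 * y + M) mod (2 * M) = 2 * y + M" by (simp add: q_def)
  then have "2 * (M * q) + (2 * y + M) mod (2 * M) = 2 * y + M" by (simp only: mult.assoc)
  moreover have "0 \<le> (2 * y + M) mod (2 * M)" "(2 * y + M) mod (2 * M) < 2 * M"
    using assms by simp_all
  ultimately have "- M \<le> 2 * (y - M * q)" "2 * (y - M * q) \<le> M"
    unfolding right_diff_distrib by linarith+
  then show "2 * \<bar>y - M * q\<bar> \<le> M" by (cases "y - M * q \<ge> 0") simp_all
qed

text \<open>Each square is at most a quarter of \<open>M\<^sup>2\<close>. Equality leaves only the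
  coordinates M/2 and -M/2, the one situation in which rounding to integer coordinates does not make
  the norm smaller.\<close>

lemma four_squares_max:
  fixes a b c e M :: int
  assumes "2 * \<bar>a\<bar> \<le> M" "2 * \<bar>b\<bar> \<le> M" "2 * \<bar>c\<bar> \<le> M" "2 * \<bar>e\<bar> \<le> M"
  shows "a\<^sup>2 + b\<^sup>2 + c\<^sup>2 + e\<^sup>2 \<le> M\<^sup>2"
    and "a\<^sup>2 + b\<^sup>2 + c\<^sup>2 + e\<^sup>2 = M\<^sup>2 \<Longrightarrow>
      M dvd 2 * a \<and> M dvd 2 * b \<and> M dvd 2 * c \<and> M dvd 2 * e"
proof -
  have *: "4 * x\<^sup>2 \<le> M\<^sup>2" if "2 * \<bar>x\<bar> \<le> M" for x
  proof -
    have "(2 * \<bar>x\<bar>)\<^sup>2 \<le> M\<^sup>2" using that by (intro power_mono) auto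
    then show ?thesis by (simp add: power_mult_distrib)
  qed
  show "a\<^sup>2 + b\<^sup>2 + c\<^sup>2 + e\<^sup>2 \<le> M\<^sup>2"
    using *[OF assms(1)] *[OF assms(2)] *[OF assms(3)] *[OF assms(4)] by linarith
  assume eq: "a\<^sup>2 + b\<^sup>2 + c\<^sup>2 + e\<^sup>2 = M\<^sup>2"
  have **: "M dvd 2 * x" if "4 * x\<^sup>2 = M\<^sup>2" for x
  proof -
    have "(2 * x)\<^sup>2 = M\<^sup>2" using that by (simp add: power_mult_distrib)
    then have "2 * x = M \<or> 2 * x = - M" by (simp only: power2_eq_iff)
    then show ?thesis by auto
  qed
  have "4 * a\<^sup>2 = M\<^sup>2" "4 * b\<^sup>2 = M\<^sup>2" "4 * c\<^sup>2 = M\<^sup>2" "4 * e\<^sup>2 = M\<^sup>2"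
    using eq *[OF assms(1)] *[OF assms(2)] *[OF assms(3)] *[OF assms(4)] by linarith+
  then show "M dvd 2 * a \<and> M dvd 2 * b \<and> M dvd 2 * c \<and> M dvd 2 * e" using ** by blast
qed

text \<open>Rounding the coordinates of \<open>x * qconj \<beta>\<close> modulo
  \<open>M = qnorm \<beta>\<close> gives a remainder \<open>\<rho>\<close> in the ideal, of norm at
  most \<open>M\<close>. By minimality a nonzero \<open>\<rho>\<close> has norm exactly
  \<open>M\<close>, and then \<open>M\<close> divides \<open>2 * r\<close>. So twice
  \<open>x\<close>, if not \<open>x\<close> itself, is a left multiple of
  \<open>\<beta>\<close>.\<close>

lemma ideal_minimal_right_dvd:
  assumes "of_int d dvd \<beta> * \<alpha>" "\<beta> \<noteq> 0"
    and min: "\<And>\<gamma>. of_int d dvd \<gamma> * \<alpha> \<Longrightarrow> \<gamma> \<noteq> 0 \<Longrightarrow> qnorm \<beta> \<le> qnorm \<gamma>"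
    and "of_int d dvd x * \<alpha>"
  obtains \<omega> where "of_int 2 * x = \<omega> * \<beta>"
proof -
  define M where "M = qnorm \<beta>"
  have "M > 0" unfolding M_def using \<open>\<beta> \<noteq> 0\<close> qnorm_nonneg[of \<beta>] qnorm_eq_0_iff[of \<beta>] by linarith
  define y where "y = x * qconj \<beta>"
  obtain q0 where q0: "2 * \<bar>qre y - M * q0\<bar> \<le> M" using nearest_int[OF \<open>M > 0\<close>] by blast
  obtain q1 where q1: "2 * \<bar>qi y - M * q1\<bar> \<le> M" using nearest_int[OF \<open>M > 0\<close>] by blast
  obtain q2 where q2: "2 * \<bar>qj y - M * q2\<bar> \<le> M" using nearest_int[OF \<open>M > 0\<close>] by blast
  obtain q3 where q3: "2 * \<bar>qk y - M * q3\<bar> \<le> M" using nearest_int[OF \<open>M > 0\<close>] by blast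
  define q where "q = Quat q0 q1 q2 q3"
  define \<rho> where "\<rho> = x - q * \<beta>"
  define r where "r = y - of_int M * q"
  have r: "\<rho> * qconj \<beta> = r"
    unfolding \<rho>_def r_def y_def M_def
    by (simp add: left_diff_distrib mult.assoc mult_qconj mult_of_int_commute)
  have rsel: "qre r = qre y - M * q0" "qi r = qi y - M * q1" "qj r = qj y - M * q2"
    "qk r = qk y - M * q3"
    by (simp_all add: r_def q_def of_int_times_quat)
  have sm: "2 * \<bar>qre r\<bar> \<le> M" "2 * \<bar>qi r\<bar> \<le> M" "2 * \<bar>qj r\<bar> \<le> M" "2 * \<bar>qk r\<bar> \<le> M"
    using q0 q1 q2 q3 by (simp_all add: rsel)
  have nr: "qnorm \<rho> * M = qnorm r" using r by (metis qnorm_mult qnorm_qconj M_def)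
  have "qnorm r \<le> M\<^sup>2" using four_squares_max(1)[OF sm] by (simp add: qnorm_def)
  then have le: "qnorm \<rho> \<le> M" using nr \<open>M > 0\<close>
    by (metis mult_right_le_imp_le power2_eq_square)
  have "of_int d dvd q * (\<beta> * \<alpha>)" by (rule of_int_dvd_mult_left) fact
  then have in_ideal: "of_int d dvd \<rho> * \<alpha>"
    using assms(4) unfolding \<rho>_def left_diff_distrib mult.assoc of_int_dvd_quat by simp
  show thesis
  proof (cases "\<rho> = 0")
    case True
    then have "of_int 2 * x = (of_int 2 * q) * \<beta>" by (simp add: \<rho>_def mult.assoc)
    then show thesis by (rule that)
  next
    case False
    then have "qnorm \<rho> = M" using min[OF in_ideal] le unfolding M_def by simp
    then have "qnorm r = M\<^sup>2" using nr by (simp add: power2_eq_square)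
    then have "of_int M dvd of_int 2 * r"
      using four_squares_max(2)[OF sm] by (simp add: qnorm_def of_int_dvd_quat of_int_times_quat)
    then obtain \<omega> where \<omega>: "of_int 2 * r = of_int M * \<omega>" by (auto simp: dvd_def)
    have "of_int M * (of_int 2 * \<rho>) = of_int 2 * (\<rho> * (qconj \<beta> * \<beta>))"
      unfolding mult_qconj M_def[symmetric] by (metis mult.assoc mult_of_int_commute)
    also have "\<dots> = of_int 2 * r * \<beta>" by (simp only: mult.assoc r[symmetric])
    also have "\<dots> = of_int M * (\<omega> * \<beta>)" by (simp only: \<omega> mult.assoc)
    finally have "of_int 2 * \<rho> = \<omega> * \<beta>"
      using of_int_mult_cancel_quat \<open>M > 0\<close> by (metis less_irrefl)
    then have "of_int 2 * x = (\<omega> + of_int 2 * q) * \<beta>"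
      by (simp add: \<rho>_def algebra_simps)
    then show thesis by (rule that)
  qed
qed

text \<open>Coordinates with even sum split into two pairs with even sums, and the factor 1-i, 1-j
  or 1-k that matches the pairing makes all coordinates even. That factor has norm 2, so halving the
  product halves the norm. Hence an ideal element of least norm has odd norm when \<open>d\<close>
  is odd.\<close>

lemma halve_even_norm:
  assumes "even (qnorm \<beta>)"
  obtains u \<gamma> where "of_int 2 * \<gamma> = u * \<beta>" "2 * qnorm \<gamma> = qnorm \<beta>"
proof -
  obtain a b c e where \<beta>: "\<beta> = Quat a b c e" by (cases \<beta>)
  have ev: "even (a + b + c + e)" using assms by (simp add: \<beta> qnorm_def)
  note found = that
  have fin: thesis if "of_int 2 dvd u * \<beta>" "qnorm u = 2" for u
  proof -
    obtain \<gamma> where \<gamma>: "u * \<beta> = of_int 2 * \<gamma>" using \<open>of_int 2 dvd u * \<beta>\<close> by (auto simp: dvd_def)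
    have "2 * qnorm \<beta> = 2\<^sup>2 * qnorm \<gamma>"
      using arg_cong[OF \<gamma>, of qnorm] \<open>qnorm u = 2\<close> by (simp add: qnorm_mult del: of_int_numeral)
    then show thesis using found[of \<gamma> u] \<gamma> by (simp del: of_int_numeral)
  qed
  consider "even (a + b)" "even (c + e)" | "even (a + c)" "even (b + e)"
    | "even (a + e)" "even (b + c)" using ev by auto
  then show thesis
  proof cases
    case 1
    then show ?thesis
      by (intro fin[of "Quat 1 (-1) 0 0"]) (auto simp: \<beta> of_int_dvd_quat times_quat_def qnorm_def simp del: of_int_numeral)
  next
    case 2
    then show ?thesis
      by (intro fin[of "Quat 1 0 (-1) 0"]) (auto simp: \<beta> of_int_dvd_quat times_quat_def qnorm_def simp del: of_int_numeral)
  next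
    case 3
    then show ?thesis
      by (intro fin[of "Quat 1 0 0 (-1)"]) (auto simp: \<beta> of_int_dvd_quat times_quat_def qnorm_def simp del: of_int_numeral)
  qed
qed

text \<open>An ideal element of least norm works. The ideal contains \<open>d\<close> and also
  \<open>\<alpha>\<close>, because the square of a pure quaternion is minus its norm. Write
  \<open>qnorm \<beta> = d * e\<close> with \<open>e\<close> odd. Since twice \<open>d\<close> is a
  left multiple of \<open>\<beta>\<close>, \<open>e\<close> divides \<open>\<beta>\<close>; since
  twice \<open>\<alpha>\<close> is one too, \<open>e\<close> divides \<open>\<alpha>\<close>, and
  primitivity gives \<open>e = 1\<close>.\<close>

lemma ideal_generator:
  assumes "qprim \<alpha>" "qre \<alpha> = 0" "odd d" "d > 0" "d dvd qnorm \<alpha>"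
  obtains \<beta> where "qnorm \<beta> = d" "of_int d dvd \<beta> * \<alpha>"
proof -
  define I where "I = {\<gamma>. of_int d dvd \<gamma> * \<alpha> \<and> \<gamma> \<noteq> 0}"
  have dI: "of_int d dvd (of_int d :: quat) * \<alpha>" by simp
  have "\<alpha> * \<alpha> = - (\<alpha> * qconj \<alpha>)" using assms(2) by (simp add: qconj_pure)
  then have aI: "of_int d dvd \<alpha> * \<alpha>"
    using assms(5) by (simp add: mult_qconj of_int_dvd_quat)
  have "of_int d \<in> I" using \<open>d > 0\<close> dI by (auto simp: I_def of_int_quat zero_quat_def)
  then obtain \<beta> where \<beta>: "\<beta> \<in> I" and "\<And>\<gamma>. \<gamma> \<in> I \<Longrightarrow> nat (qnorm \<beta>) \<le> nat (qnorm \<gamma>)"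
    using ex_has_least_nat[of "\<lambda>\<gamma>. \<gamma> \<in> I" _ "\<lambda>\<gamma>. nat (qnorm \<gamma>)"] by blast
  then have min: "\<And>\<gamma>. \<gamma> \<in> I \<Longrightarrow> qnorm \<beta> \<le> qnorm \<gamma>"
    using qnorm_nonneg by (simp add: nat_le_eq_zle)
  have bI: "of_int d dvd \<beta> * \<alpha>" and "\<beta> \<noteq> 0" using \<beta> by (auto simp: I_def)
  then have pos: "qnorm \<beta> > 0" using qnorm_nonneg[of \<beta>] qnorm_eq_0_iff[of \<beta>] by linarith
  have odd: "odd (qnorm \<beta>)"
  proof
    assume "even (qnorm \<beta>)"
    then obtain u \<gamma> where \<gamma>: "of_int 2 * \<gamma> = u * \<beta>" "2 * qnorm \<gamma> = qnorm \<beta>"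
      using halve_even_norm by blast
    have "of_int d dvd u * (\<beta> * \<alpha>)" using bI by (rule of_int_dvd_mult_left)
    then have "of_int d dvd of_int 2 * (\<gamma> * \<alpha>)" using \<gamma>(1) by (metis mult.assoc)
    then have "of_int d dvd \<gamma> * \<alpha>"
      by (rule of_int_dvd_cancel_quat[rotated]) (use \<open>odd d\<close> in simp)
    moreover have "\<gamma> \<noteq> 0" using \<gamma>(2) pos qnorm_eq_0_iff[of \<gamma>] by auto
    ultimately have "qnorm \<beta> \<le> qnorm \<gamma>" using min by (simp add: I_def)
    with \<gamma>(2) pos show False by linarith
  qed
  have min': "qnorm \<beta> \<le> qnorm \<gamma>" if "of_int d dvd \<gamma> * \<alpha>" "\<gamma> \<noteq> 0" for \<gamma>
    using min that by (simp add: I_def)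
  have half: "\<exists>\<omega>. of_int 2 * x = \<omega> * \<beta>" if "of_int d dvd x * \<alpha>" for x
    using ideal_minimal_right_dvd[OF bI \<open>\<beta> \<noteq> 0\<close> _ that] min' by blast
  obtain \<omega> where \<omega>: "of_int 2 * of_int d = \<omega> * \<beta>" using half[OF dI] by blast
  obtain \<omega>' where \<omega>': "of_int 2 * \<alpha> = \<omega>' * \<beta>" using half[OF aI] by blast
  obtain e where e: "qnorm \<beta> = d * e" using ideal_norm_dvd[OF assms(1) bI] by (auto simp: dvd_def)
  have "odd e" "e > 0" using odd pos \<open>d > 0\<close> by (auto simp: e zero_less_mult_iff)
  have "of_int d * (of_int 2 * qconj \<beta>) = of_int 2 * of_int d * qconj \<beta>"
    by (metis mult.assoc mult_of_int_commute)
  also have "\<dots> = \<omega> * (\<beta> * qconj \<beta>)" by (simp only: \<omega> mult.assoc)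
  also have "\<dots> = of_int d * (of_int e * \<omega>)"
    by (simp add: mult_qconj e mult.assoc[symmetric] mult_of_int_commute[of _ \<omega>, symmetric] flip: of_int_mult)
  finally have "of_int 2 * qconj \<beta> = of_int e * \<omega>"
    using of_int_mult_cancel_quat \<open>d > 0\<close> by (metis less_irrefl)
  then have "of_int e dvd of_int 2 * qconj \<beta>" by simp
  then have "of_int e dvd qconj \<beta>"
    by (rule of_int_dvd_cancel_quat[rotated]) (use \<open>odd e\<close> in simp)
  then have "of_int e dvd \<beta>" by (simp only: of_int_dvd_qconj)
  then have "of_int e dvd of_int 2 * \<alpha>" unfolding \<omega>' by (rule of_int_dvd_mult_left)
  then have "of_int e dvd \<alpha>"
    by (rule of_int_dvd_cancel_quat[rotated]) (use \<open>odd e\<close> in simp)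
  with assms(1) have "is_unit e" unfolding qprim_def by blast
  with \<open>e > 0\<close> have "e = 1" by simp
  then show thesis using that[of \<beta>] e bI by simp
qed


section \<open>The balanced order, its automorphisms, and conjugation by ideal generators\<close>

text \<open>The pure elements of this order carry the ternary form wanted here. Its only units are
  1, -1, k, -k, so two balanced generators of the same ideal give images that differ at most by
  conjugation with k.\<close>

definition balanced :: "quat \<Rightarrow> bool" where
  "balanced x \<longleftrightarrow> even (qi x - qj x)"

lemma balanced_mult: "balanced x \<Longrightarrow> balanced y \<Longrightarrow> balanced (x * y)"
  by (auto simp: balanced_def times_quat_def)

lemma balanced_qconj [simp]: "balanced (qconj x) \<longleftrightarrow> balanced x"
  by (auto simp add: balanced_def)

text \<open>Balanced quaternions are the order spanned by \<open>1\<close>, \<open>k\<close>, \<open>i + j\<close>, \<open>j - i\<close>, and \<open>emb (a, b, c)\<close> is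
  the pure quaternion \<open>a k + b (i + j) + c (j - i)\<close>, of norm \<open>a\<^sup>2 + 2 b\<^sup>2 + 2 c\<^sup>2\<close>.\<close>

definition emb :: "int \<times> int \<times> int \<Rightarrow> quat" where
  "emb t = (case t of (a, b, c) \<Rightarrow> Quat 0 (b - c) (b + c) a)"

lemma qnorm_emb: "qnorm (emb (a, b, c)) = a\<^sup>2 + 2 * b\<^sup>2 + 2 * c\<^sup>2"
  by (simp add: emb_def qnorm_def power2_eq_square algebra_simps)

lemma qre_emb [simp]: "qre (emb t) = 0"
  by (simp add: emb_def split: prod.split)

lemma emb_inj: "emb t = emb t' \<longleftrightarrow> t = t'"
  by (cases t; cases t') (auto simp: emb_def)

text \<open>Conjugation by \<open>1\<close>, \<open>k\<close>, \<open>i + j\<close>, \<open>j - i\<close>.\<close>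

definition aut :: "bool \<Rightarrow> bool \<Rightarrow> quat \<Rightarrow> quat" where
  "aut s t x = (let e = if t then -1 else 1 in
     if s then Quat (qre x) (e * qj x) (e * qi x) (- qk x)
     else Quat (qre x) (e * qi x) (e * qj x) (qk x))"

lemma aut_mult: "aut s t (x * y) = aut s t x * aut s t y"
  by (simp add: aut_def times_quat_def Let_def algebra_simps)

lemma aut_aut: "aut s t (aut s' t' x) = aut (s \<noteq> s') (t \<noteq> t') x"
  by (simp add: aut_def Let_def)

lemma aut_id [simp]: "aut False False x = x"
  by (simp add: aut_def)

lemma aut_invol [simp]: "aut s t (aut s t x) = x"
  by (simp add: aut_aut)

lemma qnorm_aut [simp]: "qnorm (aut s t x) = qnorm x"
  by (simp add: aut_def qnorm_def Let_def)

lemma balanced_aut [simp]: "balanced (aut s t x) \<longleftrightarrow> balanced x"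
  by (simp add: aut_def balanced_def Let_def) blast

lemma of_int_dvd_aut: "of_int d dvd aut s t x \<longleftrightarrow> of_int d dvd x"
  by (auto simp add: aut_def of_int_dvd_quat Let_def)

lemma aut_emb: "aut s t (emb (a, b, c)) =
    emb (if s then - a else a, if t then - b else b, if s \<noteq> t then - c else c)"
  by (simp add: aut_def emb_def)

lemma aut_uminus: "aut s t (- x) = - aut s t x"
  by (simp add: aut_def uminus_quat_def Let_def)

lemma qre_aut [simp]: "qre (aut s t x) = qre x"
  by (simp add: aut_def Let_def)

lemma qprim_aut: "qprim (aut s t x) \<longleftrightarrow> qprim x"
  by (simp add: qprim_def of_int_dvd_aut)

text \<open>\<open>transf d \<alpha> \<alpha>'\<close> means \<open>\<alpha>' = \<beta> \<alpha> \<beta>\<^sup>-\<^sup>1\<close> for a generator \<open>\<beta>\<close> of the ideal belonging to \<open>d\<close>: it is the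
  action of the ramified ideal of norm \<open>d\<close> of \<open>\<int>[\<surd>-N]\<close> on the pure quaternions of norm \<open>N\<close>.\<close>

definition transf :: "int \<Rightarrow> quat \<Rightarrow> quat \<Rightarrow> bool" where
  "transf d \<alpha> \<alpha>' \<longleftrightarrow>
     (\<exists>\<beta>. balanced \<beta> \<and> qnorm \<beta> = d \<and> \<beta> * \<alpha> = \<alpha>' * \<beta> \<and> of_int d dvd \<beta> * \<alpha>)"

lemma transf_aut: "transf d \<alpha> \<alpha>' \<Longrightarrow> transf d (aut s t \<alpha>) (aut s t \<alpha>')"
  unfolding transf_def by (metis aut_mult balanced_aut of_int_dvd_aut qnorm_aut)

lemma transf_uminus: "transf d \<alpha> \<alpha>' \<Longrightarrow> transf d (- \<alpha>) (- \<alpha>')"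
  unfolding transf_def by (metis minus_mult_left minus_mult_right of_int_dvd_uminus_quat)

text \<open>Conjugation negates pure quaternions, so \<open>qconj \<beta>\<close> leads back: a
  ramified ideal equals its conjugate. This is why each \<open>d\<close> acts as an
  involution.\<close>

lemma transf_sym:
  assumes "transf d \<alpha> \<alpha>'" "qre \<alpha> = 0" "qre \<alpha>' = 0" shows "transf d \<alpha>' \<alpha>"
proof -
  obtain \<beta> where b: "balanced \<beta>" "qnorm \<beta> = d" "\<beta> * \<alpha> = \<alpha>' * \<beta>" "of_int d dvd \<beta> * \<alpha>"
    using assms(1) by (auto simp: transf_def)
  have "qconj (\<beta> * \<alpha>) = qconj (\<alpha>' * \<beta>)" by (simp add: b(3))
  then have eq: "qconj \<beta> * \<alpha>' = \<alpha> * qconj \<beta>"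
    using assms(2,3) by (simp add: qconj_mult qconj_pure)
  moreover have "of_int d dvd qconj (\<beta> * \<alpha>)" using b(4) by (simp only: of_int_dvd_qconj)
  then have "of_int d dvd qconj \<beta> * \<alpha>'"
    using assms(2) by (simp add: qconj_mult qconj_pure eq of_int_dvd_uminus_quat)
  ultimately show ?thesis unfolding transf_def using b(1,2)
    by (intro exI[of _ "qconj \<beta>"]) simp
qed

text \<open>The product \<open>\<gamma> * \<beta>\<close> serves: \<open>d\<close> already divides
  \<open>\<beta> * \<alpha>\<close>, \<open>e\<close> appears after \<open>\<alpha>\<close> has been
  moved past \<open>\<beta>\<close>, and coprimality joins the two divisors.\<close>

lemma transf_trans:
  assumes "transf d \<alpha> \<alpha>'" "transf e \<alpha>' \<alpha>''" "coprime d e" shows "transf (e * d) \<alpha> \<alpha>''"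
proof -
  obtain \<beta> where b: "balanced \<beta>" "qnorm \<beta> = d" "\<beta> * \<alpha> = \<alpha>' * \<beta>" "of_int d dvd \<beta> * \<alpha>"
    using assms(1) by (auto simp: transf_def)
  obtain \<gamma> where c: "balanced \<gamma>" "qnorm \<gamma> = e" "\<gamma> * \<alpha>' = \<alpha>'' * \<gamma>" "of_int e dvd \<gamma> * \<alpha>'"
    using assms(2) by (auto simp: transf_def)
  have eq: "\<gamma> * \<beta> * \<alpha> = \<gamma> * \<alpha>' * \<beta>" by (simp add: mult.assoc b(3))
  have "of_int d dvd \<gamma> * \<beta> * \<alpha>" using of_int_dvd_mult_left[OF b(4)] by (simp add: mult.assoc)
  moreover have "of_int e dvd \<gamma> * \<beta> * \<alpha>" unfolding eq by (rule of_int_dvd_mult_right) fact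
  ultimately have "of_int (e * d) dvd \<gamma> * \<beta> * \<alpha>"
    using assms(3) unfolding of_int_dvd_quat by (simp add: divides_mult coprime_commute)
  moreover have "\<gamma> * \<beta> * \<alpha> = \<alpha>'' * (\<gamma> * \<beta>)" by (metis b(3) c(3) mult.assoc)
  ultimately show ?thesis unfolding transf_def
    by (intro exI[of _ "\<gamma> * \<beta>"]) (simp add: balanced_mult b c qnorm_mult)
qed

lemma balanced_unit:
  assumes "balanced \<delta>" "qnorm \<delta> = 1" "\<delta> * \<alpha> = \<alpha>' * \<delta>"
  shows "\<alpha>' = \<alpha> \<or> \<alpha>' = aut False True \<alpha>"
proof -
  obtain p q r s where d: "\<delta> = Quat p q r s" by (cases \<delta>)
  have n: "p\<^sup>2 + q\<^sup>2 + r\<^sup>2 + s\<^sup>2 = 1" and e: "even (q - r)"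
    using assms by (simp_all add: d qnorm_def balanced_def)
  have small: "x\<^sup>2 \<le> 1 \<Longrightarrow> x = 0 \<or> x = 1 \<or> x = -1" for x :: int
    by (auto simp: abs_square_le_1)
  have c: "p = 0 \<or> p = 1 \<or> p = -1" "q = 0 \<or> q = 1 \<or> q = -1" "r = 0 \<or> r = 1 \<or> r = -1"
    "s = 0 \<or> s = 1 \<or> s = -1"
    using n zero_le_power2[of p] zero_le_power2[of q] zero_le_power2[of r] zero_le_power2[of s]
    by (intro small; linarith)+
  have "\<delta> = Quat 1 0 0 0 \<or> \<delta> = Quat (-1) 0 0 0 \<or> \<delta> = Quat 0 0 0 1 \<or> \<delta> = Quat 0 0 0 (-1)"
    using c by (elim disjE) (use n e d in simp_all)
  then show ?thesis using assms(3)
    by (cases \<alpha>; cases \<alpha>'; elim disjE) (simp_all add: times_quat_def aut_def)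
qed

text \<open>The quotient \<open>\<delta>\<close> of the two generators is integral by
  \<open>ideal_mult_qconj_dvd\<close>, has norm 1, and is balanced because \<open>d\<close> is odd.
  It conjugates one image into the other, so they agree up to a balanced unit.\<close>

lemma transf_unique:
  assumes "qprim \<alpha>" "odd d" "d > 0" "transf d \<alpha> \<alpha>'" "transf d \<alpha> \<alpha>''" "qre \<alpha> = 0" "qre \<alpha>' = 0"
  shows "\<alpha>'' = \<alpha>' \<or> \<alpha>'' = aut False True \<alpha>'"
proof -
  obtain \<beta> where b: "balanced \<beta>" "qnorm \<beta> = d" "\<beta> * \<alpha> = \<alpha>' * \<beta>" "of_int d dvd \<beta> * \<alpha>"
    using assms(4) by (auto simp: transf_def)
  obtain \<gamma> where c: "balanced \<gamma>" "qnorm \<gamma> = d" "\<gamma> * \<alpha> = \<alpha>'' * \<gamma>" "of_int d dvd \<gamma> * \<alpha>"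
    using assms(5) by (auto simp: transf_def)
  obtain \<delta> where \<delta>: "\<gamma> * qconj \<beta> = of_int d * \<delta>"
    using ideal_mult_qconj_dvd[OF assms(1,2) b(4) c(4)] by (auto simp: dvd_def)
  have "d * d = d\<^sup>2 * qnorm \<delta>"
    using arg_cong[OF \<delta>, of qnorm] by (simp add: qnorm_mult b c)
  then have 1: "qnorm \<delta> = 1" using \<open>d > 0\<close> by (simp add: power2_eq_square)
  have "balanced (of_int d * \<delta>)" unfolding \<delta>[symmetric] using b c by (simp add: balanced_mult)
  then have 2: "balanced \<delta>" using \<open>odd d\<close>
    by (simp add: balanced_def flip: right_diff_distrib)
  have "qconj (\<beta> * \<alpha>) = qconj (\<alpha>' * \<beta>)" by (simp add: b(3))
  then have eq: "qconj \<beta> * \<alpha>' = \<alpha> * qconj \<beta>"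
    using assms by (simp add: qconj_mult qconj_pure)
  have "of_int d * (\<delta> * \<alpha>') = \<gamma> * (qconj \<beta> * \<alpha>')" by (simp add: \<delta> mult.assoc[symmetric])
  also have "\<dots> = \<alpha>'' * (\<gamma> * qconj \<beta>)" by (simp add: eq c(3) mult.assoc[symmetric])
  also have "\<dots> = of_int d * (\<alpha>'' * \<delta>)" by (metis \<delta> mult.assoc mult_of_int_commute)
  finally have "\<delta> * \<alpha>' = \<alpha>'' * \<delta>"
    using of_int_mult_cancel_quat \<open>d > 0\<close> by (metis less_irrefl)
  then show ?thesis using balanced_unit[OF 2 1] by blast
qed

text \<open>For odd norm exactly one of \<open>\<beta>\<close> and \<open>?i * \<beta>\<close> is
  balanced: the two parity conditions together involve each coordinate once, and the sum of all
  coordinates is odd.\<close>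

lemma balanced_generator:
  assumes "qprim \<alpha>" "qre \<alpha> = 0" "odd d" "d > 0" "d dvd qnorm \<alpha>"
  obtains \<beta> where "balanced \<beta>" "qnorm \<beta> = d" "of_int d dvd \<beta> * \<alpha>"
proof -
  obtain \<beta> where b: "qnorm \<beta> = d" "of_int d dvd \<beta> * \<alpha>" using ideal_generator[OF assms] by blast
  show thesis
  proof (cases "balanced \<beta>")
    case True
    with b that show thesis by blast
  next
    case False
    let ?i = "Quat 0 1 0 0"
    have "balanced (?i * \<beta>)" using False b(1) \<open>odd d\<close>
      by (auto simp: balanced_def times_quat_def qnorm_def)
    moreover have "qnorm (?i * \<beta>) = d" using b(1) by (simp add: qnorm_mult) (simp add: qnorm_def)
    moreover have "of_int d dvd ?i * \<beta> * \<alpha>"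
      using of_int_dvd_mult_left[OF b(2)] by (simp add: mult.assoc)
    ultimately show thesis using that by blast
  qed
qed

text \<open>From \<open>\<beta> * \<alpha> = d * \<eta>\<close> the conjugate of \<alpha> by \<beta>
  is \<open>\<eta> * qconj \<beta>\<close>, hence integral. Coprimality of \<open>d\<close> and
  \<open>m\<close> preserves primitivity, and the parities of the last two coordinates survive
  because \<open>d\<close> is odd.\<close>

lemma transf_exists:
  assumes "qprim (emb (a, b, c))" "odd d" "d > 0" "qnorm (emb (a, b, c)) = d * m" "coprime d m"
    "m \<noteq> 0" "odd b" "even c"
  obtains a' b' c' where "transf d (emb (a, b, c)) (emb (a', b', c'))"
    "qprim (emb (a', b', c'))" "qnorm (emb (a', b', c')) = d * m" "odd b'" "even c'"
proof -
  let ?\<alpha> = "emb (a, b, c)"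
  obtain \<beta> where \<beta>: "balanced \<beta>" "qnorm \<beta> = d" "of_int d dvd \<beta> * ?\<alpha>"
    using balanced_generator[OF assms(1) _ assms(2,3)] assms(4) by auto
  obtain \<eta> where \<eta>: "\<beta> * ?\<alpha> = of_int d * \<eta>" using \<beta>(3) by (auto simp: dvd_def)
  define \<alpha>' where "\<alpha>' = \<eta> * qconj \<beta>"
  have conj: "of_int d * \<alpha>' = \<beta> * ?\<alpha> * qconj \<beta>"
    by (simp add: \<alpha>'_def \<eta> mult.assoc)
  have comm: "\<beta> * ?\<alpha> = \<alpha>' * \<beta>"
    by (simp add: \<alpha>'_def mult.assoc mult_qconj \<beta>(2) \<eta> mult_of_int_commute)
  have "d * (d * m) = d\<^sup>2 * qnorm \<eta>"
    using arg_cong[OF \<eta>, of qnorm] by (simp add: qnorm_mult \<beta>(2) assms(4))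
  then have n\<eta>: "qnorm \<eta> = m" using \<open>d > 0\<close> by (simp add: power2_eq_square)
  then have n': "qnorm \<alpha>' = d * m" by (simp add: \<alpha>'_def qnorm_mult \<beta>(2))
  have "of_int d * ?\<alpha> = qconj \<beta> * (\<beta> * ?\<alpha>)"
    by (simp add: mult.assoc[symmetric] mult_qconj \<beta>(2))
  then have "of_int d * ?\<alpha> = of_int d * (qconj \<beta> * \<eta>)"
    unfolding \<eta> by (metis mult.assoc mult_of_int_commute)
  then have \<alpha>: "?\<alpha> = qconj \<beta> * \<eta>" using of_int_mult_cancel_quat \<open>d > 0\<close> by (metis less_irrefl)
  \<comment> \<open>A scalar divisor of \<open>\<alpha>'\<close> divides \<open>m\<close>, as seen
    by multiplying with \<open>qconj \<eta>\<close> on the left, and divides \<open>d\<close>, as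
    seen by conjugating back with \<open>\<beta>\<close>.\<close>
  have prim: "qprim \<alpha>'"
    unfolding qprim_def
  proof (intro allI impI)
    fix e assume e: "of_int e dvd \<alpha>'"
    have "of_int e dvd qconj \<eta> * \<alpha>'" using e by (rule of_int_dvd_mult_left)
    then have "of_int e dvd of_int m * qconj \<beta>"
      by (simp add: \<alpha>'_def mult.assoc[symmetric] mult_qconj n\<eta>)
    then have "of_int e dvd of_int m * qconj \<beta> * \<eta>" by (rule of_int_dvd_mult_right)
    then have "of_int e dvd of_int m * ?\<alpha>" by (simp add: \<alpha> mult.assoc)
    then have 1: "e dvd m" by (rule qprim_dvd_scalar[OF assms(1)])
    have "of_int d * ?\<alpha> = qconj \<beta> * (\<alpha>' * \<beta>)"
      by (simp add: comm[symmetric] mult.assoc[symmetric] mult_qconj \<beta>(2))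
    then have "of_int e dvd of_int d * ?\<alpha>"
      using of_int_dvd_mult_left[OF of_int_dvd_mult_right[OF e]] by metis
    then have "e dvd d" by (rule qprim_dvd_scalar[OF assms(1)])
    with 1 \<open>coprime d m\<close> show "is_unit e" by (meson coprime_common_divisor)
  qed
  obtain r s where rs: "qi \<beta> = r - s" "qj \<beta> = r + s"
  proof -
    have "even (qj \<beta> - qi \<beta>)" using \<beta>(1) by (simp add: balanced_def)
    then obtain s where "qj \<beta> - qi \<beta> = 2 * s" by (elim evenE)
    then have "qi \<beta> = (qi \<beta> + s) - s" "qj \<beta> = (qi \<beta> + s) + s" by linarith+
    then show thesis by (rule that)
  qed
  define p q where "p = qre \<beta>" and "q = qk \<beta>"
  have d: "d = p\<^sup>2 + q\<^sup>2 + 2 * r\<^sup>2 + 2 * s\<^sup>2"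
    using \<beta>(2) by (simp add: qnorm_def rs p_def q_def power2_eq_square algebra_simps)
  have \<beta>': "\<beta> = Quat p (r - s) (r + s) q" by (cases \<beta>) (use rs in \<open>simp add: p_def q_def\<close>)
  \<comment> \<open>\<open>B\<close> and \<open>C\<close> are \<open>d\<close> times the new second
    and third coordinates, written so that they are visibly congruent to \<open>b * d\<close> and
    \<open>c * d\<close> modulo 2.\<close>
  define B where "B = b * d + 2 * (r * (q * a + 2 * r * b + 2 * s * c) - (q\<^sup>2 + 2 * r\<^sup>2 + 2 * s\<^sup>2) * b + p * (s * a - q * c))"
  define C where "C = c * d + 2 * (s * (q * a + 2 * r * b + 2 * s * c) - (q\<^sup>2 + 2 * r\<^sup>2 + 2 * s\<^sup>2) * c + p * (q * b - r * a))"
  have "qre (of_int d * \<alpha>') = 0"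
    unfolding conj by (simp add: \<beta>' emb_def times_quat_def algebra_simps)
  then have re: "qre \<alpha>' = 0" using \<open>d > 0\<close> by simp
  have "qi (\<beta> * ?\<alpha> * qconj \<beta>) = B - C" "qj (\<beta> * ?\<alpha> * qconj \<beta>) = B + C"
    unfolding B_def C_def d
    by (simp_all add: \<beta>' emb_def times_quat_def power2_eq_square algebra_simps)
  then have BC: "d * qi \<alpha>' = B - C" "d * qj \<alpha>' = B + C"
    unfolding conj[symmetric] by simp_all
  have par: "odd B" "even C" using assms by (auto simp: B_def C_def)
  have "even (d * (qj \<alpha>' - qi \<alpha>'))" unfolding right_diff_distrib BC by simp
  then obtain c' where c': "qj \<alpha>' - qi \<alpha>' = 2 * c'"
    using \<open>odd d\<close> by (metis evenE even_mult_iff)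
  define b' where "b' = qi \<alpha>' + c'"
  have \<alpha>': "\<alpha>' = emb (qk \<alpha>', b', c')"
    by (cases \<alpha>') (use re c' in \<open>simp add: emb_def b'_def\<close>)
  have "2 * (d * b') = d * (2 * qi \<alpha>' + (qj \<alpha>' - qi \<alpha>'))" unfolding c' b'_def by (simp add: algebra_simps)
  also have "\<dots> = 2 * B" using BC by (simp add: algebra_simps)
  finally have "d * b' = B" by simp
  then have "odd b'" using par by auto
  have "2 * (d * c') = d * (qj \<alpha>' - qi \<alpha>')" unfolding c' by simp
  also have "\<dots> = 2 * C" using BC by (simp add: algebra_simps)
  finally have "d * c' = C" by simp
  then have "even c'" using par \<open>odd d\<close> by auto
  have "transf d ?\<alpha> \<alpha>'" unfolding transf_def using \<beta> comm by blast
  with prim n' \<open>odd b'\<close> \<open>even c'\<close> show thesis using that[of "qk \<alpha>'" b' c'] \<alpha>' by metis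
qed

text \<open>Commuting means that the imaginary parts have vanishing cross product. Primitivity gives
  a Bezout relation among the coordinates of \<open>\<alpha>\<close>, which makes the factor of
  proportionality an integer.\<close>

lemma parallel_prim:
  assumes "qprim \<alpha>" "qre \<alpha> = 0" "\<delta> * \<alpha> = \<alpha> * \<delta>"
  obtains m where "\<delta> = of_int (qre \<delta>) + of_int m * \<alpha>"
proof -
  obtain u v w where \<alpha>: "\<alpha> = Quat 0 u v w" using assms(2) by (cases \<alpha>) auto
  obtain p x y z where \<delta>: "\<delta> = Quat p x y z" by (cases \<delta>)
  have cr: "y * w = z * v" "z * u = x * w" "x * v = y * u"
    using assms(3) by (simp_all add: \<alpha> \<delta> times_quat_def) (simp_all add: mult.commute)
  have g: "gcd u (gcd v w) = 1"
  proof -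
    have "of_int (gcd u (gcd v w)) dvd \<alpha>"
      unfolding of_int_dvd_quat \<alpha> quat.sel by (meson dvd_trans gcd_dvd1 gcd_dvd2 dvd_0_right)
    with assms(1) have "is_unit (gcd u (gcd v w))" unfolding qprim_def by blast
    then show ?thesis by simp
  qed
  obtain k l where "k * v + l * w = gcd v w" using bezout_int by blast
  moreover obtain k' l' where "k' * u + l' * gcd v w = gcd u (gcd v w)" using bezout_int by blast
  ultimately obtain A B C where bz: "A * u + B * v + C * w = 1"
    using g by (metis distrib_left mult.assoc add.assoc)
  define m where "m = x * A + y * B + z * C"
  have "x = m * u" "y = m * v" "z = m * w"
    unfolding m_def using cr bz by algebra+
  then have "\<delta> = of_int (qre \<delta>) + of_int m * \<alpha>"
    by (simp add: \<alpha> \<delta> of_int_quat times_quat_def plus_quat_def)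
  then show thesis by (rule that)
qed

text \<open>With \<open>\<epsilon>\<close> of norm 1 or 2 undoing \<open>aut s t\<close>, the
  product \<open>\<delta> = \<epsilon> * \<beta>\<close> commutes with \<open>\<alpha>\<close>, so
  \<open>\<delta> = x + m * \<alpha>\<close> with integers x and m. Its norm x^2 + m^2
  \<open>qnorm \<alpha>\<close> is \<open>d\<close> or \<open>2 * d\<close>, and the lower bound on
  \<open>qnorm \<alpha>\<close> forces m = 0. Then \<open>d\<close> or \<open>2 * d\<close> is a
  square, the latter being impossible for odd \<open>d\<close>.\<close>

lemma transf_not_fixed:
  assumes "qprim \<alpha>" "qre \<alpha> = 0" "odd d" "\<nexists>x. d = x\<^sup>2" "qnorm \<alpha> > 2 * d"
  shows "\<not> transf d \<alpha> (aut s t \<alpha>)"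
proof
  assume "transf d \<alpha> (aut s t \<alpha>)"
  then obtain \<beta> where b: "qnorm \<beta> = d" "\<beta> * \<alpha> = aut s t \<alpha> * \<beta>" by (auto simp: transf_def)
  have "d \<ge> 0" using b(1) qnorm_nonneg by metis
  define \<epsilon> where "\<epsilon> = (if s then Quat 0 1 (if t then -1 else 1) 0
                      else if t then Quat 0 0 0 1 else Quat 1 0 0 0)"
  have \<epsilon>: "\<epsilon> * aut s t \<alpha> = \<alpha> * \<epsilon>"
    using assms(2) by (simp add: \<epsilon>_def aut_def times_quat_def)
  define \<delta> where "\<delta> = \<epsilon> * \<beta>"
  have "\<delta> * \<alpha> = \<alpha> * \<delta>" unfolding \<delta>_def using b(2) \<epsilon> by (metis mult.assoc)
  then obtain m where m: "\<delta> = of_int (qre \<delta>) + of_int m * \<alpha>"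
    using parallel_prim[OF assms(1,2)] by blast
  have "qnorm \<delta> = qnorm (of_int (qre \<delta>) + of_int m * \<alpha>)" using m by simp
  also have "\<dots> = (qre \<delta>)\<^sup>2 + m\<^sup>2 * qnorm \<alpha>"
    using assms(2) by (simp add: qnorm_def power2_eq_square algebra_simps)
  finally have n: "qnorm \<delta> = (qre \<delta>)\<^sup>2 + m\<^sup>2 * qnorm \<alpha>" .
  have "qnorm \<epsilon> = 1 \<or> qnorm \<epsilon> = 2" by (simp add: \<epsilon>_def qnorm_def)
  then have d12: "qnorm \<delta> = d \<or> qnorm \<delta> = 2 * d" by (auto simp: \<delta>_def qnorm_mult b(1))
  have "m = 0"
  proof (rule ccontr)
    assume "m \<noteq> 0"
    then have "m\<^sup>2 \<ge> 1" by (smt (verit) zero_less_power2)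
    then have "m\<^sup>2 * qnorm \<alpha> \<ge> qnorm \<alpha>" using qnorm_nonneg[of \<alpha>] by (simp add: mult_le_cancel_right1)
    with n d12 assms(5) \<open>d \<ge> 0\<close> zero_le_power2[of "qre \<delta>"] show False by linarith
  qed
  then have "d = (qre \<delta>)\<^sup>2 \<or> 2 * d = (qre \<delta>)\<^sup>2" using n d12 by auto
  then show False
  proof
    assume *: "2 * d = (qre \<delta>)\<^sup>2"
    then have "even ((qre \<delta>)\<^sup>2)" by (metis dvd_triv_left)
    then obtain k where "qre \<delta> = 2 * k" by auto
    with * have "d = 2 * k\<^sup>2" by (simp add: power2_eq_square)
    with \<open>odd d\<close> show False by simp
  qed (use assms(4) in blast)
qed

section \<open>A ternary quadratic form\<close>

text \<open>An orbit of the sign changes \<open>aut\<close> with nonzero first two coordinates has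
  exactly one member with both of them positive, so \<open>c\<close> has to keep its sign. The
  parities fit two uses: a^2 + 2 b^2 + 8 c^2 = n fits after doubling c, and a^2 + 2 b^2 + 4 c^2 = n
  after rewriting it as (2 b)^2 + 2 a^2 + 2 (2 c)^2 = 2 n.\<close>

definition reps :: "int \<Rightarrow> (int \<times> int \<times> int) set" where
  "reps N = {(a, b, c). a\<^sup>2 + 2 * b\<^sup>2 + 2 * c\<^sup>2 = N \<and> 0 < a \<and> 0 < b \<and> odd b \<and> even c}"

lemma finite_reps: "finite (reps N)"
proof (rule finite_subset)
  show "reps N \<subseteq> {-N..N} \<times> {-N..N} \<times> {-N..N}"
  proof (clarsimp simp: reps_def, goal_cases)
    case (1 a b c)
    have "c\<^sup>2 = (- c)\<^sup>2" by simp
    then show ?case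
      using 1 le_square_int[of a] le_square_int[of b] le_square_int[of c] le_square_int[of "-c"]
        zero_le_power2[of a] zero_le_power2[of b] zero_le_power2[of c] by linarith
  qed
qed simp

section \<open>Involutions on primitive representations\<close>

definition prim_reps :: "int \<Rightarrow> (int \<times> int \<times> int) set" where
  "prim_reps N = {t \<in> reps N. qprim (emb t)}"

text \<open>The three coordinates of \<open>emb t\<close> are normalised by the four automorphisms \<open>aut\<close> to positive first
  two coordinates, so on \<open>prim_reps N\<close> the relation \<open>linked d\<close> is the graph of an involution.\<close>

definition linked :: "int \<Rightarrow> int \<times> int \<times> int \<Rightarrow> int \<times> int \<times> int \<Rightarrow> bool" where
  "linked d t t' \<longleftrightarrow> (\<exists>s u. transf d (emb t) (aut s u (emb t')))"

lemma aut_emb_reps_unique: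
  assumes "t \<in> reps N" "t' \<in> reps N" "aut s u (emb t) = emb t'" shows "t = t'"
  using assms by (cases t; cases t') (auto simp: reps_def aut_emb emb_inj split: if_splits)

lemma linked_unique:
  assumes "odd d" "d > 0" "t \<in> prim_reps N" "t' \<in> prim_reps N" "t'' \<in> prim_reps N"
    "linked d t t'" "linked d t t''"
  shows "t' = t''"
proof -
  obtain s u where 1: "transf d (emb t) (aut s u (emb t'))" using assms by (auto simp: linked_def)
  obtain s' u' where 2: "transf d (emb t) (aut s' u' (emb t''))"
    using assms by (auto simp: linked_def)
  have "aut s' u' (emb t'') = aut s u (emb t') \<or>
      aut s' u' (emb t'') = aut False True (aut s u (emb t'))"
    by (rule transf_unique[OF _ assms(1,2) 1 2]) (use assms in \<open>auto simp: prim_reps_def\<close>)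
  then obtain s1 u1 where "aut s' u' (emb t'') = aut s1 u1 (emb t')" by (auto simp: aut_aut)
  then have "aut s' u' (aut s' u' (emb t'')) = aut s' u' (aut s1 u1 (emb t'))" by simp
  then have "emb t'' = aut (s' \<noteq> s1) (u' \<noteq> u1) (emb t')" by (simp only: aut_aut aut_invol) (simp add: aut_aut)
  then show ?thesis using aut_emb_reps_unique assms by (metis (no_types, lifting) mem_Collect_eq prim_reps_def)
qed

lemma linked_sym: "linked d t t' \<Longrightarrow> linked d t' t"
proof -
  assume "linked d t t'"
  then obtain s u where "transf d (emb t) (aut s u (emb t'))" by (auto simp: linked_def)
  then have "transf d (aut s u (emb t')) (emb t)" by (rule transf_sym) simp_all
  then have "transf d (aut s u (aut s u (emb t'))) (aut s u (emb t))" by (rule transf_aut)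
  then show ?thesis by (auto simp: linked_def)
qed

lemma linked_trans:
  assumes "linked d t t'" "linked e t' t''" "coprime d e" shows "linked (e * d) t t''"
proof -
  obtain s u where 1: "transf d (emb t) (aut s u (emb t'))" using assms by (auto simp: linked_def)
  obtain s' u' where "transf e (emb t') (aut s' u' (emb t''))"
    using assms by (auto simp: linked_def)
  then have "transf e (aut s u (emb t')) (aut s u (aut s' u' (emb t'')))" by (rule transf_aut)
  from transf_trans[OF 1 this assms(3)] show ?thesis by (auto simp: linked_def aut_aut)
qed

lemma linked_irrefl:
  assumes "t \<in> prim_reps N" "odd d" "\<nexists>x. d = x\<^sup>2" "N > 2 * d" shows "\<not> linked d t t"
proof -
  have "qnorm (emb t) = N" using assms(1) by (cases t) (simp add: prim_reps_def reps_def qnorm_emb)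
  then show ?thesis unfolding linked_def
    using transf_not_fixed assms by (auto simp: prim_reps_def)
qed

lemma linked_exists:
  assumes "t \<in> prim_reps N" "odd d" "d > 0" "N = d * m" "coprime d m" "N mod 8 \<noteq> 2"
  shows "\<exists>t' \<in> prim_reps N. linked d t t'"
proof -
  obtain a b c where t: "t = (a, b, c)" by (cases t)
  have abc: "a\<^sup>2 + 2 * b\<^sup>2 + 2 * c\<^sup>2 = N" "a > 0" "b > 0" "odd b" "even c" "qprim (emb (a, b, c))"
    using assms(1) by (simp_all add: t prim_reps_def reps_def)
  have "N > 0" using abc(1,2) by (smt (verit) zero_le_power2 zero_less_power)
  then have "m \<noteq> 0" using assms(4) by auto
  obtain a' b' c' where tr: "transf d (emb t) (emb (a', b', c'))"
    and pr: "qprim (emb (a', b', c'))" and n: "qnorm (emb (a', b', c')) = N" and "odd b'" "even c'"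
    using transf_exists[of a b c d m] abc assms(2-5) \<open>m \<noteq> 0\<close> unfolding t qnorm_emb by metis
  \<comment> \<open>A vanishing first coordinate could not be made positive. It would give N = 2
    b'^2 + 2 c'^2 with b' odd and c' even, which is 2 modulo 8; hence the excluded residue.\<close>
  have "a' \<noteq> 0"
  proof
    assume "a' = 0"
    then have N: "N = 2 * b'\<^sup>2 + 2 * c'\<^sup>2" using n by (simp add: qnorm_emb)
    obtain k l where "b' = 2 * k + 1" "c' = 2 * l" using \<open>odd b'\<close> \<open>even c'\<close> by (auto elim!: oddE)
    then have "N = 2 + 8 * l\<^sup>2 + 8 * (k\<^sup>2 + k)"
      by (simp add: N power2_eq_square algebra_simps)
    then have "N = 2 + 8 * (l\<^sup>2 + k\<^sup>2 + k)" by simp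
    then have "N mod 8 = 2" by (metis mod_mult_self2 mod_pos_pos_trivial zero_le_numeral numeral_less_iff semiring_norm(76) semiring_norm(78))
    with assms(6) show False by blast
  qed
  have "b' \<noteq> 0" using \<open>odd b'\<close> by auto
  define s u where "s = (a' < 0)" and "u = (b' < 0)"
  define t' where "t' = (\<bar>a'\<bar>, \<bar>b'\<bar>, if s \<noteq> u then - c' else c')"
  have e: "emb t' = aut s u (emb (a', b', c'))"
    by (simp add: t'_def aut_emb s_def u_def abs_if)
  have "t' \<in> reps N"
    using n \<open>odd b'\<close> \<open>even c'\<close> \<open>a' \<noteq> 0\<close> \<open>b' \<noteq> 0\<close> by (auto simp: t'_def reps_def qnorm_emb)
  then have "t' \<in> prim_reps N" using pr by (simp add: prim_reps_def e qprim_aut)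
  moreover have "linked d t t'"
    unfolding linked_def using tr by (intro exI[of _ s] exI[of _ u]) (simp add: e)
  ultimately show ?thesis by blast
qed

definition flip :: "int \<times> int \<times> int \<Rightarrow> int \<times> int \<times> int" where
  "flip t = (case t of (a, b, c) \<Rightarrow> (a, b, - c))"

lemma flip_reps: "flip t \<in> reps N \<longleftrightarrow> t \<in> reps N"
  by (simp add: flip_def reps_def split: prod.split)

lemma emb_flip: "emb (flip t) = - aut True True (emb t)"
  by (cases t) (simp add: flip_def emb_def aut_def uminus_quat_def)

lemma flip_prim_reps: "flip t \<in> prim_reps N \<longleftrightarrow> t \<in> prim_reps N"
  by (simp add: prim_reps_def flip_reps emb_flip qprim_def of_int_dvd_uminus_quat of_int_dvd_aut)

text \<open>Changing the sign of the last coordinate is, up to \<open>aut\<close>, negation of the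
  quaternion. The involutions therefore commute with \<open>flip\<close> and also act on its fixed
  points.\<close>

lemma linked_flip: "linked d t t' \<Longrightarrow> linked d (flip t) (flip t')"
proof -
  assume "linked d t t'"
  then obtain s u where "transf d (emb t) (aut s u (emb t'))" by (auto simp: linked_def)
  then have "transf d (- aut True True (emb t)) (- aut True True (aut s u (emb t')))"
    by (intro transf_uminus transf_aut)
  also have "- aut True True (aut s u (emb t')) = aut s u (emb (flip t'))"
    by (simp add: emb_flip aut_uminus aut_aut)
  finally show ?thesis unfolding linked_def emb_flip by blast
qed

text \<open>\<open>F d\<close> and \<open>F e\<close> commute and compose to
  \<open>F (d * e)\<close>. All three are free, since none of \<open>d\<close>, \<open>e\<close>,
  \<open>d * e\<close> is a square and the remaining factor \<open>m \<ge> 3\<close> makes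
  \<open>N\<close> exceed twice each of them.\<close>

lemma four_dvd_card_prim_reps:
  assumes "odd d" "odd e" "d > 0" "e > 0" "m \<ge> 3" "N = d * e * m"
    and cop: "coprime d e" "coprime d m" "coprime e m"
    and nsq: "\<nexists>x. d = x\<^sup>2" "\<nexists>x. e = x\<^sup>2" "\<nexists>x. d * e = x\<^sup>2" and N: "N mod 8 \<noteq> 2"
  shows "4 dvd card (prim_reps N)" "4 dvd card {t \<in> prim_reps N. flip t = t}"
proof -
  let ?A = "prim_reps N"
  define F where "F k t = (THE t'. t' \<in> ?A \<and> linked k t t')" for k t
  define D where "D = {d, e, d * e}"
  have D: "odd k \<and> k > 0 \<and> (\<nexists>x. k = x\<^sup>2) \<and> N > 2 * k \<and> (\<exists>l. N = k * l \<and> coprime k l)" if "k \<in> D" for k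
  proof -
    have de: "d * e > 0" using assms by simp
    have N3: "N \<ge> 3 * (d * e)"
      unfolding assms(6) using de \<open>m \<ge> 3\<close> by (metis less_imp_le mult.commute mult_right_mono)
    have "d \<le> d * e" "e \<le> d * e" using assms(3,4) by (simp_all add: mult_le_cancel_left1 mult_le_cancel_right1)
    then have 2: "2 * d < N" "2 * e < N" "2 * (d * e) < N"
      using N3 assms(3,4) de by linarith+
    have 3: "N = d * (e * m)" "N = e * (d * m)" "N = (d * e) * m" by (simp_all add: assms(6))
    have "coprime d (e * m)" "coprime e (d * m)" "coprime (d * e) m"
      using cop by (simp_all add: coprime_commute)
    with 3 have 4: "\<exists>l. N = d * l \<and> coprime d l" "\<exists>l. N = e * l \<and> coprime e l"
      "\<exists>l. N = d * e * l \<and> coprime (d * e) l" by blast+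
    from that consider "k = d" | "k = e" | "k = d * e" unfolding D_def by blast
    then show ?thesis
      by cases (use 2 4 nsq assms(1-4) de in \<open>simp_all only: even_mult_iff simp_thms\<close>)
  qed
  have ex1: "\<exists>!t'. t' \<in> ?A \<and> linked k t t'" if k: "k \<in> D" and t: "t \<in> ?A" for k t
    using D[OF k] linked_exists[OF t _ _ _ _ N] linked_unique[OF _ _ t] by metis
  have F: "F k t \<in> ?A \<and> linked k t (F k t)" if "k \<in> D" "t \<in> ?A" for k t
    unfolding F_def using theI'[OF ex1[OF that]] .
  have F_eq: "F k t = t'" if "k \<in> D" "t \<in> ?A" "t' \<in> ?A" "linked k t t'" for k t t'
    using F ex1 that by metis
  have inv: "F k t \<in> ?A \<and> F k (F k t) = t \<and> F k t \<noteq> t" if "k \<in> D" "t \<in> ?A" for k t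
    using F[OF that] F_eq linked_sym that D[OF that(1)] linked_irrefl[OF that(2)] by metis
  have de: "d \<in> D" "e \<in> D" "d * e \<in> D" by (auto simp: D_def)
  have comp: "F d (F e t) = F (d * e) t" "F e (F d t) = F (d * e) t" if "t \<in> ?A" for t
  proof -
    have "linked (d * e) t (F d (F e t))"
      using linked_trans F de that cop(1) by (metis coprime_commute)
    then show "F d (F e t) = F (d * e) t" using F_eq F de that by metis
    have "linked (e * d) t (F e (F d t))"
      using linked_trans F de that cop(1) by metis
    then show "F e (F d t) = F (d * e) t" using F_eq F de that by (metis mult.commute)
  qed
  have fin: "finite ?A" by (rule finite_subset[OF _ finite_reps[of N]]) (auto simp: prim_reps_def)
  show "4 dvd card ?A"
    by (rule four_dvd_card_involutions[of _ "F d" "F e"]) (use fin inv de comp in auto)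
  have fl: "flip (F k t) = F k t" if "k \<in> D" "t \<in> ?A" "flip t = t" for k t
  proof -
    have "linked k t (flip (F k t))" using linked_flip[of k t "F k t"] F[OF that(1,2)] that(3) by simp
    moreover have "flip (F k t) \<in> ?A" using F[OF that(1,2)] by (simp add: flip_prim_reps)
    ultimately show ?thesis using F_eq that by metis
  qed
  show "4 dvd card {t \<in> ?A. flip t = t}"
    by (rule four_dvd_card_involutions[of _ "F d" "F e"]) (use fin inv de comp fl in auto)
qed

lemma odd_multiplicity_not_square:
  fixes p :: int assumes "prime p" "odd (multiplicity p d)" shows "\<nexists>x. d = x\<^sup>2"
proof
  assume "\<exists>x. d = x\<^sup>2"
  then obtain x where x: "d = x\<^sup>2" by blast
  have "x \<noteq> 0" using assms(2) x by (intro notI) simp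
  then have "multiplicity p d = 2 * multiplicity p x"
    unfolding x using assms(1) prime_imp_prime_elem prime_elem_multiplicity_power_distrib by blast
  with assms(2) show False by simp
qed

text \<open>\<open>d\<close> and \<open>e\<close> are the full powers of \<open>p\<close> and
  \<open>q\<close> in \<open>N\<close>; the odd exponents show that \<open>d\<close>,
  \<open>e\<close> and \<open>d * e\<close> are not squares. The prime \<open>r\<close> divides the
  cofactor and makes it at least 3.\<close>

lemma four_dvd_card_prim_reps':
  fixes N p q r :: int
  assumes "prime p" "prime q" "prime r" "p \<noteq> q" "p \<noteq> r" "q \<noteq> r" "odd p" "odd q" "odd r"
    "odd (multiplicity p N)" "odd (multiplicity q N)" "odd (multiplicity r N)" "N > 0" "N mod 8 \<noteq> 2"
  shows "4 dvd card (prim_reps N)" "4 dvd card {t \<in> prim_reps N. flip t = t}"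
proof -
  have prim: "prime_elem p" "prime_elem q" "prime_elem r" using assms(1-3) by blast+
  have ndvd: "\<not> p dvd q" "\<not> q dvd p" "\<not> r dvd p" "\<not> r dvd q"
    using assms(1-6) by (metis primes_dvd_imp_eq)+
  define d where "d = p ^ multiplicity p N"
  obtain n where n: "N = d * n" "\<not> p dvd n"
    using multiplicity_decompose'[of N p] prim(1) \<open>N > 0\<close> unfolding d_def
    by (metis less_irrefl not_prime_elem_zero prime_elem_not_unit)
  have "n \<noteq> 0" using n \<open>N > 0\<close> by auto
  define e where "e = q ^ multiplicity q n"
  obtain m where m: "n = e * m" "\<not> q dvd m"
    using multiplicity_decompose'[of n q] prim(2) \<open>n \<noteq> 0\<close> unfolding e_def
    by (metis prime_elem_not_unit)
  have "d > 0" "e > 0" using assms(1,2) by (simp_all add: d_def e_def prime_gt_0_int)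
  have N: "N = d * e * m" by (simp add: n m mult.assoc)
  have "m > 0" using \<open>N > 0\<close> \<open>d > 0\<close> \<open>e > 0\<close> zero_less_mult_pos[of "d * e" m] unfolding N by simp
  have "\<not> q dvd d" unfolding d_def using ndvd assms(2) prime_dvd_power by blast
  then have "multiplicity q N = multiplicity q n"
    using n \<open>d > 0\<close> \<open>n \<noteq> 0\<close> prim(2)
    by (simp add: prime_elem_multiplicity_mult_distrib not_dvd_imp_multiplicity_0)
  then have oq: "odd (multiplicity q n)" using assms(11) by simp
  have md: "multiplicity p d = multiplicity p N"
    unfolding d_def using prim(1) by (simp add: multiplicity_same_power prime_elem_not_unit)
  have me: "multiplicity q e = multiplicity q n"
    unfolding e_def using prim(2) by (simp add: multiplicity_same_power prime_elem_not_unit)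
  have "\<not> p dvd e" unfolding e_def using ndvd assms(1) prime_dvd_power by blast
  then have mde: "multiplicity p (d * e) = multiplicity p N"
    using \<open>d > 0\<close> \<open>e > 0\<close> prim(1) md
    by (simp add: prime_elem_multiplicity_mult_distrib not_dvd_imp_multiplicity_0)
  have cop: "coprime d e" "coprime d m" "coprime e m"
  proof -
    have "coprime p e" "coprime p m" "coprime q m"
      using \<open>\<not> p dvd e\<close> n(2) m assms(1,2) by (auto intro!: prime_imp_coprime)
    then show "coprime d e" "coprime d m" "coprime e m" by (simp_all add: d_def) (simp add: e_def)
  qed
  have "r dvd N" using assms(12) by (metis not_dvd_imp_multiplicity_0 even_zero)
  then have "r dvd m" unfolding N using assms(3) ndvd
    by (metis d_def e_def prime_dvd_mult_iff prime_dvd_power)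
  then have "r \<le> m" using \<open>m > 0\<close> by (rule zdvd_imp_le)
  moreover have "r \<noteq> 2" "r \<ge> 2" using assms(3,9) by (auto simp: prime_ge_2_int)
  ultimately have "m \<ge> 3" by linarith
  have "\<nexists>x. d = x\<^sup>2" "\<nexists>x. d * e = x\<^sup>2" "\<nexists>x. e = x\<^sup>2"
    using odd_multiplicity_not_square assms(1,2,10) oq md me mde by metis+
  then show "4 dvd card (prim_reps N)" "4 dvd card {t \<in> prim_reps N. flip t = t}"
    using four_dvd_card_prim_reps[OF _ _ \<open>d > 0\<close> \<open>e > 0\<close> \<open>m \<ge> 3\<close> N cop _ _ _ assms(14)]
      assms(7,8) by (auto simp: d_def e_def)
qed

section \<open>Imprimitive representations and the final parity\<close>

definition scale :: "int \<Rightarrow> int \<times> int \<times> int \<Rightarrow> int \<times> int \<times> int" where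
  "scale m t = (case t of (a, b, c) \<Rightarrow> (m * a, m * b, m * c))"

lemma flip_scale: "flip (scale m t) = scale m (flip t)"
  by (simp add: flip_def scale_def split: prod.split)

lemma inj_scale: "m \<noteq> 0 \<Longrightarrow> inj (scale m)"
  by (auto simp: inj_def scale_def)

lemma scale_reps:
  assumes "m > 0" "odd m" shows "scale m t \<in> reps (m\<^sup>2 * N) \<longleftrightarrow> t \<in> reps N"
proof -
  obtain a b c where t: "t = (a, b, c)" by (cases t)
  have "(m * a)\<^sup>2 + 2 * (m * b)\<^sup>2 + 2 * (m * c)\<^sup>2 = m\<^sup>2 * (a\<^sup>2 + 2 * b\<^sup>2 + 2 * c\<^sup>2)"
    by (simp add: power_mult_distrib algebra_simps)
  then show ?thesis using assms by (simp add: t reps_def scale_def zero_less_mult_iff)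
qed

definition content :: "int \<times> int \<times> int \<Rightarrow> int" where
  "content t = (case t of (a, b, c) \<Rightarrow> gcd a (gcd b c))"

text \<open>\<open>emb\<close> has the coordinates \<open>b - c\<close> and \<open>b + c\<close>,
  which could share an additional factor 2. Since \<open>b - c\<close> is odd, only odd divisors
  occur, and an odd divisor of both divides \<open>b\<close> and \<open>c\<close>.\<close>

lemma qprim_emb_iff:
  assumes "odd b" "even c" shows "qprim (emb (a, b, c)) \<longleftrightarrow> content (a, b, c) = 1"
proof
  assume "qprim (emb (a, b, c))"
  moreover have "of_int (content (a, b, c)) dvd emb (a, b, c)"
    unfolding of_int_dvd_quat emb_def content_def
    by simp (meson dvd_add dvd_diff dvd_trans gcd_dvd1 gcd_dvd2)
  ultimately have "is_unit (content (a, b, c))" unfolding qprim_def by blast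
  then show "content (a, b, c) = 1" by (simp add: content_def)
next
  assume c: "content (a, b, c) = 1"
  show "qprim (emb (a, b, c))"
    unfolding qprim_def
  proof (intro allI impI)
    fix e assume "of_int e dvd emb (a, b, c)"
    then have e: "e dvd a" "e dvd b - c" "e dvd b + c" by (simp_all add: of_int_dvd_quat emb_def)
    have "odd (b - c)" using assms by simp
    then have "odd e" using e(2) dvd_trans by blast
    have "2 * b = (b + c) + (b - c)" "2 * c = (b + c) - (b - c)" by simp_all
    then have "e dvd 2 * b" "e dvd 2 * c" using dvd_add[OF e(3,2)] dvd_diff[OF e(3,2)] by metis+
    then have "e dvd b" "e dvd c" using \<open>odd e\<close> by (simp_all add: coprime_dvd_mult_right_iff)
    with e(1) have "e dvd content (a, b, c)" by (simp add: content_def)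
    with c show "is_unit e" by simp
  qed
qed

lemma reps_content:
  assumes "m > 0" "odd m"
  shows "{t \<in> reps (m\<^sup>2 * N). content t = m} = scale m ` prim_reps N"
proof (intro equalityI subsetI)
  fix t assume t: "t \<in> {t \<in> reps (m\<^sup>2 * N). content t = m}"
  obtain a b c where abc: "t = (a, b, c)" by (cases t)
  have g: "gcd a (gcd b c) = m" using t by (simp add: abc content_def)
  then have "m dvd a" "m dvd b" "m dvd c" by (metis dvd_trans gcd_dvd1 gcd_dvd2)+
  then obtain a' b' c' where *: "a = m * a'" "b = m * b'" "c = m * c'" by (auto simp: dvd_def)
  then have t': "t = scale m (a', b', c')" by (simp add: abc scale_def)
  then have "(a', b', c') \<in> reps N" using t scale_reps[OF assms] by auto
  moreover have "m * gcd a' (gcd b' c') = m * 1"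
    using g assms(1) by (simp add: * gcd_mult_left abs_mult)
  then have "content (a', b', c') = 1" using assms(1) by (simp add: content_def)
  ultimately have "(a', b', c') \<in> prim_reps N"
    using qprim_emb_iff[of b' c' a'] by (simp add: prim_reps_def reps_def)
  then show "t \<in> scale m ` prim_reps N" using t' by blast
next
  fix t assume "t \<in> scale m ` prim_reps N"
  then obtain t' where t': "t = scale m t'" "t' \<in> prim_reps N" by blast
  obtain a b c where abc: "t' = (a, b, c)" by (cases t')
  have "content t' = 1" using t'(2) qprim_emb_iff[of b c a] by (simp add: abc prim_reps_def reps_def)
  then have "content t = m" using assms(1)
    by (simp add: t'(1) abc content_def scale_def gcd_mult_left abs_mult)
  then show "t \<in> {t \<in> reps (m\<^sup>2 * N). content t = m}"
    using t' scale_reps[OF assms] by (simp add: prim_reps_def)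
qed

text \<open>Representations are sorted by their content \<open>m\<close>, which is odd because
  \<open>b\<close> is. Dividing by it replaces \<open>N = m\<^sup>2 * M\<close> by \<open>M\<close>;
  this changes neither the parity of any multiplicity nor the residue modulo 8, so the primitive
  case applies to \<open>M\<close>.\<close>

lemma four_dvd_card_reps:
  fixes N p q r :: int
  assumes "prime p" "prime q" "prime r" "p \<noteq> q" "p \<noteq> r" "q \<noteq> r" "odd p" "odd q" "odd r"
    "odd (multiplicity p N)" "odd (multiplicity q N)" "odd (multiplicity r N)" "N > 0" "N mod 8 \<noteq> 2"
  shows "4 dvd card (reps N)" "4 dvd card {t \<in> reps N. flip t = t}"
proof -
  have block: "4 dvd card {t \<in> reps N. content t = m} \<and>
      4 dvd card {t \<in> reps N. flip t = t \<and> content t = m}" for m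
  proof (cases "{t \<in> reps N. content t = m} = {}")
    case True
    then have "{t \<in> reps N. flip t = t \<and> content t = m} = {}" by blast
    with True show ?thesis by (metis card.empty dvd_0_right)
  next
    case False
    then obtain a b c where abc: "(a, b, c) \<in> reps N" "gcd a (gcd b c) = m"
      by (auto simp: content_def)
    then have "m dvd a" "m dvd b" "m dvd c" by (metis dvd_trans gcd_dvd1 gcd_dvd2)+
    then obtain a' b' c' where *: "a = m * a'" "b = m * b'" "c = m * c'" by (auto simp: dvd_def)
    have "odd m" using abc(1) by (auto simp: reps_def *)
    moreover have "m \<ge> 0" unfolding abc(2)[symmetric] by simp
    ultimately have "m > 0" by (cases "m = 0") auto
    have "N = m\<^sup>2 * (a'\<^sup>2 + 2 * b'\<^sup>2 + 2 * c'\<^sup>2)"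
      using abc(1) by (auto simp: reps_def * power_mult_distrib algebra_simps)
    then obtain M where M: "N = m\<^sup>2 * M" by blast
    have "M > 0" using \<open>N > 0\<close> M \<open>m > 0\<close> by (simp add: zero_less_mult_iff)
    have odd_mult: "odd (multiplicity s M)" if "prime s" "odd (multiplicity s N)" for s
    proof -
      have "prime_elem s" using \<open>prime s\<close> by blast
      then have "multiplicity s N = 2 * multiplicity s m + multiplicity s M"
        unfolding M using \<open>m > 0\<close> \<open>M > 0\<close>
        by (simp add: prime_elem_multiplicity_mult_distrib prime_elem_multiplicity_power_distrib)
      with that(2) show ?thesis by simp
    qed
    have "M mod 8 \<noteq> 2"
    proof
      assume "M mod 8 = 2"
      obtain k where k: "m = 2 * k + 1" using \<open>odd m\<close> by (elim oddE)
      obtain l where "k * (k + 1) = 2 * l" by (metis evenE even_mult_iff even_plus_one_iff)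
      then have "m\<^sup>2 = 8 * l + 1" by (simp add: k power2_eq_square algebra_simps)
      then have "N mod 8 = (M + 8 * (l * M)) mod 8" by (simp add: M algebra_simps)
      also have "\<dots> = M mod 8" by (rule mod_mult_self2)
      finally show False using \<open>M mod 8 = 2\<close> assms(14) by simp
    qed
    have inj: "inj_on (scale m) X" for X
      using inj_scale \<open>m > 0\<close> by (metis inj_on_subset less_irrefl subset_UNIV)
    have img: "{t \<in> reps N. content t = m} = scale m ` prim_reps M"
      unfolding M by (rule reps_content) fact+
    then have "{t \<in> reps N. flip t = t \<and> content t = m} = scale m ` {t \<in> prim_reps M. flip t = t}"
    proof -
      have "{t \<in> reps N. flip t = t \<and> content t = m} = {t \<in> scale m ` prim_reps M. flip t = t}"
        unfolding img[symmetric] by blast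
      also have "\<dots> = scale m ` {t \<in> prim_reps M. flip t = t}"
        using inj_scale[of m] \<open>m > 0\<close> by (auto simp: flip_scale inj_eq)
      finally show ?thesis .
    qed
    then show ?thesis
      using four_dvd_card_prim_reps'[OF assms(1-9) odd_mult odd_mult odd_mult \<open>M > 0\<close> \<open>M mod 8 \<noteq> 2\<close>]
        assms(1-3,10-12) by (simp add: img card_image[OF inj])
  qed
  have sum: "card X = (\<Sum>m \<in> content ` X. card {t \<in> X. content t = m})" if "finite X" for X
    using sum.image_gen[OF that, of "\<lambda>_. 1" content] by (simp only: card_eq_sum)
  show "4 dvd card (reps N)"
    by (subst sum[OF finite_reps]) (use block in \<open>intro dvd_sum; blast\<close>)
  have "finite {t \<in> reps N. flip t = t}" using finite_reps by simp
  then show "4 dvd card {t \<in> reps N. flip t = t}"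
    by (subst sum) (use block in \<open>auto intro!: dvd_sum\<close>)
qed

text \<open>The parts with c > 0 and c < 0 have the same size P. With Z representations having c =
  0, the total is 2 P + Z and the wanted number P + Z. If 4 divides the total and Z, then P and Z
  are even.\<close>

theorem even_card_reps_nonneg:
  fixes N p q r :: int
  assumes "prime p" "prime q" "prime r" "p \<noteq> q" "p \<noteq> r" "q \<noteq> r" "odd p" "odd q" "odd r"
    "odd (multiplicity p N)" "odd (multiplicity q N)" "odd (multiplicity r N)" "N > 0" "N mod 8 \<noteq> 2"
  shows "even (card {(a, b, c) \<in> reps N. c \<ge> 0})"
proof -
  let ?P = "{t \<in> reps N. snd (snd t) > 0}" and ?M = "{t \<in> reps N. snd (snd t) < 0}"
    and ?Z = "{t \<in> reps N. flip t = t}"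
  have Z: "?Z = {t \<in> reps N. snd (snd t) = 0}" by (auto simp: flip_def)
  have fin: "finite ?P" "finite ?M" "finite ?Z" using finite_reps by simp_all
  have "card ?M = card ?P"
    by (rule bij_betw_same_card[of flip], rule bij_betw_byWitness[of _ flip])
      (auto simp: flip_reps, auto simp: flip_def)
  moreover have "card (reps N) = card ?P + card ?M + card ?Z"
  proof -
    have "reps N = ?P \<union> ?M \<union> ?Z" unfolding Z by auto
    then have "card (reps N) = card (?P \<union> ?M \<union> ?Z)" by (rule arg_cong)
    also have "\<dots> = card (?P \<union> ?M) + card ?Z"
      using fin by (intro card_Un_disjoint) (auto simp: Z)
    also have "card (?P \<union> ?M) = card ?P + card ?M"
      using fin by (intro card_Un_disjoint) auto
    finally show ?thesis .
  qed
  moreover have "{(a, b, c) \<in> reps N. c \<ge> 0} = ?P \<union> ?Z" unfolding Z by auto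
  then have "card {(a, b, c) \<in> reps N. c \<ge> 0} = card (?P \<union> ?Z)" by (rule arg_cong)
  moreover have "card (?P \<union> ?Z) = card ?P + card ?Z"
    using fin by (intro card_Un_disjoint) (auto simp: Z)
  ultimately show ?thesis using four_dvd_card_reps[OF assms] by presburger
qed

section \<open>Sums of two squares\<close>

definition windmills :: "int \<Rightarrow> (int \<times> int \<times> int) set" where
  "windmills n = {(x, y, z). 0 < x \<and> 0 < y \<and> 0 < z \<and> x\<^sup>2 + 4 * (y * z) = n}"

lemma finite_windmills: "finite (windmills n)"
proof (rule finite_subset)
  show "windmills n \<subseteq> {0..n} \<times> {0..n} \<times> {0..n}"
  proof (clarsimp simp: windmills_def, goal_cases)
    case (1 x y z)
    have "y * z \<ge> y" "y * z \<ge> z" using 1 by (simp_all add: mult_le_cancel_left1 mult_le_cancel_right1)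
    then show ?case using 1 le_square_int[of x] zero_le_power2[of x] by linarith
  qed
qed simp

definition zagier :: "int \<times> int \<times> int \<Rightarrow> int \<times> int \<times> int" where
  "zagier t = (case t of (x, y, z) \<Rightarrow>
     if x < y - z then (x + 2 * z, z, y - x - z)
     else if x < 2 * y then (2 * y - x, y, x - y + z)
     else (x - 2 * y, x - y + z, y))"

text \<open>On the boundaries \<open>x = y - z\<close> and \<open>x = 2 y\<close> of the three cases \<open>n\<close> would be a square or even.\<close>

lemma zagier_windmills:
  assumes "t \<in> windmills n" "odd n" "\<nexists>k. n = k\<^sup>2"
  shows "zagier t \<in> windmills n \<and> zagier (zagier t) = t"
proof -
  obtain x y z where t: "t = (x, y, z)" by (cases t)
  have n: "n = x\<^sup>2 + 4 * (y * z)" and pos: "x > 0" "y > 0" "z > 0"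
    using assms(1) by (auto simp: t windmills_def)
  have "x \<noteq> y - z"
  proof
    assume "x = y - z"
    then have "n = (y + z)\<^sup>2" unfolding n \<open>x = y - z\<close> by (simp add: power2_eq_square algebra_simps)
    with assms(3) show False by blast
  qed
  moreover have "x \<noteq> 2 * y" using assms(2) by (auto simp: n)
  ultimately consider "x < y - z" | "y - z < x" "x < 2 * y" | "2 * y < x" by linarith
  then show ?thesis
    by cases (use pos in \<open>simp_all add: t zagier_def windmills_def n power2_eq_square algebra_simps\<close>)
qed

text \<open>A divisor of \<open>u * w\<close> is a pair of divisors of \<open>u\<close> and
  \<open>w\<close>. Passing to the complementary divisor in either component gives two commuting
  free involutions, so 4 divides the number of divisors, and exactly half of them lie below the
  square root.\<close>

lemma even_card_divisors_below_sqrt: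
  fixes u w :: int
  assumes "u > 0" "w > 0" "coprime u w" "\<nexists>k. u = k\<^sup>2" "\<nexists>k. w = k\<^sup>2" "\<nexists>k. u * w = k\<^sup>2"
  shows "even (card {d. 0 < d \<and> d dvd u * w \<and> d\<^sup>2 < u * w})"
proof -
  let ?n = "u * w"
  define U W where "U = {d. 0 < d \<and> d dvd u}" and "W = {d. 0 < d \<and> d dvd w}"
  define A where "A = {d. 0 < d \<and> d dvd ?n}"
  have fin: "finite {d::int. 0 < d \<and> d dvd k}" if "k > 0" for k
    by (rule finite_subset[of _ "{0..k}"]) (use that in \<open>auto intro: zdvd_imp_le\<close>)
  have n: "?n > 0" using assms by simp
  have co: "k div d > 0 \<and> k div d dvd k \<and> k div (k div d) = d \<and> ((\<nexists>l. k = l\<^sup>2) \<longrightarrow> k div d \<noteq> d)"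
    if "k > 0" "d > 0" "d dvd k" for k d :: int
  proof -
    obtain e where e: "k = d * e" using \<open>d dvd k\<close> by (auto simp: dvd_def)
    then have "e > 0" using that by (simp add: zero_less_mult_iff)
    then show ?thesis using that by (auto simp: e power2_eq_square)
  qed
  have "4 dvd card (U \<times> W)"
    by (rule four_dvd_card_involutions[of _ "\<lambda>(d, e). (u div d, e)" "\<lambda>(d, e). (d, w div e)"])
      (use assms fin co in \<open>auto simp: U_def W_def\<close>)
  also have "card (U \<times> W) = card A"
  proof (rule bij_betw_same_card[of "\<lambda>(d, e). d * e"], rule bij_betw_imageI)
    have "d = d'" if "d > 0" "d' > 0" "d dvd a" "d' dvd a" "e dvd b" "e' dvd b" "coprime a b" "d * e = d' * e'"
      for a b d d' e e' :: int
    proof -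
      have "coprime d e'" "coprime d' e" using that by (meson coprime_divisors)+
      moreover have "d dvd d' * e'" "d' dvd d * e" using that(8) by (metis dvd_triv_left)+
      ultimately have "d dvd d'" "d' dvd d" by (simp_all add: coprime_dvd_mult_left_iff)
      then show "d = d'" using that by (simp add: zdvd_antisym_nonneg)
    qed
    note * = this
    show "inj_on (\<lambda>(d, e). d * e) (U \<times> W)"
    proof (rule inj_onI, clarify)
      fix d e d' e' assume de: "d \<in> U" "e \<in> W" "d' \<in> U" "e' \<in> W" and eq: "d * e = d' * e'"
      have "d = d'" using *[of d d' u e w e'] de eq assms(3) by (simp add: U_def W_def)
      then show "d = d' \<and> e = e'" using eq de by (simp add: U_def)
    qed
    show "(\<lambda>(d, e). d * e) ` (U \<times> W) = A"
    proof (intro equalityI subsetI)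
      fix x assume "x \<in> (\<lambda>(d, e). d * e) ` (U \<times> W)"
      then show "x \<in> A" by (auto simp: U_def W_def A_def intro: mult_dvd_mono)
    next
      fix x assume x: "x \<in> A"
      then obtain d e where de: "x = d * e" "d dvd u" "e dvd w"
        using division_decomp[of x u w] by (auto simp: A_def)
      have "x = \<bar>d\<bar> * \<bar>e\<bar>" using x de(1) by (simp add: A_def abs_mult[symmetric])
      moreover have "\<bar>d\<bar> \<in> U" "\<bar>e\<bar> \<in> W" using x de by (auto simp: U_def W_def A_def)
      ultimately show "x \<in> (\<lambda>(d, e). d * e) ` (U \<times> W)" by force
    qed
  qed
  also have "card A = card {d \<in> A. d\<^sup>2 < ?n} + card {d \<in> A. d\<^sup>2 > ?n}"
  proof -
    have "A = {d \<in> A. d\<^sup>2 < ?n} \<union> {d \<in> A. d\<^sup>2 > ?n}" 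
      using assms(6) linorder_neq_iff by blast
    then have "card A = card ({d \<in> A. d\<^sup>2 < ?n} \<union> {d \<in> A. d\<^sup>2 > ?n})" by (rule arg_cong)
    also have "\<dots> = card {d \<in> A. d\<^sup>2 < ?n} + card {d \<in> A. d\<^sup>2 > ?n}"
      using fin[OF n] by (intro card_Un_disjoint) (auto simp: A_def[symmetric])
    finally show ?thesis .
  qed
  also have "card {d \<in> A. d\<^sup>2 > ?n} = card {d \<in> A. d\<^sup>2 < ?n}"
  proof -
    have sq: "(k div d)\<^sup>2 < k \<longleftrightarrow> k < d\<^sup>2" "k < (k div d)\<^sup>2 \<longleftrightarrow> d\<^sup>2 < k"
      if "k > 0" "d > 0" "d dvd k" for k d :: int
    proof -
      obtain e where e: "k = d * e" using \<open>d dvd k\<close> by (auto simp: dvd_def)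
      then have "e > 0" using that by (simp add: zero_less_mult_iff)
      then show "(k div d)\<^sup>2 < k \<longleftrightarrow> k < d\<^sup>2" "k < (k div d)\<^sup>2 \<longleftrightarrow> d\<^sup>2 < k"
        using that by (auto simp: e power2_eq_square)
    qed
    show ?thesis
      by (rule bij_betw_same_card[of "\<lambda>d. ?n div d"], rule bij_betw_byWitness[of _ "\<lambda>d. ?n div d"])
        (use co[OF n] sq[OF n] in \<open>auto simp: A_def\<close>)
  qed
  finally obtain k where "card {d \<in> A. d\<^sup>2 < ?n} + card {d \<in> A. d\<^sup>2 < ?n} = 4 * k"
    by (elim dvdE)
  then have "card {d \<in> A. d\<^sup>2 < ?n} = 2 * k" by linarith
  then have "even (card {d \<in> A. d\<^sup>2 < ?n})" by simp
  also have "{d \<in> A. d\<^sup>2 < ?n} = {d. 0 < d \<and> d dvd ?n \<and> d\<^sup>2 < ?n}" by (auto simp: A_def)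
  finally show ?thesis .
qed

text \<open>Two involutions on the windmills compare two fixed point counts modulo 2. Swapping the
  last coordinates fixes the representations a^2 + 4 b^2. Zagier's map, for composite n too, fixes
  exactly the triples (d, d, (n/d - d)/4), one for every divisor d below the square root of
  n.\<close>

lemma even_card_two_squares:
  fixes u w :: int
  assumes "u > 0" "w > 0" "coprime u w" "\<nexists>k. u = k\<^sup>2" "\<nexists>k. w = k\<^sup>2" "\<nexists>k. u * w = k\<^sup>2"
    and n: "n = u * w" "n mod 4 = 1"
  shows "even (card {(a, b). 0 < a \<and> 0 \<le> b \<and> a\<^sup>2 + 4 * b\<^sup>2 = n})"
proof -
  have nsq: "\<nexists>k. n = k\<^sup>2" using assms by simp
  have "odd n" using n(2) by presburger
  let ?sw = "\<lambda>(x :: int, y :: int, z :: int). (x, z, y)"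
  let ?fix = "{t \<in> windmills n. fst (snd t) = snd (snd t)}"
  have sw: "?sw t = t \<longleftrightarrow> fst (snd t) = snd (snd t)" for t
    by (cases t) (simp only: case_prod_conv prod.inject fst_conv snd_conv, blast)
  have "card ?fix = card {(a, b). 0 < a \<and> 0 \<le> b \<and> a\<^sup>2 + 4 * b\<^sup>2 = n}"
  proof (rule bij_betw_same_card[of "\<lambda>(x, y, z). (x, y)"], rule bij_betw_byWitness[of _ "\<lambda>(x, y). (x, y, y)"])
    show "(\<lambda>(x, y). (x, y, y)) ` {(a, b). 0 < a \<and> 0 \<le> b \<and> a\<^sup>2 + 4 * b\<^sup>2 = n} \<subseteq> ?fix"
    proof
      fix t assume "t \<in> (\<lambda>(x, y). (x, y, y)) ` {(a, b). 0 < a \<and> 0 \<le> b \<and> a\<^sup>2 + 4 * b\<^sup>2 = n}"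
      then obtain a b where ab: "t = (a, b, b)" "0 < a" "0 \<le> b" "a\<^sup>2 + 4 * b\<^sup>2 = n" by auto
      \<comment> \<open>Representations with b = 0 would make n a square, so the weak inequality for
        b agrees with the positivity built into \<open>windmills\<close>.\<close>
      then have "b \<noteq> 0" using nsq by auto
      with ab show "t \<in> ?fix" by (simp add: windmills_def power2_eq_square)
    qed
    show "(\<lambda>(x, y, z). (x, y)) ` ?fix
        \<subseteq> {(a, b). 0 < a \<and> 0 \<le> b \<and> a\<^sup>2 + 4 * b\<^sup>2 = n}"
      by (clarsimp simp: windmills_def) (simp add: power2_eq_square)
    show "\<forall>t \<in> ?fix. (case case t of (x, y, z) \<Rightarrow> (x, y) of (x, y) \<Rightarrow> (x, y, y)) = t"
      by clarsimp
  qed clarsimp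
  moreover have "even (card (windmills n)) \<longleftrightarrow> even (card ?fix)"
    unfolding sw[symmetric] by (rule card_involution_fixed[OF finite_windmills]) (clarsimp simp: windmills_def mult.commute)
  moreover have "even (card (windmills n)) \<longleftrightarrow> even (card {t \<in> windmills n. zagier t = t})"
    by (rule card_involution_fixed[OF finite_windmills]) (rule zagier_windmills[OF _ \<open>odd n\<close> nsq])
  moreover have "card {d. 0 < d \<and> d dvd n \<and> d\<^sup>2 < n} = card {t \<in> windmills n. zagier t = t}"
  proof (rule bij_betw_same_card[of "\<lambda>d. (d, d, (n div d - d) div 4)"],
      rule bij_betw_byWitness[of _ fst])
    show "(\<lambda>d. (d, d, (n div d - d) div 4)) ` {d. 0 < d \<and> d dvd n \<and> d\<^sup>2 < n}
        \<subseteq> {t \<in> windmills n. zagier t = t}"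
    proof
      fix t assume "t \<in> (\<lambda>d. (d, d, (n div d - d) div 4)) ` {d. 0 < d \<and> d dvd n \<and> d\<^sup>2 < n}"
      then obtain d where d: "0 < d" "d dvd n" "d\<^sup>2 < n" and t: "t = (d, d, (n div d - d) div 4)"
        by blast
      obtain e where e: "n = d * e" using d(2) by (elim dvdE)
      have "e > d" using d by (simp add: e power2_eq_square)
      have "odd d" "odd e" using \<open>odd n\<close> by (auto simp: e)
      then obtain k l where kl: "d = 2 * k + 1" "e = 2 * l + 1" by (auto elim!: oddE)
      \<comment> \<open>As d e is 1 modulo 4, d and e are congruent modulo 4, so the third
        coordinate is an exact quotient.\<close>
      have "(2 * (k + l)) mod 4 = 0"
      proof -
        have "n = 2 * (k + l) + 1 + 4 * (k * l)" by (simp add: e kl algebra_simps)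
        with n(2) show ?thesis by presburger
      qed
      then have "(e - d) mod 4 = 0" unfolding kl by presburger
      then obtain z where z: "e - d = 4 * z" by (auto elim: dvdE)
      then have "z > 0" using \<open>e > d\<close> by linarith
      moreover have "e = d + 4 * z" using z by simp
      ultimately show "t \<in> {t \<in> windmills n. zagier t = t}"
        using d by (simp add: t e windmills_def zagier_def power2_eq_square algebra_simps)
    qed
    \<comment> \<open>Only the middle branch of \<open>zagier\<close> can fix a triple: the other
      two change \<open>x\<close> by a nonzero even amount.\<close>
    have fp: "0 < x \<and> y = x \<and> 0 < z \<and> n = x * (x + 4 * z)"
      if "(x, y, z) \<in> windmills n" "zagier (x, y, z) = (x, y, z)" for x y z
    proof -
      have n: "n = x\<^sup>2 + 4 * (y * z)" and pos: "x > 0" "y > 0" "z > 0"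
        using that(1) by (simp_all add: windmills_def)
      have "y = x"
        using that(2) pos unfolding zagier_def case_prod_conv
        by (cases "x < y - z"; cases "x < 2 * y"; simp only: if_True if_False prod.inject; linarith)
      then show ?thesis using pos n by (simp add: power2_eq_square algebra_simps)
    qed
    show "\<forall>t \<in> {t \<in> windmills n. zagier t = t}. (fst t, fst t, (n div fst t - fst t) div 4) = t"
    proof
      fix t assume t: "t \<in> {t \<in> windmills n. zagier t = t}"
      obtain x y z where xyz: "t = (x, y, z)" by (cases t)
      have *: "x > 0" "y = x" "z > 0" "n = x * (x + 4 * z)" using fp[of x y z] t xyz by blast+
      then have "(n div x - x) div 4 = z" by simp
      then show "(fst t, fst t, (n div fst t - fst t) div 4) = t"
        by (simp only: xyz fst_conv \<open>y = x\<close>)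
    qed
    show "fst ` {t \<in> windmills n. zagier t = t} \<subseteq> {d. 0 < d \<and> d dvd n \<and> d\<^sup>2 < n}"
    proof (rule image_subsetI)
      fix t assume t: "t \<in> {t \<in> windmills n. zagier t = t}"
      obtain x y z where xyz: "t = (x, y, z)" by (cases t)
      have *: "x > 0" "z > 0" "n = x * (x + 4 * z)" using fp[of x y z] t xyz by blast+
      then show "fst t \<in> {d. 0 < d \<and> d dvd n \<and> d\<^sup>2 < n}"
        by (simp add: xyz power2_eq_square)
    qed
  qed auto
  ultimately show ?thesis using even_card_divisors_below_sqrt[OF assms(1-6)] n(1) by simp
qed

section \<open>Theta series over the two-element field\<close>

lemma of_nat_bit: "(of_nat m :: bit) = of_bool (odd m)"
  by (induction m) simp_all

lemma int_mod_eqE: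
  assumes "a mod m = (r :: int)" obtains k where "a = m * k + r"
  using that[of "a div m"] assms mult_div_mod_eq[of m a] by simp

definition theta :: "'a set \<Rightarrow> ('a \<Rightarrow> int) \<Rightarrow> bit fps" where
  "theta A \<phi> = Abs_fps (\<lambda>n. of_nat (card {a \<in> A. \<phi> a = int n}))"

text \<open>\<open>card\<close> is 0 on infinite fibres, and negative values never become exponents
  in \<open>theta\<close>; the product formula fails without excluding both.\<close>

definition adm :: "'a set \<Rightarrow> ('a \<Rightarrow> int) \<Rightarrow> bool" where
  "adm A \<phi> \<longleftrightarrow> (\<forall>a \<in> A. \<phi> a \<ge> 0) \<and> (\<forall>n. finite {a \<in> A. \<phi> a = n})"

lemma theta_nth: "fps_nth (theta A \<phi>) n = of_nat (card {a \<in> A. \<phi> a = int n})"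
  by (simp add: theta_def)

lemma
  assumes "adm A \<phi>" "adm B \<psi>"
  shows adm_Times: "adm (A \<times> B) (\<lambda>(a, b). \<phi> a + \<psi> b)"
    and theta_mult: "theta A \<phi> * theta B \<psi> = theta (A \<times> B) (\<lambda>(a, b). \<phi> a + \<psi> b)"
proof -
  let ?S = "\<lambda>n. {ab \<in> A \<times> B. (case ab of (a, b) \<Rightarrow> \<phi> a + \<psi> b) = n}"
  let ?T = "\<lambda>n i. {a \<in> A. \<phi> a = int i} \<times> {b \<in> B. \<psi> b = int (n - i)}"
  have S: "?S (int n) = (\<Union>i \<in> {0..n}. ?T n i)" for n
  proof (intro equalityI subsetI)
    fix x assume "x \<in> ?S (int n)"
    then obtain a b where x: "x = (a, b)" "a \<in> A" "b \<in> B" "\<phi> a + \<psi> b = int n" by auto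
    then have "\<phi> a \<ge> 0" "\<psi> b \<ge> 0" using assms by (auto simp: adm_def)
    then have "nat (\<phi> a) \<in> {0..n}" "x \<in> ?T n (nat (\<phi> a))" using x by auto
    then show "x \<in> (\<Union>i \<in> {0..n}. ?T n i)" by blast
  qed auto
  have finT: "finite (?T n i)" for n i using assms by (simp add: adm_def)
  have "finite (?S n)" for n
  proof (cases "n \<ge> 0")
    case True
    have "finite (?S (int (nat n)))" unfolding S by (intro finite_UN_I finT) simp
    then show ?thesis using True by simp
  next
    case False
    then have "?S n = {}" using assms by (force simp: adm_def)
    then show ?thesis by (metis finite.emptyI)
  qed
  then show "adm (A \<times> B) (\<lambda>(a, b). \<phi> a + \<psi> b)"
    using assms by (auto simp: adm_def)
  show "theta A \<phi> * theta B \<psi> = theta (A \<times> B) (\<lambda>(a, b). \<phi> a + \<psi> b)"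
  proof (rule fps_ext)
    fix n
    have "card (?S (int n)) = (\<Sum>i = 0..n. card (?T n i))"
      unfolding S by (rule card_UN_disjoint) (use finT in \<open>simp, blast, force\<close>)
    then show "fps_nth (theta A \<phi> * theta B \<psi>) n =
        fps_nth (theta (A \<times> B) (\<lambda>(a, b). \<phi> a + \<psi> b)) n"
      by (simp add: fps_mult_nth theta_nth card_cartesian_product)
  qed
qed

text \<open>Frobenius, seen combinatorially: swapping the two factors cancels all pairs off the
  diagonal.\<close>

lemma theta_square:
  assumes "adm A \<phi>" shows "theta A \<phi> ^ 2 = theta A (\<lambda>a. 2 * \<phi> a)"
proof (rule fps_ext)
  fix n
  let ?S = "{ab \<in> A \<times> A. (case ab of (a, b) \<Rightarrow> \<phi> a + \<phi> b) = int n}"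
  have "finite ?S" using adm_Times[OF assms assms] unfolding adm_def by blast
  then have "even (card ?S) \<longleftrightarrow> even (card {ab \<in> ?S. prod.swap ab = ab})"
    by (rule card_involution_fixed) auto
  also have "card {ab \<in> ?S. prod.swap ab = ab} = card {ab \<in> ?S. fst ab = snd ab}"
  proof -
    have "prod.swap ab = ab \<longleftrightarrow> fst ab = snd ab" for ab :: "'a \<times> 'a"
      by (cases ab) (simp only: swap_simp prod.inject fst_conv snd_conv, blast)
    then show ?thesis by simp
  qed
  also have "card {ab \<in> ?S. fst ab = snd ab} = card {a \<in> A. 2 * \<phi> a = int n}"
    by (rule bij_betw_same_card[of fst], rule bij_betw_byWitness[of _ "\<lambda>a. (a, a)"])
      auto
  finally show "fps_nth (theta A \<phi> ^ 2) n = fps_nth (theta A (\<lambda>a. 2 * \<phi> a)) n"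
    by (simp add: power2_eq_square theta_mult[OF assms assms] theta_nth of_nat_bit)
qed

lemma adm_scale:
  assumes "adm A \<phi>" "k > 0" shows "adm A (\<lambda>a. k * \<phi> a)"
proof -
  have "{a \<in> A. k * \<phi> a = n} \<subseteq> {a \<in> A. \<phi> a = n div k}" for n
    using assms(2) by auto
  then have "finite {a \<in> A. k * \<phi> a = n}" for n
    using assms(1) finite_subset unfolding adm_def by metis
  then show ?thesis using assms by (simp add: adm_def)
qed

lemma theta_power2:
  assumes "adm A \<phi>" shows "theta A \<phi> ^ (2 ^ k) = theta A (\<lambda>a. 2 ^ k * \<phi> a)"
proof (induction k)
  case (Suc k)
  have "theta A \<phi> ^ (2 ^ Suc k) = (theta A \<phi> ^ (2 ^ k)) ^ 2"
    by (simp add: power_mult[symmetric] mult.commute)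
  also have "\<dots> = theta A (\<lambda>a. 2 * (2 ^ k * \<phi> a))"
    unfolding Suc by (rule theta_square) (use assms in \<open>simp add: adm_scale\<close>)
  finally show ?case by (simp add: mult.assoc)
qed simp

lemma theta_bij:
  assumes "bij_betw f A B" "\<And>a. a \<in> A \<Longrightarrow> \<psi> (f a) = \<phi> a"
  shows "theta A \<phi> = theta B \<psi>"
proof (rule fps_ext)
  fix n
  have "bij_betw f {a \<in> A. \<phi> a = int n} {b \<in> B. \<psi> b = int n}"
    using assms unfolding bij_betw_def by (fastforce simp: inj_on_def)
  then show "fps_nth (theta A \<phi>) n = fps_nth (theta B \<psi>) n"
    by (simp add: theta_nth bij_betw_same_card)
qed

lemma theta_Un:
  assumes "adm A \<phi>" "adm B \<phi>" "A \<inter> B = {}"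
  shows "theta (A \<union> B) \<phi> = theta A \<phi> + theta B \<phi>"
proof (rule fps_ext)
  fix n
  have "card ({a \<in> A. \<phi> a = int n} \<union> {a \<in> B. \<phi> a = int n}) =
      card {a \<in> A. \<phi> a = int n} + card {a \<in> B. \<phi> a = int n}"
    using assms by (intro card_Un_disjoint) (auto simp: adm_def)
  moreover have "{a \<in> A \<union> B. \<phi> a = int n} = {a \<in> A. \<phi> a = int n} \<union> {a \<in> B. \<phi> a = int n}"
    by auto
  ultimately show "fps_nth (theta (A \<union> B) \<phi>) n = fps_nth (theta A \<phi> + theta B \<phi>) n"
    by (simp add: theta_nth)
qed

lemma theta_nth_nonzero:
  assumes "fps_nth (theta A \<phi>) n \<noteq> 0" shows "\<exists>a \<in> A. \<phi> a = int n"
proof (rule ccontr)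
  assume "\<not> (\<exists>a \<in> A. \<phi> a = int n)"
  then have "{a \<in> A. \<phi> a = int n} = {}" by blast
  then have "fps_nth (theta A \<phi>) n = 0" unfolding theta_nth by (simp only: card.empty of_nat_0)
  with assms show False by blast
qed

text \<open>Over two elements a series is the theta series of its support, so what holds for powers
  of theta series holds for powers of every series.\<close>

lemma fps_eq_theta: "(f :: bit fps) = theta {n. fps_nth f n \<noteq> 0} int"
proof (rule fps_ext)
  fix n
  have "{a \<in> {n. fps_nth f n \<noteq> 0}. int a = int n} = (if fps_nth f n \<noteq> 0 then {n} else {})" by auto
  then show "fps_nth f n = fps_nth (theta {n. fps_nth f n \<noteq> 0} int) n"
    by (simp add: theta_nth)
qed

lemma adm_int: "adm A int"
proof -
  have "{a \<in> A. int a = n} \<subseteq> {nat n}" for n by auto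
  then show ?thesis by (auto simp: adm_def intro: finite_subset)
qed

lemma adm_square: "adm A (\<lambda>a :: int. a\<^sup>2)"
proof -
  have "{a \<in> A. a\<^sup>2 = n} \<subseteq> {-n..n}" for n
    using le_square_int[of "- a" for a] le_square_int by (auto simp: minus_le_iff)
  then show ?thesis by (auto simp: adm_def intro: finite_subset)
qed

lemma fps_bit_two [simp]: "(2 :: bit fps) = 0"
  by (simp add: numeral_fps_const)

lemma fps_bit_double [simp]: "x + x = (0 :: bit fps)"
  by (simp flip: mult_2)

lemma fps_bit_double' [simp]: "x + (x + y) = (y :: bit fps)"
  by (simp flip: add.assoc)

lemma fps_bit_add_eq_iff: "x + y = z \<longleftrightarrow> x = y + (z :: bit fps)"
  by (metis fps_bit_double' add.commute)

lemma fps_bit_square_add: "(x + y) ^ 2 = x ^ 2 + (y :: bit fps) ^ 2"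
proof -
  have "(x + y) ^ 2 = x ^ 2 + y ^ 2 + 2 * (x * y)" by (simp only: power2_sum mult.assoc)
  then show ?thesis by simp
qed

section \<open>The odd theta series and its two parts modulo 16\<close>

definition odds :: "int set" where "odds = {a. a > 0 \<and> odd a}"

definition odd_theta :: "bit fps" where "odd_theta = theta odds (\<lambda>a. a\<^sup>2)"
text \<open>Every odd square has exactly one root congruent to 1 or 3 modulo 8. Admitting negative
  \<open>a\<close> thus makes each index set a single residue class, on which linear substitutions
  are bijective.\<close>

definition odd_theta1 :: "bit fps" where "odd_theta1 = theta {a :: int. a mod 8 = 1} (\<lambda>a. a\<^sup>2)"
definition odd_theta3 :: "bit fps" where "odd_theta3 = theta {a :: int. a mod 8 = 3} (\<lambda>a. a\<^sup>2)"

lemma g_series_theta: "g_series = theta {0..} (\<lambda>a. a\<^sup>2)"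
proof (rule fps_ext)
  fix n
  have "{a \<in> {0..}. a\<^sup>2 = int n} = (if \<exists>k. n = k\<^sup>2 then {int (THE k. n = k\<^sup>2)} else {})"
  proof (cases "\<exists>k. n = k\<^sup>2")
    case True
    then obtain k where k: "n = k\<^sup>2" by blast
    then have "(THE k. n = k\<^sup>2) = k" by (intro the_equality) auto
    moreover have "{a \<in> {0..}. a\<^sup>2 = int n} = {int k}"
      by (auto simp: k)
    ultimately show ?thesis using True by simp
  next
    case False
    have "\<not> a\<^sup>2 = int n" if "a \<ge> 0" for a
    proof
      assume "a\<^sup>2 = int n"
      then have "int ((nat a)\<^sup>2) = int n" using that by simp
      then show False using False by (metis of_nat_eq_iff)
    qed
    then show ?thesis using False by auto
  qed
  then show "fps_nth g_series n = fps_nth (theta {0..} (\<lambda>a. a\<^sup>2)) n"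
    by (simp add: g_series_nth theta_nth)
qed

lemma odd_theta_eq: "odd_theta = g_series + g_series ^ 4"
proof -
  have "g_series ^ 4 = theta {0..} (\<lambda>a. 2 ^ 2 * a\<^sup>2)"
    unfolding g_series_theta using theta_power2[OF adm_square, of "{0..}" 2] by simp
  also have "\<dots> = theta {a. a \<ge> 0 \<and> even a} (\<lambda>a. a\<^sup>2)"
    by (rule theta_bij[of "\<lambda>a. 2 * a"])
      (auto intro!: bij_betw_byWitness[of _ "\<lambda>a. a div 2"])
  finally have g4: "g_series ^ 4 = theta {a. a \<ge> 0 \<and> even a} (\<lambda>a. a\<^sup>2)" .
  have "{0..} = odds \<union> {a. a \<ge> 0 \<and> even a}" by (auto simp: odds_def) (metis even_zero less_le)
  then have "g_series = theta (odds \<union> {a. a \<ge> 0 \<and> even a}) (\<lambda>a. a\<^sup>2)"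
    by (simp add: g_series_theta)
  also have "\<dots> = odd_theta + g_series ^ 4"
    unfolding g4 odd_theta_def by (rule theta_Un[OF adm_square adm_square]) (auto simp: odds_def)
  finally show ?thesis by (metis fps_bit_add_eq_iff add.commute)
qed

lemma odd_theta_split: "odd_theta = odd_theta1 + odd_theta3"
proof -
  have "odd_theta1 + odd_theta3 = theta ({a :: int. a mod 8 = 1} \<union> {a :: int. a mod 8 = 3}) (\<lambda>a. a\<^sup>2)"
    unfolding odd_theta1_def odd_theta3_def by (rule theta_Un[OF adm_square adm_square, symmetric]) auto
  also have "\<dots> = theta odds (\<lambda>a. a\<^sup>2)"
  proof (rule theta_bij[of abs])
    show "bij_betw abs ({a :: int. a mod 8 = 1} \<union> {a :: int. a mod 8 = 3}) odds"
    proof (rule bij_betw_byWitness[of _ "\<lambda>a. if a mod 8 \<in> {1, 3} then a else - a"])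
      show "\<forall>a \<in> {a :: int. a mod 8 = 1} \<union> {a :: int. a mod 8 = 3}. (if \<bar>a\<bar> mod 8 \<in> {1, 3} then \<bar>a\<bar> else - \<bar>a\<bar>) = a"
      proof
        fix a :: int assume "a \<in> {a. a mod 8 = 1} \<union> {a. a mod 8 = 3}"
        then have "a mod 8 = 1 \<or> a mod 8 = 3" by simp
        then have "(- a) mod 8 \<noteq> 1" "(- a) mod 8 \<noteq> 3" "\<bar>a\<bar> = a \<or> \<bar>a\<bar> = - a" by presburger+
        then show "(if \<bar>a\<bar> mod 8 \<in> {1, 3} then \<bar>a\<bar> else - \<bar>a\<bar>) = a"
          using \<open>a mod 8 = 1 \<or> a mod 8 = 3\<close> by auto
      qed
      show "\<forall>a \<in> odds. \<bar>if a mod 8 \<in> {1, 3} then a else - a\<bar> = a" by (simp add: odds_def)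
      show "abs ` ({a. a mod 8 = 1} \<union> {a. a mod 8 = 3}) \<subseteq> odds"
      proof
        fix b assume "b \<in> abs ` ({a :: int. a mod 8 = 1} \<union> {a. a mod 8 = 3})"
        then obtain a :: int where a: "b = \<bar>a\<bar>" "a mod 8 = 1 \<or> a mod 8 = 3" by auto
        then have "odd a" by presburger
        then show "b \<in> odds" using a(1) by (auto simp: odds_def)
      qed
      have "a mod 8 = 1 \<or> a mod 8 = 3 \<or> (- a) mod 8 = 1 \<or> (- a) mod 8 = 3" if "odd a" for a :: int
        using that by presburger
      then show "(\<lambda>a. if a mod 8 \<in> {1, 3} then a else - a) ` odds
          \<subseteq> {a. a mod 8 = 1} \<union> {a. a mod 8 = 3}"
        by (fastforce simp: odds_def)
    qed
  qed simp
  finally show ?thesis by (simp add: odd_theta_def)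
qed

text \<open>The bijection is \<open>(a, b) \<mapsto> ((a - b) / 2, (a + b) / 4)\<close>; the signs of its values are
  determined by their residues.\<close>

lemma odd_theta1_mult_odd_theta3: "odd_theta1 * odd_theta3 = odd_theta ^ 10"
proof -
  let ?A = "{a :: int. a mod 8 = 1} \<times> {a :: int. a mod 8 = 3}"
  let ?B = "{(c :: int, d :: int). c mod 4 = 3 \<and> (c + 2 * d) mod 8 = 1}"
  have B: "(2 * d - c) mod 8 = 3 \<and> (c - 2 * d) mod 8 = 5 \<and> odd c \<and> odd d"
    if cd: "c mod 4 = 3" "(c + 2 * d) mod 8 = 1" for c d :: int
  proof -
    obtain k where k: "c = 4 * k + 3" using cd(1) by (rule int_mod_eqE)
    obtain l where "c + 2 * d = 8 * l + 1" using cd(2) by (rule int_mod_eqE)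
    with k have "d = 2 * (2 * l - k - 1) + 1" by presburger
    then have "odd d" by simp
    have "2 * d - c = 3 + 8 * (l - k - 1)" "c - 2 * d = 5 + 8 * (k - l)"
      using k \<open>d = 2 * (2 * l - k - 1) + 1\<close> by simp_all
    then have "(2 * d - c) mod 8 = 3" "(c - 2 * d) mod 8 = 5" by (simp_all only: mod_mult_self2) simp_all
    then show ?thesis using \<open>odd d\<close> k by simp
  qed
  have A: "(a - b) div 2 + 2 * ((a + b) div 4) = a \<and> 2 * ((a + b) div 4) - (a - b) div 2 = b \<and>
      (a - b) div 2 mod 4 = 3" if ab: "a mod 8 = 1" "b mod 8 = 3" for a b :: int
  proof -
    obtain k where k: "a = 8 * k + 1" using ab(1) by (rule int_mod_eqE)
    obtain l where l: "b = 8 * l + 3" using ab(2) by (rule int_mod_eqE)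
    have 1: "a - b = 2 * (3 + 4 * (k - l - 1))" "a + b = 4 * (2 * (k + l) + 1)" using k l by simp_all
    then have "(a - b) div 2 = 3 + 4 * (k - l - 1)" "(a + b) div 4 = 2 * (k + l) + 1"
      by simp_all
    moreover have "(3 + 4 * (k - l - 1)) mod 4 = 3" by (simp only: mod_mult_self2) simp
    ultimately show ?thesis using k l by simp
  qed
  have "odd_theta1 * odd_theta3 = theta ?A (\<lambda>(a, b). a\<^sup>2 + b\<^sup>2)"
    unfolding odd_theta1_def odd_theta3_def by (rule theta_mult[OF adm_square adm_square])
  also have "\<dots> = theta ?B (\<lambda>(c, d). 2 * c\<^sup>2 + 8 * d\<^sup>2)"
  proof (rule sym, rule theta_bij[of "\<lambda>(c, d). (c + 2 * d, 2 * d - c)"])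
    show "bij_betw (\<lambda>(c, d). (c + 2 * d, 2 * d - c)) ?B ?A"
    proof (rule bij_betw_byWitness[of _ "\<lambda>(a, b). ((a - b) div 2, (a + b) div 4)"])
      show "\<forall>x \<in> ?A. (case case x of (a, b) \<Rightarrow> ((a - b) div 2, (a + b) div 4) of
          (c, d) \<Rightarrow> (c + 2 * d, 2 * d - c)) = x"
      proof
        fix x assume "x \<in> ?A"
        then obtain a b where x: "x = (a, b)" and ab: "a mod 8 = 1" "b mod 8 = 3" by (elim SigmaE) simp
        show "(case (case x of (a, b) \<Rightarrow> ((a - b) div 2, (a + b) div 4)) of
            (c, d) \<Rightarrow> (c + 2 * d, 2 * d - c)) = x"
          using A[OF ab] by (simp only: x case_prod_conv)
      qed
      show "(\<lambda>(c, d). (c + 2 * d, 2 * d - c)) ` ?B \<subseteq> ?A"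
      proof
        fix x assume "x \<in> (\<lambda>(c, d). (c + 2 * d, 2 * d - c)) ` ?B"
        then obtain c d where "x = (c + 2 * d, 2 * d - c)" "c mod 4 = 3" "(c + 2 * d) mod 8 = 1"
          by auto
        then show "x \<in> ?A" using B[of c d] by blast
      qed
      show "(\<lambda>(a, b). ((a - b) div 2, (a + b) div 4)) ` ?A \<subseteq> ?B"
      proof
        fix x assume "x \<in> (\<lambda>(a, b). ((a - b) div 2, (a + b) div 4)) ` ?A"
        then obtain a b where ab: "x = ((a - b) div 2, (a + b) div 4)" "a mod 8 = 1" "b mod 8 = 3"
          by auto
        then show "x \<in> ?B" using A[of a b] by simp
      qed
    qed auto
  qed (auto simp: power2_eq_square algebra_simps)
  also have "\<dots> = theta (odds \<times> odds) (\<lambda>(c, d). 2 * c\<^sup>2 + 8 * d\<^sup>2)"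
  proof (rule theta_bij[of "\<lambda>(c, d). (\<bar>c\<bar>, \<bar>d\<bar>)"])
    let ?s = "\<lambda>c :: int. if c mod 4 = 3 then c else - c"
    let ?t = "\<lambda>c d :: int. if (c + 2 * d) mod 8 = 1 then d else - d"
    show "bij_betw (\<lambda>(c, d). (\<bar>c\<bar>, \<bar>d\<bar>)) ?B (odds \<times> odds)"
    proof (rule bij_betw_byWitness[of _ "\<lambda>(c, d). (?s c, ?t (?s c) d)"])
      show "\<forall>x \<in> ?B. (case case x of (c, d) \<Rightarrow> (\<bar>c\<bar>, \<bar>d\<bar>) of (c, d) \<Rightarrow> (?s c, ?t (?s c) d)) = x"
      proof
        fix x assume "x \<in> ?B"
        then obtain c d where x: "x = (c, d)" and cd: "c mod 4 = 3" "(c + 2 * d) mod 8 = 1" by auto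
        have "(- c) mod 4 = 1" using cd(1) by presburger
        then have "?s \<bar>c\<bar> = c" using cd(1) by (simp add: abs_if)
        moreover have "(c + 2 * (- d)) mod 8 = 5" using B[OF cd] by simp
        then have "?t c \<bar>d\<bar> = d" using cd by (cases "d < 0") (simp_all only: abs_if if_True if_False, simp_all)
        ultimately show "(case (case x of (c, d) \<Rightarrow> (\<bar>c\<bar>, \<bar>d\<bar>)) of
            (c, d) \<Rightarrow> (?s c, ?t (?s c) d)) = x"
          by (simp only: x case_prod_conv)
      qed
      show "(\<lambda>(c, d). (\<bar>c\<bar>, \<bar>d\<bar>)) ` ?B \<subseteq> odds \<times> odds"
      proof
        fix x assume "x \<in> (\<lambda>(c, d). (\<bar>c\<bar>, \<bar>d\<bar>)) ` ?B"
        then obtain c d where x: "x = (\<bar>c\<bar>, \<bar>d\<bar>)" and cd: "c mod 4 = 3" "(c + 2 * d) mod 8 = 1"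
          by auto
        then show "x \<in> odds \<times> odds" using B[OF cd] by (auto simp: odds_def)
      qed
      show "(\<lambda>(c, d). (?s c, ?t (?s c) d)) ` (odds \<times> odds) \<subseteq> ?B"
      proof (rule image_subsetI)
        fix x assume "x \<in> odds \<times> odds"
        then obtain c d where x: "x = (c, d)" and "c \<in> odds" "d \<in> odds" by (elim SigmaE) simp
        then have cd: "odd c" "odd d" unfolding odds_def by blast+
        have "c mod 4 = 3 \<or> (- c) mod 4 = 3" using cd(1) by presburger
        then have 1: "?s c mod 4 = 3" by (cases "c mod 4 = 3") simp_all
        \<comment> \<open>For k = 3 modulo 4 and odd d, k + 2 d is 1 or 5 modulo 8, and changing the
          sign of d interchanges the two.\<close>
        have 2: "(k + 2 * ?t k d) mod 8 = 1" if k: "k mod 4 = 3" for k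
        proof (cases "(k + 2 * d) mod 8 = 1")
          case False
          obtain m where m: "k = 4 * m + 3" using k by (rule int_mod_eqE)
          obtain e where e: "d = 2 * e + 1" using cd(2) by (elim oddE)
          have "even (m - e)"
          proof (rule ccontr)
            assume "odd (m - e)"
            then obtain f where "m - e = 2 * f + 1" by (elim oddE)
            then have "k + 2 * d = 1 + 8 * (f + e + 1)" using m e by presburger
            then show False using False by (simp only: mod_mult_self2) simp
          qed
          then obtain f where "m - e = 2 * f" by (elim evenE)
          then have "k + 2 * (- d) = 1 + 8 * f" using m e by presburger
          then have "(k + 2 * (- d)) mod 8 = 1" by (simp only: mod_mult_self2) simp
          then show ?thesis using False by (simp only: if_False)
        qed simp
        from 1 2[OF 1] show "(case x of (c, d) \<Rightarrow> (?s c, ?t (?s c) d)) \<in> ?B"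
          by (simp only: x case_prod_conv mem_Collect_eq simp_thms)
      qed
    qed (auto simp: odds_def)
  qed auto
  \<comment> \<open>The coefficients 2 and 8 are powers of 2, so Frobenius turns the two factors
    into h^2 and h^8; this produces the exponent 10.\<close>
  also have "\<dots> = theta odds (\<lambda>a. 2 ^ 1 * a\<^sup>2) * theta odds (\<lambda>a. 2 ^ 3 * a\<^sup>2)"
    by (subst theta_mult) (simp_all add: adm_scale adm_square)
  also have "\<dots> = odd_theta ^ (2 ^ 1) * odd_theta ^ (2 ^ 3)"
    unfolding odd_theta_def by (simp only: theta_power2[OF adm_square])
  finally show ?thesis by (simp flip: power_add)
qed

lemma fps_bit_power2_add: "(x + y) ^ 2 ^ k = x ^ 2 ^ k + (y :: bit fps) ^ 2 ^ k"
proof (induction k)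
  case (Suc k)
  have *: "z ^ 2 ^ Suc k = (z ^ 2 ^ k) ^ 2" for z :: "bit fps"
    by (simp add: power_mult[symmetric] mult.commute)
  show ?case unfolding * Suc by (rule fps_bit_square_add)
qed simp

lemma odd_theta_pow2: "odd_theta ^ 2 ^ k = g_series ^ 2 ^ k + g_series ^ (4 * 2 ^ k)"
  unfolding odd_theta_eq fps_bit_power2_add by (simp add: power_mult)

text \<open>Both sides are roots of \<open>X\<^sup>2 + odd_theta X = odd_theta\<^sup>1\<^sup>0\<close>, whose roots differ by \<open>odd_theta\<close>.\<close>

lemma odd_theta3_eq: "odd_theta3 = odd_theta * (g_series ^ 8 + g_series ^ 16)"
proof -
  define X where "X = odd_theta * (g_series ^ 8 + g_series ^ 16)"
  have h8: "odd_theta ^ 8 = g_series ^ 8 + g_series ^ 32" using odd_theta_pow2[of 3] by simp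
  have "X ^ 2 = odd_theta ^ 2 * (g_series ^ 16 + g_series ^ 32)"
    by (simp add: X_def power_mult_distrib fps_bit_square_add flip: power_mult)
  then have "X ^ 2 + odd_theta * X = odd_theta ^ 2 * (g_series ^ 16 + g_series ^ 32) + odd_theta ^ 2 * (g_series ^ 8 + g_series ^ 16)"
    by (simp only: X_def power2_eq_square mult.assoc)
  also have "\<dots> = odd_theta ^ 2 * (g_series ^ 8 + g_series ^ 32 + (g_series ^ 16 + g_series ^ 16))"
    by (simp only: distrib_left add.assoc add.commute add.left_commute)
  also have "\<dots> = odd_theta ^ 10" by (simp flip: h8 power_add)
  finally have X: "X ^ 2 + odd_theta * X = odd_theta ^ 10" .
  have "odd_theta3 ^ 2 + odd_theta * odd_theta3 = odd_theta1 * odd_theta3 + (odd_theta3 ^ 2 + odd_theta3 ^ 2)"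
    unfolding odd_theta_split by (simp only: power2_eq_square) algebra
  then have odd_theta3: "odd_theta3 ^ 2 + odd_theta * odd_theta3 = odd_theta ^ 10" by (simp add: odd_theta1_mult_odd_theta3)
  have "(odd_theta3 + X) * (odd_theta3 + X + odd_theta) = (odd_theta3 ^ 2 + odd_theta * odd_theta3) + (X ^ 2 + odd_theta * X) + 2 * (odd_theta3 * X)"
    by (simp only: power2_eq_square) algebra
  then have "(odd_theta3 + X) * (odd_theta3 + X + odd_theta) = 0" by (simp only: X odd_theta3) simp
  then consider "odd_theta3 + X = 0" | "odd_theta3 + X + odd_theta = 0" by (metis mult_eq_0_iff)
  then show ?thesis
  proof cases
    case 1
    then show ?thesis by (metis X_def fps_bit_add_eq_iff add_0_right)
  next
    \<comment> \<open>The other root is excluded by the coefficient of x: it is 1 in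
      \<open>odd_theta\<close> but 0 in \<open>odd_theta3\<close> and in \<open>X\<close>.\<close>
    case 2
    have "\<not> (\<exists>a \<in> odds. a\<^sup>2 = int 0)" by (simp add: odds_def)
    then have h0: "fps_nth odd_theta 0 = 0" unfolding odd_theta_def using theta_nth_nonzero by blast
    have "{a \<in> odds. a\<^sup>2 = int 1} = {1}" by (auto simp: odds_def power2_eq_1_iff)
    then have hone: "fps_nth odd_theta 1 = 1" by (simp add: odd_theta_def theta_nth)
    have "\<not> (\<exists>a \<in> {a :: int. a mod 8 = 3}. a\<^sup>2 = int 1)" by (auto simp: power2_eq_1_iff)
    then have "fps_nth odd_theta3 1 = 0" unfolding odd_theta3_def using theta_nth_nonzero by blast
    moreover have "fps_nth (g_series ^ 8 + g_series ^ 16) 0 = 0"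
      by (simp add: fps_power_zeroth)
    then have "fps_nth X 1 = 0" by (simp add: X_def fps_mult_nth h0 del: fps_add_nth)
    ultimately have "fps_nth (odd_theta3 + X + odd_theta) 1 = 1" using hone by simp
    with 2 show ?thesis by simp
  qed
qed

section \<open>The reciprocal of the theta series\<close>

definition supp_mod :: "nat \<Rightarrow> nat \<Rightarrow> bit fps \<Rightarrow> bool" where
  "supp_mod m r f \<longleftrightarrow> (\<forall>n. fps_nth f n \<noteq> 0 \<longrightarrow> [n = r] (mod m))"

lemma supp_mod_mult:
  assumes "supp_mod m r f" "supp_mod m s f'" shows "supp_mod m (r + s) (f * f')"
  unfolding supp_mod_def
proof (intro allI impI)
  fix n assume "fps_nth (f * f') n \<noteq> 0"
  then have "(\<Sum>i = 0..n. fps_nth f i * fps_nth f' (n - i)) \<noteq> 0" unfolding fps_mult_nth .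
  then obtain i where i: "i \<in> {0..n}" "fps_nth f i * fps_nth f' (n - i) \<noteq> 0"
    by (meson sum.neutral)
  then have "fps_nth f i \<noteq> 0" "fps_nth f' (n - i) \<noteq> 0" by auto
  then have "[i + (n - i) = r + s] (mod m)"
    using assms unfolding supp_mod_def by (intro cong_add) blast+
  with i(1) show "[n = r + s] (mod m)" by simp
qed

lemma supp_mod_add:
  assumes "supp_mod m r f" "supp_mod m r f'" shows "supp_mod m r (f + f')"
  using assms unfolding supp_mod_def by (metis add_0 fps_add_nth)

lemma supp_mod_theta:
  assumes "\<And>a. a \<in> A \<Longrightarrow> [\<phi> a = int r] (mod int m)" shows "supp_mod m r (theta A \<phi>)"
  unfolding supp_mod_def using assms theta_nth_nonzero by (metis cong_int_iff)

lemma supp_mod_dvd: "supp_mod m r f \<Longrightarrow> k dvd m \<Longrightarrow> supp_mod k r f"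
  unfolding supp_mod_def using cong_dvd_modulus_nat by blast

lemma supp_mod_power2: "supp_mod (2 ^ k) 0 (f ^ 2 ^ k)"
proof -
  have "f ^ 2 ^ k = theta {n. fps_nth f n \<noteq> 0} (\<lambda>a. 2 ^ k * int a)"
    by (subst fps_eq_theta[of f], rule theta_power2[OF adm_int])
  then show ?thesis by (simp add: supp_mod_theta cong_0_iff)
qed

lemma odd_square_mod_8: "odd a \<Longrightarrow> [a\<^sup>2 = 1] (mod (8 :: int))"
proof -
  assume "odd a"
  then obtain k where k: "a = 2 * k + 1" by (elim oddE)
  obtain l where "k * (k + 1) = 2 * l" by (metis evenE even_mult_iff even_plus_one_iff)
  then have "a\<^sup>2 = 1 + 8 * l" by (simp add: k power2_eq_square algebra_simps)
  then show ?thesis by (simp add: unique_euclidean_semiring_class.cong_def)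
qed

lemma supp_odd_theta: "supp_mod 8 1 odd_theta"
  unfolding odd_theta_def by (rule supp_mod_theta) (auto simp: odds_def intro: odd_square_mod_8)

lemma supp_odd_theta1: "supp_mod 16 1 odd_theta1"
  unfolding odd_theta1_def
proof (rule supp_mod_theta)
  fix a :: int assume "a \<in> {a. a mod 8 = 1}"
  then obtain k where "a = 8 * k + 1" using int_mod_eqE[of a 8 1] by auto
  then have "a\<^sup>2 - 1 = 16 * (4 * k\<^sup>2 + k)" by (simp add: power2_eq_square algebra_simps)
  then show "[a\<^sup>2 = int 1] (mod int 16)" unfolding cong_iff_dvd_diff by simp
qed

lemma supp_odd_theta3: "supp_mod 16 9 odd_theta3"
  unfolding odd_theta3_def
proof (rule supp_mod_theta)
  fix a :: int assume "a \<in> {a. a mod 8 = 3}"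
  then obtain k where "a = 8 * k + 3" using int_mod_eqE[of a 8 3] by auto
  then have "a\<^sup>2 - 9 = 16 * (4 * k\<^sup>2 + 3 * k)" by (simp add: power2_eq_square algebra_simps)
  then show "[a\<^sup>2 = int 9] (mod int 16)" unfolding cong_iff_dvd_diff by simp
qed

lemma supp_odd_theta_power2: "supp_mod (8 * 2 ^ k) (2 ^ k) (odd_theta ^ 2 ^ k)"
proof -
  have "[2 ^ k * a\<^sup>2 = int (2 ^ k)] (mod int (8 * 2 ^ k))" if "a \<in> odds" for a
  proof -
    have "[a\<^sup>2 = 1] (mod 8)" using that by (intro odd_square_mod_8) (simp add: odds_def)
    then have "[2 ^ k * a\<^sup>2 = 2 ^ k * 1] (mod (2 ^ k * 8))"
      unfolding cong_iff_dvd_diff right_diff_distrib[symmetric] by (rule mult_dvd_mono[OF dvd_refl])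
    then show ?thesis by (simp add: mult.commute)
  qed
  then show ?thesis
    unfolding odd_theta_def theta_power2[OF adm_square] by (rule supp_mod_theta)
qed

lemma supp_odd_theta_6: "supp_mod 16 6 (odd_theta ^ 2 * odd_theta ^ 4)"
proof -
  have "supp_mod 16 2 (odd_theta ^ 2)" using supp_odd_theta_power2[of 1] by simp
  moreover have "supp_mod 16 4 (odd_theta ^ 4)" using supp_mod_dvd[OF supp_odd_theta_power2[of 2], of 16] by simp
  ultimately show ?thesis using supp_mod_mult by fastforce
qed

lemma g_mult_inverse_power: "g_series ^ k * inverse g_series ^ k = 1"
  by (simp add: g_series_mult_inverse flip: power_mult_distrib)

section \<open>Expansion of the reciprocal\<close>

text \<open>This is h^7 / g^8 - h^6 h1, written in factors whose supports modulo 16 are known: the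
  two summands of the bracket live on 1 + 8 + 0 and 9 + 0, and the factor in front adds 6.\<close>

definition tail15 :: "bit fps" where
  "tail15 = odd_theta ^ 2 * odd_theta ^ 4 * (odd_theta1 * odd_theta ^ 8 * inverse g_series ^ 16 + odd_theta3 * g_series ^ 16)"

lemma supp_tail15: "supp_mod 16 15 tail15"
proof -
  have "supp_mod 16 8 (odd_theta ^ 8)" using supp_mod_dvd[OF supp_odd_theta_power2[of 3], of 16] by simp
  moreover have 0: "supp_mod 16 0 (f ^ 16)" for f using supp_mod_power2[of 4 f] by simp
  ultimately have "supp_mod 16 (1 + 8 + 0) (odd_theta1 * odd_theta ^ 8 * inverse g_series ^ 16)"
    by (intro supp_mod_mult supp_odd_theta1)
  moreover have "supp_mod 16 (9 + 0) (odd_theta3 * g_series ^ 16)" by (intro supp_mod_mult supp_odd_theta3 0)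
  ultimately have "supp_mod 16 (6 + 9) tail15"
    unfolding tail15_def by (intro supp_mod_mult supp_mod_add supp_odd_theta_6) simp_all
  then show ?thesis by simp
qed

lemma inverse_g_series:
  "inverse g_series = g_series ^ 2 + odd_theta * g_series ^ 4 + odd_theta * odd_theta ^ 2 * g_series ^ 8
     + odd_theta ^ 2 * odd_theta ^ 4 * odd_theta1 + tail15"
proof -
  let ?E = "inverse g_series" and ?g = g_series
  have gE: "?g * ?E = 1" by (rule g_series_mult_inverse)
  \<comment> \<open>Inserting \<open>g + g^4\<close> for \<open>odd_theta\<close> yields the
    recursion for \<open>?E\<close>. Its powers with exponents 2, 4 and 8 have the same shape, so it
    can be fed into itself.\<close>
  have "odd_theta * ?E ^ 2 = ?E * (?g * ?E) + ?g ^ 2 * (?g * ?E) ^ 2"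
    unfolding odd_theta_eq by (simp only: power2_eq_square power4_eq_xxxx) algebra
  then have "?E = ?g ^ 2 + odd_theta * ?E ^ 2" by (simp add: gE add.commute)
  then have 1: "?E ^ 2 ^ k = ?g ^ (2 * 2 ^ k) + odd_theta ^ 2 ^ k * ?E ^ (2 * 2 ^ k)" for k
    by (metis fps_bit_power2_add power_mult power_mult_distrib)
  have E: "?E = ?g ^ 2 + odd_theta * ?E ^ 2" "?E ^ 2 = ?g ^ 4 + odd_theta ^ 2 * ?E ^ 4"
    "?E ^ 4 = ?g ^ 8 + odd_theta ^ 4 * ?E ^ 8" "?E ^ 8 = ?g ^ 16 + odd_theta ^ 8 * ?E ^ 16"
    using 1[of 0] 1[of 1] 1[of 2] 1[of 3] by simp_all
  have g16: "?g ^ 16 = ?g ^ 8 * ?g ^ 8" by (simp flip: power_add)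
  have g8: "?g ^ 8 * ?E ^ 8 = 1" by (rule g_mult_inverse_power)
  have "odd_theta3 * ?E ^ 8 = odd_theta * (?g ^ 8 * ?E ^ 8) + odd_theta * (?g ^ 8 * (?g ^ 8 * ?E ^ 8))"
    unfolding odd_theta3_eq g16 by (simp only: distrib_left distrib_right mult.assoc)
  then have a: "odd_theta3 * ?E ^ 8 = odd_theta + odd_theta * ?g ^ 8" by (simp add: g8)
  have b: "odd_theta1 = odd_theta + odd_theta3" using odd_theta_split[symmetric] by (simp only: fps_bit_add_eq_iff add.commute)
  have c: "odd_theta3 = odd_theta * ?g ^ 8 + odd_theta * ?g ^ 16" unfolding odd_theta3_eq by (rule distrib_left)
  have d: "odd_theta ^ 8 * ?E ^ 16 = ?E ^ 8 + ?g ^ 16"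
    \<comment> \<open>In the equation for \<open>?E ^ 8\<close> the two sides can be exchanged
      freely, since a summand added twice vanishes. The resulting substitution removes
      \<open>?E ^ 16\<close> from the bracket of \<open>tail15\<close>; with
      \<open>odd_theta1\<close> added, only \<open>odd_theta * ?E ^ 8\<close> remains.\<close>
    by (subst E(4)) (simp only: add.commute[of _ "?g ^ 16"] fps_bit_double')
  have "odd_theta1 + (odd_theta1 * odd_theta ^ 8 * ?E ^ 16 + odd_theta3 * ?g ^ 16) = odd_theta1 + odd_theta1 * ?E ^ 8 + (odd_theta1 + odd_theta3) * ?g ^ 16"
    by (simp only: mult.assoc d) (simp only: algebra_simps)
  also have "\<dots> = odd_theta1 + (odd_theta * ?E ^ 8 + odd_theta3 * ?E ^ 8) + odd_theta * ?g ^ 16"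
    unfolding odd_theta_split[symmetric] by (simp only: b distrib_right)
  also have "\<dots> = odd_theta * ?E ^ 8 + (odd_theta + odd_theta) + (odd_theta * ?g ^ 8 + odd_theta * ?g ^ 8) + (odd_theta * ?g ^ 16 + odd_theta * ?g ^ 16)"
    unfolding a b unfolding c by (simp only: add.assoc add.commute add.left_commute)
  also have "\<dots> = odd_theta * ?E ^ 8" by simp
  finally have e: "odd_theta1 + (odd_theta1 * odd_theta ^ 8 * ?E ^ 16 + odd_theta3 * ?g ^ 16) = odd_theta * ?E ^ 8" .
  have "?E = ?g ^ 2 + odd_theta * (?g ^ 4 + odd_theta ^ 2 * (?g ^ 8 + odd_theta ^ 4 * ?E ^ 8))"
    unfolding E(3)[symmetric] E(2)[symmetric] by (rule E(1))
  also have "\<dots> = ?g ^ 2 + odd_theta * ?g ^ 4 + odd_theta * odd_theta ^ 2 * ?g ^ 8 + odd_theta ^ 2 * odd_theta ^ 4 * (odd_theta * ?E ^ 8)"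
    by (simp only: distrib_left ac_simps)
  also have "\<dots> = ?g ^ 2 + odd_theta * ?g ^ 4 + odd_theta * odd_theta ^ 2 * ?g ^ 8 + odd_theta ^ 2 * odd_theta ^ 4 * odd_theta1 + tail15"
    unfolding e[symmetric] tail15_def by (simp only: distrib_left add.assoc)
  finally show ?thesis .
qed

lemma theta_mult_square_power2:
  "theta A (\<lambda>a. a\<^sup>2) * theta B (\<lambda>a. a\<^sup>2) ^ 2 ^ k = theta (A \<times> B) (\<lambda>(a, b). a\<^sup>2 + 2 ^ k * b\<^sup>2)"
  by (simp add: theta_power2 theta_mult adm_square adm_scale)

lemma theta_mult_square_power2_power2_nth:
  "fps_nth (theta A (\<lambda>a. a\<^sup>2) * theta B (\<lambda>a. a\<^sup>2) ^ 2 ^ k * theta C (\<lambda>a. a\<^sup>2) ^ 2 ^ l) n =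
     of_nat (card {(a, b, c). a \<in> A \<and> b \<in> B \<and> c \<in> C \<and> a\<^sup>2 + 2 ^ k * b\<^sup>2 + 2 ^ l * c\<^sup>2 = int n})"
proof -
  have "adm (A \<times> B) (\<lambda>(a, b). a\<^sup>2 + 2 ^ k * b\<^sup>2)"
    by (rule adm_Times) (simp_all add: adm_square adm_scale)
  then have "theta (A \<times> B) (\<lambda>(a, b). a\<^sup>2 + 2 ^ k * b\<^sup>2) * theta C (\<lambda>a. 2 ^ l * a\<^sup>2) =
      theta ((A \<times> B) \<times> C) (\<lambda>(x, c). (case x of (a, b) \<Rightarrow> a\<^sup>2 + 2 ^ k * b\<^sup>2) + 2 ^ l * c\<^sup>2)"
    by (rule theta_mult) (simp add: adm_square adm_scale)
  also have "fps_nth \<dots> n = of_nat (card {(a, b, c). a \<in> A \<and> b \<in> B \<and> c \<in> C \<and>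
      a\<^sup>2 + 2 ^ k * b\<^sup>2 + 2 ^ l * c\<^sup>2 = int n})"
    unfolding theta_nth
    by (rule arg_cong[of _ _ of_nat], rule bij_betw_same_card[of "\<lambda>((a, b), c). (a, b, c)"],
      rule bij_betw_byWitness[of _ "\<lambda>(a, b, c). ((a, b), c)"]) auto
  finally show ?thesis
    by (simp only: theta_mult_square_power2 theta_power2[OF adm_square[of C], of l])
qed

text \<open>Apart from g^2, the summands of the expansion are supported on the disjoint classes 1
  mod 4, 3 mod 8, 7 mod 16 and 15 mod 16. In the class 7 the factor h1 may be replaced by h, because
  h^6 times the other part of h lives on 15.\<close>

lemma inverse_g_series_nth:
  assumes "fps_nth (inverse g_series) n \<noteq> 0" "\<not> [n = 15] (mod 16)"
  shows "fps_nth (g_series ^ 2) n \<noteq> 0 \<or> n mod 4 = 1 \<and> fps_nth (odd_theta * g_series ^ 4) n \<noteq> 0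
    \<or> n mod 8 = 3 \<and> fps_nth (odd_theta * odd_theta ^ 2 * g_series ^ 8) n \<noteq> 0
    \<or> n mod 16 = 7 \<and> fps_nth (odd_theta * odd_theta ^ 2 * odd_theta ^ 4) n \<noteq> 0"
proof -
  have s1: "supp_mod 4 (1 + 0) (odd_theta * g_series ^ 4)"
    using supp_mod_dvd[OF supp_odd_theta, of 4] supp_mod_power2[of 2 g_series] by (intro supp_mod_mult) simp_all
  have "supp_mod 8 2 (odd_theta ^ 2)" using supp_mod_dvd[OF supp_odd_theta_power2[of 1], of 8] by simp
  then have s2: "supp_mod 8 (1 + 2 + 0) (odd_theta * odd_theta ^ 2 * g_series ^ 8)"
    using supp_odd_theta supp_mod_power2[of 3 g_series] by (intro supp_mod_mult) simp_all
  have s3: "supp_mod 16 (6 + 1) (odd_theta ^ 2 * odd_theta ^ 4 * odd_theta1)" by (intro supp_mod_mult supp_odd_theta_6 supp_odd_theta1)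
  have s4: "supp_mod 16 (6 + 9) (odd_theta ^ 2 * odd_theta ^ 4 * odd_theta3)" by (intro supp_mod_mult supp_odd_theta_6 supp_odd_theta3)
  have "odd_theta * odd_theta ^ 2 * odd_theta ^ 4 = odd_theta ^ 2 * odd_theta ^ 4 * odd_theta1 + odd_theta ^ 2 * odd_theta ^ 4 * odd_theta3"
    unfolding distrib_left[symmetric] odd_theta_split[symmetric] by (simp only: ac_simps)
  then have h7: "fps_nth (odd_theta * odd_theta ^ 2 * odd_theta ^ 4) n = fps_nth (odd_theta ^ 2 * odd_theta ^ 4 * odd_theta1) n"
    using s4 assms(2) by (auto simp: supp_mod_def)
  have t: "fps_nth tail15 n = 0" using supp_tail15 assms(2) by (auto simp: supp_mod_def)
  have "fps_nth (g_series ^ 2) n \<noteq> 0 \<or> fps_nth (odd_theta * g_series ^ 4) n \<noteq> 0 \<or>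
      fps_nth (odd_theta * odd_theta ^ 2 * g_series ^ 8) n \<noteq> 0 \<or> fps_nth (odd_theta ^ 2 * odd_theta ^ 4 * odd_theta1) n \<noteq> 0"
  proof (rule ccontr)
    assume "\<not> ?thesis"
    then have "fps_nth (inverse g_series) n = 0"
      unfolding inverse_g_series fps_add_nth t by simp
    with assms(1) show False by blast
  qed
  then show ?thesis
    unfolding h7 using s1 s2 s3 unfolding supp_mod_def by (force simp: unique_euclidean_semiring_class.cong_def)
qed

section \<open>Coefficients at integers with three odd primes to odd powers\<close>

definition three_odd_primes :: "nat \<Rightarrow> bool" where
  "three_odd_primes n \<longleftrightarrow> (\<exists>p q r. prime p \<and> prime q \<and> prime r \<and> p \<noteq> q \<and> p \<noteq> r \<and> q \<noteq> r \<and>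
     odd p \<and> odd q \<and> odd r \<and> odd (multiplicity p n) \<and> odd (multiplicity q n) \<and> odd (multiplicity r n))"

lemma multiplicity_int: "multiplicity (int p) (int n) = multiplicity p n"
proof -
  have "int p ^ k dvd int n \<longleftrightarrow> p ^ k dvd n" for k by (metis of_nat_dvd_iff of_nat_power)
  then show ?thesis by (simp add: multiplicity_def)
qed

lemma multiplicity_double:
  assumes "prime p" "odd p" shows "multiplicity p (2 * n) = multiplicity p (n :: nat)"
proof (cases "n = 0")
  case False
  have "\<not> p dvd 2" using assms by (metis primes_dvd_imp_eq two_is_prime_nat even_numeral)
  with False assms show ?thesis
    by (simp add: prime_elem_multiplicity_mult_distrib not_dvd_imp_multiplicity_0)
qed simp

lemma even_card_reps_nat:
  assumes "three_odd_primes n" "n mod 8 \<noteq> 2"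
  shows "even (card {(a, b, c) \<in> reps (int n). c \<ge> 0})"
proof -
  obtain p q r where pqr: "prime p" "prime q" "prime r" "p \<noteq> q" "p \<noteq> r" "q \<noteq> r" "odd p" "odd q" "odd r"
    "odd (multiplicity p n)" "odd (multiplicity q n)" "odd (multiplicity r n)"
    using assms(1) unfolding three_odd_primes_def by blast
  have "n > 0" using pqr(10) by (cases "n = 0") auto
  show ?thesis
  proof (rule even_card_reps_nonneg[of "int p" "int q" "int r"])
    have "int n mod 8 = int (n mod 8)" by (simp add: zmod_int)
    then show "int n mod 8 \<noteq> 2" using assms(2) by simp
  qed (use pqr \<open>n > 0\<close> in \<open>simp_all add: multiplicity_int\<close>)
qed

lemma double_square_not_three_odd_primes: "\<not> three_odd_primes (2 * m\<^sup>2)"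
proof
  assume "three_odd_primes (2 * m\<^sup>2)"
  then obtain p where p: "prime p" "odd p" "odd (multiplicity p (2 * m\<^sup>2))"
    unfolding three_odd_primes_def by blast
  then have "odd (multiplicity p (m\<^sup>2))" using multiplicity_double[of p "m\<^sup>2"] by simp
  moreover have "m \<noteq> 0" using p(3) by (intro notI) simp
  ultimately show False using p(1) prime_elem_multiplicity_power_distrib[of p m 2] by simp
qed

lemma g_series_square_nth:
  assumes "fps_nth (g_series ^ 2) n \<noteq> 0" shows "\<exists>m. n = 2 * m\<^sup>2"
proof -
  obtain a where "2 * a\<^sup>2 = int n"
    using theta_nth_nonzero[of "{0..}" "\<lambda>a. 2 * a\<^sup>2" n] theta_square[OF adm_square] assms
    unfolding g_series_theta by metis
  then have "int n = int (2 * (nat \<bar>a\<bar>)\<^sup>2)" by simp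
  then have "n = 2 * (nat \<bar>a\<bar>)\<^sup>2" by (simp only: of_nat_eq_iff)
  then show ?thesis ..
qed

text \<open>In each residue class the coefficient is the parity of a number of representations: by 2
  m^2, by a^2 + 4 b^2, or by one of two ternary forms. The latter are transported to
  \<open>reps n\<close> by doubling c and to \<open>reps (2 * n)\<close> by doubling the
  equation.\<close>

theorem inverse_g_series_support:
  assumes "fps_nth (inverse g_series) n \<noteq> 0" "\<not> [n = 15] (mod 16)"
  shows "\<not> three_odd_primes n"
proof
  assume three: "three_odd_primes n"
  consider "fps_nth (g_series ^ 2) n \<noteq> 0" | "n mod 4 = 1" "fps_nth (odd_theta * g_series ^ 4) n \<noteq> 0"
    | "n mod 8 = 3" "fps_nth (odd_theta * odd_theta ^ 2 * g_series ^ 8) n \<noteq> 0"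
    | "n mod 16 = 7" "fps_nth (odd_theta * odd_theta ^ 2 * odd_theta ^ 4) n \<noteq> 0"
    using inverse_g_series_nth[OF assms] by blast
  then show False
  proof cases
    case 1
    then obtain m where "n = 2 * m\<^sup>2" using g_series_square_nth by blast
    with three double_square_not_three_odd_primes show False by simp
  next
    case 2
    obtain p q where pq: "prime p" "prime q" "p \<noteq> q" "odd (multiplicity p n)" "odd (multiplicity q n)"
      using three unfolding three_odd_primes_def by blast
    have "n \<noteq> 0" using pq(4) by (intro notI) simp
    have prim: "prime_elem p" "prime_elem q" using pq by blast+
    \<comment> \<open>Two of the primes suffice: \<open>u\<close> is the full power of
      \<open>p\<close>, so \<open>u\<close> and \<open>n\<close> have odd multiplicity at
      \<open>p\<close>, and \<open>w\<close> has odd multiplicity at \<open>q\<close>; none of the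
      three is a square.\<close>
    define u where "u = p ^ multiplicity p n"
    obtain w where w: "n = u * w" "\<not> p dvd w"
      using multiplicity_decompose'[of n p] prim(1) \<open>n \<noteq> 0\<close> unfolding u_def
      by (metis prime_elem_not_unit)
    have "u > 0" "w > 0" using w \<open>n \<noteq> 0\<close> by (auto intro: Nat.gr0I)
    have cop: "coprime u w" unfolding u_def using w(2) pq(1) by (simp add: prime_imp_coprime)
    have "\<not> q dvd u" unfolding u_def using pq by (metis prime_dvd_power primes_dvd_imp_eq)
    then have qw: "multiplicity q w = multiplicity q n"
      using w \<open>u > 0\<close> \<open>w > 0\<close> prim(2)
      by (simp add: prime_elem_multiplicity_mult_distrib not_dvd_imp_multiplicity_0)
    have pu: "multiplicity p u = multiplicity p n"
      unfolding u_def using prim(1) by (simp add: multiplicity_same_power prime_elem_not_unit)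
    have nsq: "\<nexists>k. int u = k\<^sup>2" "\<nexists>k. int w = k\<^sup>2" "\<nexists>k. int n = k\<^sup>2"
      using odd_multiplicity_not_square[of "int p" "int u"] odd_multiplicity_not_square[of "int q" "int w"]
        odd_multiplicity_not_square[of "int p" "int n"] pq pu qw
      by (simp_all add: multiplicity_int)
    have "int n mod 4 = int (n mod 4)" by (simp add: zmod_int)
    then have "int n mod 4 = 1" using 2(1) by simp
    then have "even (card {(a, b). 0 < a \<and> 0 \<le> b \<and> a\<^sup>2 + 4 * b\<^sup>2 = int n})"
      using even_card_two_squares[of "int u" "int w" "int n"] \<open>u > 0\<close> \<open>w > 0\<close> cop nsq
      by (simp add: w(1))
    also have "{(a, b). 0 < a \<and> 0 \<le> b \<and> a\<^sup>2 + 4 * b\<^sup>2 = int n} =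
        {x \<in> odds \<times> {0..}. (case x of (a, b) \<Rightarrow> a\<^sup>2 + 2 ^ 2 * b\<^sup>2) = int n}"
    proof -
      have "odd (n mod 4)" by (simp add: 2(1))
      then have "odd (int n)" by (simp add: dvd_mod_iff)
      then have "odd a" if "a\<^sup>2 + 4 * b\<^sup>2 = int n" for a b using that[symmetric] by simp
      then show ?thesis by (auto simp: odds_def)
    qed
    finally show False
      using 2(2) theta_mult_square_power2[of odds "{0..}" 2]
      by (simp add: odd_theta_def g_series_theta theta_nth of_nat_bit)
  next
    case 3
    have "odd (card {(a, b, c). a \<in> odds \<and> b \<in> odds \<and> c \<in> {0..} \<and> a\<^sup>2 + 2 ^ 1 * b\<^sup>2 + 2 ^ 3 * c\<^sup>2 = int n})"
      using 3(2) theta_mult_square_power2_power2_nth[of odds odds 1 "{0..}" 3 n]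
      by (simp add: odd_theta_def g_series_theta of_nat_bit)
    also have "card {(a, b, c). a \<in> odds \<and> b \<in> odds \<and> c \<in> {0..} \<and> a\<^sup>2 + 2 ^ 1 * b\<^sup>2 + 2 ^ 3 * c\<^sup>2 = int n} =
        card {(a, b, c) \<in> reps (int n). c \<ge> 0}" (is "card ?X = card ?Y")
    proof (rule bij_betw_same_card[of "\<lambda>(a, b, c). (a, b, 2 * c)"],
        rule bij_betw_byWitness[of _ "\<lambda>(a, b, c). (a, b, c div 2)"])
      show "(\<lambda>(a, b, c). (a, b, 2 * c)) ` ?X \<subseteq> ?Y" by (auto simp: reps_def odds_def power_mult_distrib)
      have "odd (n mod 8)" by (simp add: 3(1))
      then have "odd (int n)" by (simp add: dvd_mod_iff)
      show "(\<lambda>(a, b, c). (a, b, c div 2)) ` ?Y \<subseteq> ?X"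
      proof (rule image_subsetI)
        fix x assume "x \<in> ?Y"
        then obtain a b c where x: "x = (a, b, c)"
          and abc: "a\<^sup>2 + 2 * b\<^sup>2 + 2 * c\<^sup>2 = int n" "0 < a" "0 < b" "odd b" "even c" "c \<ge> 0"
          by (auto simp: reps_def)
        have "odd (a\<^sup>2 + 2 * b\<^sup>2 + 2 * c\<^sup>2)" unfolding abc(1) by fact
        then have "odd a" by simp
        obtain c' where "c = 2 * c'" using \<open>even c\<close> by auto
        then show "(case x of (a, b, c) \<Rightarrow> (a, b, c div 2)) \<in> ?X"
          using abc \<open>odd a\<close> by (simp add: x odds_def power_mult_distrib)
      qed
    qed (auto simp: reps_def)
    finally show False using even_card_reps_nat[OF three] 3(1) by simp
  next
    case 4
    have n8: "n mod 8 = 7" using mod_mod_cancel[of 8 16 n] 4(1) by simp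
    have n4: "n mod 4 = 3" using mod_mod_cancel[of 4 16 n] 4(1) by simp
    have "odd (card {(a, b, c). a \<in> odds \<and> b \<in> odds \<and> c \<in> odds \<and> a\<^sup>2 + 2 ^ 1 * b\<^sup>2 + 2 ^ 2 * c\<^sup>2 = int n})"
      using 4(2) theta_mult_square_power2_power2_nth[of odds odds 1 odds 2 n]
      by (simp add: odd_theta_def of_nat_bit)
    also have "card {(a, b, c). a \<in> odds \<and> b \<in> odds \<and> c \<in> odds \<and> a\<^sup>2 + 2 ^ 1 * b\<^sup>2 + 2 ^ 2 * c\<^sup>2 = int n} =
        card {(a, b, c) \<in> reps (int (2 * n)). c \<ge> 0}" (is "card ?X = card ?Y")
    proof (rule bij_betw_same_card[of "\<lambda>(a, b, c). (2 * b, a, 2 * c)"],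
        rule bij_betw_byWitness[of _ "\<lambda>(a, b, c). (b, a div 2, c div 2)"])
      show "(\<lambda>(a, b, c). (2 * b, a, 2 * c)) ` ?X \<subseteq> ?Y" by (auto simp: reps_def odds_def power_mult_distrib)
      have n: "int n mod 8 = 7" using n8 zmod_int[of n 8] by simp
      show "(\<lambda>(a, b, c). (b, a div 2, c div 2)) ` ?Y \<subseteq> ?X"
      proof (rule image_subsetI)
        fix x assume "x \<in> ?Y"
        then obtain a b c where x: "x = (a, b, c)"
          and abc: "a\<^sup>2 + 2 * b\<^sup>2 + 2 * c\<^sup>2 = 2 * int n" "0 < a" "0 < b" "odd b" "even c" "c \<ge> 0"
          by (auto simp: reps_def)
        have "a\<^sup>2 = 2 * (int n - b\<^sup>2 - c\<^sup>2)" using abc(1) by simp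
        then have "even (a\<^sup>2)" by simp
        then obtain a' where a': "a = 2 * a'" by auto
        obtain c' where c': "c = 2 * c'" using \<open>even c\<close> by auto
        have eq: "b\<^sup>2 + 2 * a'\<^sup>2 + 4 * c'\<^sup>2 = int n" using abc(1) by (simp add: a' c' power_mult_distrib)
        \<comment> \<open>The odd square of b leaves 2 a'^2 + 4 c'^2 = 6 modulo 8. This forces a'
          and then c' to be odd, so every representation of 2 n comes from a product of three odd
          theta series.\<close>
        have "b\<^sup>2 mod 8 = 1" using odd_square_mod_8[OF \<open>odd b\<close>] by (simp add: unique_euclidean_semiring_class.cong_def)
        moreover have "(A + B + C) mod 8 = 7 \<Longrightarrow> A mod 8 = 1 \<Longrightarrow> (B + C) mod 8 = 6" for A B C :: int
          by presburger
        ultimately have *: "(2 * a'\<^sup>2 + 4 * c'\<^sup>2) mod 8 = 6" using n unfolding eq[symmetric] by blast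
        have "odd A" if "(2 * A + 4 * C) mod 8 = 6" for A C :: int using that by presburger
        then have "odd (a'\<^sup>2)" using * by blast
        then have "odd a'" by simp
        then have "a'\<^sup>2 mod 8 = 1" using odd_square_mod_8 by (simp add: unique_euclidean_semiring_class.cong_def)
        moreover have "odd C" if "A mod 8 = 1" "(2 * A + 4 * C) mod 8 = 6" for A C :: int
          using that by presburger
        ultimately have "odd (c'\<^sup>2)" using * by blast
        then have "odd c'" by simp
        then have "c' \<noteq> 0" by auto
        then show "(case x of (a, b, c) \<Rightarrow> (b, a div 2, c div 2)) \<in> ?X"
          using abc \<open>odd a'\<close> \<open>odd c'\<close> eq by (simp add: x a' c' odds_def)
      qed
      show "\<forall>x \<in> ?Y. (case (case x of (a, b, c) \<Rightarrow> (b, a div 2, c div 2)) of (a, b, c) \<Rightarrow> (2 * b, a, 2 * c)) = x"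
      proof
        fix x assume "x \<in> ?Y"
        then obtain a b c where x: "x = (a, b, c)"
          and abc: "a\<^sup>2 + 2 * b\<^sup>2 + 2 * c\<^sup>2 = 2 * int n" "even c"
          by (auto simp: reps_def)
        have "a\<^sup>2 = 2 * (int n - b\<^sup>2 - c\<^sup>2)" using abc(1) by simp
        then have "even (a\<^sup>2)" by simp
        then have "even a" by simp
        then show "(case (case x of (a, b, c) \<Rightarrow> (b, a div 2, c div 2)) of (a, b, c) \<Rightarrow> (2 * b, a, 2 * c)) = x"
          using abc(2) by (simp add: x)
      qed
    qed auto
    finally have "odd (card {(a, b, c) \<in> reps (int (2 * n)). c \<ge> 0})" .
    moreover have "three_odd_primes (2 * n)"
      using three unfolding three_odd_primes_def by (metis multiplicity_double)
    \<comment> \<open>For n = 3 modulo 4 the double is 6 modulo 8, which avoids the excluded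
      residue.\<close>
    moreover have "(2 * n) mod 8 \<noteq> 2" using mult_mod_right[of 2 n 4] n4 by simp
    ultimately show False using even_card_reps_nat by blast
  qed
qed

section \<open>Squares times products of at most two primes\<close>

lemma prod_primes_dvd:
  assumes "finite A" "\<And>p. p \<in> A \<Longrightarrow> prime p \<and> p dvd n" shows "\<Prod>A dvd (n :: nat)"
  using assms
proof (induction A)
  case (insert p A)
  have "coprime p (\<Prod>A)"
    using insert by (intro prod_coprime_right) (metis insert_iff primes_coprime)
  then show ?case using insert by (simp add: divides_mult)
qed simp

definition primes_upto :: "real \<Rightarrow> nat set" where
  "primes_upto x = {p. prime p \<and> real p \<le> x}"

lemma finite_primes_upto [simp]: "finite (primes_upto x)"
  by (rule finite_subset[of _ "{..nat \<lfloor>x\<rfloor>}"]) (auto simp: primes_upto_def le_nat_floor)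

text \<open>Erdos's induction: even n > 2 reduce to n - 1, and for n = 2 m + 1 the primes above m +
  1 divide binom(2 m + 1, m), which is at most 4^m because it occurs twice in a row with sum 2 *
  4^m.\<close>

lemma primorial_le: "\<Prod>{p. prime p \<and> p \<le> n} \<le> (4 :: nat) ^ n"
proof (induction n rule: less_induct)
  case (less n)
  let ?P = "\<lambda>n :: nat. {p. prime p \<and> p \<le> n}"
  have "n = 0 \<or> n = 1 \<or> n = 2 \<or> n > 2 \<and> even n \<or> (\<exists>m > 0. n = 2 * m + 1)"
  proof (cases "even n")
    case False
    then obtain m where "n = 2 * m + 1" by (elim oddE)
    then show ?thesis by (cases "m = 0") auto
  next
    case True
    then show ?thesis by (cases "n > 2") auto
  qed
  then consider "n = 0 \<or> n = 1" | "n = 2" | "n > 2" "even n" | m where "n = 2 * m + 1" "m > 0"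
    by blast
  then show ?case
  proof cases
    case 1
    then have "?P n = {}" by (auto dest: prime_gt_1_nat)
    then show ?thesis by (metis prod.empty one_le_numeral one_le_power)
  next
    case 2
    have "prime p \<and> p \<le> 2 \<longleftrightarrow> p = 2" for p :: nat by (auto dest: prime_ge_2_nat)
    then show ?thesis using 2 by simp
  next
    case 3
    have "\<not> prime n" using 3 prime_odd_nat by blast
    then have "p \<le> n \<longleftrightarrow> p \<le> n - 1" if "prime p" for p using that 3 by (cases "p = n") auto
    then have "?P n = ?P (n - 1)" by blast
    then have "\<Prod>(?P n) \<le> 4 ^ (n - 1)" using less[of "n - 1"] 3 by simp
    also have "\<dots> \<le> 4 ^ n" by (rule power_increasing) auto
    finally show ?thesis .
  next
    case 4
    define C where "C = (2 * m + 1) choose m"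
    have fact: "fact m * fact (m + 1) * C = fact (2 * m + 1)"
      using binomial_fact_lemma[of m "2 * m + 1"] by (simp add: C_def)
    have "\<Prod>{p. prime p \<and> m + 1 < p \<and> p \<le> n} dvd C"
    proof (rule prod_primes_dvd)
      fix p assume p: "p \<in> {p. prime p \<and> m + 1 < p \<and> p \<le> n}"
      then have "p dvd fact (2 * m + 1)" using 4 by (simp add: prime_dvd_fact_iff del: fact_Suc)
      then have "p dvd fact m * fact (m + 1) * C" unfolding fact .
      moreover have "\<not> p dvd fact m" "\<not> p dvd fact (m + 1)" using p by (simp_all add: prime_dvd_fact_iff del: fact_Suc)
      ultimately have "p dvd C" using p prime_dvd_mult_nat by blast
      then show "prime p \<and> p dvd C" using p by simp
    qed (rule finite_subset[of _ "{..n}"], auto)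
    moreover have "C > 0" by (simp add: C_def)
    ultimately have "\<Prod>{p. prime p \<and> m + 1 < p \<and> p \<le> n} \<le> C" by (rule dvd_imp_le)
    also have "C \<le> 4 ^ m"
    proof -
      have "C = (2 * m + 1) choose (m + 1)"
        unfolding C_def by (subst binomial_symmetric) simp_all
      then have "2 * C = (\<Sum>k \<in> {m, m + 1}. (2 * m + 1) choose k)" by (simp add: C_def)
      also have "\<dots> \<le> (\<Sum>k \<le> 2 * m + 1. (2 * m + 1) choose k)" by (rule sum_mono2) auto
      also have "\<dots> = 2 * 4 ^ m" by (simp only: choose_row_sum power_add power_mult) simp
      finally show ?thesis by simp
    qed
    finally have 1: "\<Prod>{p. prime p \<and> m + 1 < p \<and> p \<le> n} \<le> 4 ^ m" .
    have 2: "\<Prod>(?P (m + 1)) \<le> 4 ^ (m + 1)" using less[of "m + 1"] 4 by simp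
    have "?P n = ?P (m + 1) \<union> {p. prime p \<and> m + 1 < p \<and> p \<le> n}" using 4 by auto
    then have "\<Prod>(?P n) = \<Prod>(?P (m + 1) \<union> {p. prime p \<and> m + 1 < p \<and> p \<le> n})" by (rule arg_cong)
    also have "\<dots> = \<Prod>(?P (m + 1)) * \<Prod>{p. prime p \<and> m + 1 < p \<and> p \<le> n}"
      by (rule prod.union_disjoint) auto
    also have "\<dots> \<le> 4 ^ (m + 1) * 4 ^ m" using 1 2 by (rule mult_le_mono[rotated])
    also have "\<dots> = 4 ^ n" using 4 by (simp flip: power_add add: mult_2)
    finally show ?thesis .
  qed
qed

lemma ln_le_2_sqrt: "x > 0 \<Longrightarrow> ln x \<le> 2 * sqrt x"
  using ln_le_minus_one[of "sqrt x"] by (simp add: ln_sqrt)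

text \<open>Primes above \<open>sqrt x\<close> each contribute a factor at least
  \<open>sqrt x\<close> to a primorial of size at most 4^x, so there are at most 4 x / ln x of them.
  The others number at most \<open>sqrt x\<close>, which is at most 2 x / ln x.\<close>

lemma chebyshev_upper:
  assumes "x > 1" shows "real (card (primes_upto x)) \<le> 6 * (x / ln x)"
proof -
  let ?B = "{p \<in> primes_upto x. sqrt x < real p}"
  define n where "n = nat \<lfloor>x\<rfloor>"
  have pos: "ln x > 0" using assms by simp
  have "(sqrt x) ^ card ?B = (\<Prod>p \<in> ?B. sqrt x)" by simp
  also have "\<dots> \<le> (\<Prod>p \<in> ?B. real p)" using assms by (intro prod_mono) auto
  also have "\<dots> = real (\<Prod>?B)" by simp
  also have "\<Prod>?B \<le> \<Prod>{p. prime p \<and> p \<le> n}"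
  proof (intro dvd_imp_le prod_dvd_prod_subset prod_pos)
    show "?B \<subseteq> {p. prime p \<and> p \<le> n}" by (auto simp: primes_upto_def n_def le_nat_floor)
    show "finite {p. prime p \<and> p \<le> n}" by (rule finite_subset[of _ "{..n}"]) auto
  qed (auto dest: prime_gt_0_nat)
  also have "\<dots> \<le> 4 ^ n" by (rule primorial_le)
  finally have "(sqrt x) ^ card ?B \<le> 4 ^ n" by simp
  then have "ln ((sqrt x) ^ card ?B) \<le> ln (4 ^ n)" using assms by simp
  then have "real (card ?B) * (ln x / 2) \<le> real n * ln 4" using assms by (simp add: ln_realpow ln_sqrt)
  also have "\<dots> \<le> x * 2"
  proof (rule mult_mono)
    have "ln (4 :: real) = 2 * ln 2" using ln_realpow[of 2 2] by simp
    then show "ln (4 :: real) \<le> 2" using ln_le_minus_one[of 2] by simp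
  qed (use assms in \<open>auto simp: n_def\<close>)
  finally have 1: "real (card ?B) \<le> 4 * (x / ln x)" using pos by (simp add: field_simps)
  have "primes_upto x \<subseteq> ?B \<union> {1..nat \<lfloor>sqrt x\<rfloor>}"
  proof
    fix p assume p: "p \<in> primes_upto x"
    then have "p \<ge> 1" by (auto simp: primes_upto_def dest: prime_ge_1_nat)
    then show "p \<in> ?B \<union> {1..nat \<lfloor>sqrt x\<rfloor>}"
      using p le_nat_floor[of p "sqrt x"] by (cases "sqrt x < real p") auto
  qed
  then have "card (primes_upto x) \<le> card (?B \<union> {1..nat \<lfloor>sqrt x\<rfloor>})" by (intro card_mono) auto
  also have "\<dots> \<le> card ?B + nat \<lfloor>sqrt x\<rfloor>" using card_Un_le[of ?B "{1..nat \<lfloor>sqrt x\<rfloor>}"] by simp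
  finally have 2: "real (card (primes_upto x)) \<le> real (card ?B) + real (nat \<lfloor>sqrt x\<rfloor>)" by linarith
  have 3: "real (nat \<lfloor>sqrt x\<rfloor>) \<le> sqrt x" using assms by simp
  have 4: "sqrt x \<le> 2 * (x / ln x)"
  proof -
    have "sqrt x * ln x \<le> sqrt x * (2 * sqrt x)" using assms ln_le_2_sqrt[of x] by (intro mult_left_mono) auto
    also have "\<dots> = 2 * x" using assms by simp
    finally show ?thesis using pos by (simp add: field_simps)
  qed
  show ?thesis using 1 2 3 4 by linarith
qed

section \<open>Reciprocals of primes\<close>

lemma sum_inverse_le_ln: "K > 0 \<Longrightarrow> (\<Sum>k<K. 1 / real (Suc k)) \<le> 1 + ln (real K)"
proof (induction K rule: nat_induct_non_zero)
  case (Suc K)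
  have "ln (real K / real (Suc K)) \<le> real K / real (Suc K) - 1"
    using Suc.hyps by (intro ln_le_minus_one) simp
  also have "\<dots> = - (1 / real (Suc K))" by (simp add: field_simps)
  finally have "1 / real (Suc K) \<le> ln (real (Suc K)) - ln (real K)"
    using Suc.hyps by (simp add: ln_div)
  then show ?case using Suc.IH by simp
qed simp

text \<open>Dyadic blocks: the primes between 2^K and 2^(K+1) number at most 6 * 2^(K+1) /
  ln(2^(K+1)), and each reciprocal is at most 1/2^K. With ln 2 at least 1/2 this gives 24/(K+1) per
  block.\<close>

lemma sum_prime_reciprocals_power2:
  "(\<Sum>p \<in> primes_upto (2 ^ K). 1 / real p) \<le> 24 * (\<Sum>k<K. 1 / real (Suc k))"
proof (induction K)
  case 0
  have "primes_upto 1 = {}" by (auto simp: primes_upto_def dest: prime_gt_1_nat)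
  then show ?case by simp
next
  case (Suc K)
  let ?N = "primes_upto (2 ^ Suc K) - primes_upto (2 ^ K)"
  have "(\<Sum>p \<in> ?N. 1 / real p) \<le> (\<Sum>p \<in> ?N. 1 / 2 ^ K)"
    by (intro sum_mono divide_left_mono) (auto simp: primes_upto_def dest: prime_gt_0_nat)
  also have "\<dots> = real (card ?N) / 2 ^ K" by simp
  also have "\<dots> \<le> real (card (primes_upto (2 ^ Suc K))) / 2 ^ K"
    by (intro divide_right_mono of_nat_mono card_mono) auto
  also have "\<dots> \<le> (6 * (2 ^ Suc K / ln (2 ^ Suc K))) / 2 ^ K"
    by (intro divide_right_mono chebyshev_upper) (simp_all add: one_less_power del: power_Suc)
  also have "\<dots> = 12 / (real (Suc K) * ln 2)"
  proof -
    have "6 * (2 ^ Suc K / L) / 2 ^ K = 12 / L" for L :: real by simp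
    then show ?thesis by (simp only: ln_realpow zero_less_numeral)
  qed
  also have "\<dots> \<le> 12 / (real (Suc K) * (1 / 2))"
  proof -
    have "ln (2 :: real) \<ge> 1 / 2" using ln_le_minus_one[of "1 / 2 :: real"] by (simp add: ln_div)
    then show ?thesis by (intro divide_left_mono mult_left_mono mult_pos_pos) auto
  qed
  finally have "(\<Sum>p \<in> ?N. 1 / real p) \<le> 24 * (1 / real (Suc K))" by simp
  moreover have "primes_upto (2 ^ K) \<subseteq> primes_upto (2 ^ Suc K)"
  proof -
    have "(2 :: real) ^ K \<le> 2 ^ Suc K" by simp
    then show ?thesis unfolding primes_upto_def using order_trans by blast
  qed
  then have "(\<Sum>p \<in> primes_upto (2 ^ Suc K). 1 / real p) =
      (\<Sum>p \<in> ?N. 1 / real p) + (\<Sum>p \<in> primes_upto (2 ^ K). 1 / real p)"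
    by (intro sum.subset_diff) simp_all
  ultimately show ?case using Suc.IH by (simp add: algebra_simps)
qed

lemma sum_prime_reciprocals:
  assumes "y > 0" "ln (ln y) \<ge> 1" "ln y \<ge> 2"
  shows "(\<Sum>p \<in> primes_upto y. 1 / real p) \<le> 96 * ln (ln y)"
proof -
  \<comment> \<open>Since ln 2 is at least 1/2, this exponent gives 2^K at least y. Rounding up
    keeps K below 3 ln y, so 24 (1 + ln K) is at most 24 (3 + ln ln y), which gives the constant
    96.\<close>
  define K where "K = nat \<lceil>2 * ln y\<rceil>"
  have K: "2 * ln y \<le> real K" "real K \<le> 3 * ln y"
    using assms unfolding K_def by linarith+
  then have K0: "K > 0" using assms(3) by (intro gr0I) simp
  have "ln (2 :: real) \<ge> 1 / 2" using ln_le_minus_one[of "1 / 2 :: real"] by (simp add: ln_div)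
  then have "real K * ln 2 \<ge> real K * (1 / 2)" by (intro mult_left_mono) auto
  then have "ln y \<le> ln (2 ^ K)" using K(1) by (simp add: ln_realpow)
  then have "y \<le> 2 ^ K" using assms(1) by simp
  then have "primes_upto y \<subseteq> primes_upto (2 ^ K)"
    unfolding primes_upto_def using order_trans by blast
  then have "(\<Sum>p \<in> primes_upto y. 1 / real p) \<le> (\<Sum>p \<in> primes_upto (2 ^ K). 1 / real p)"
    by (intro sum_mono2) auto
  also have "\<dots> \<le> 24 * (1 + ln (real K))"
    using sum_inverse_le_ln[OF K0] by (intro order_trans[OF sum_prime_reciprocals_power2] mult_left_mono) auto
  also have "ln (real K) \<le> ln (3 * ln y)" using K K0 by simp
  also have "ln (3 * ln y) = ln 3 + ln (ln y)" using assms(3) by (simp add: ln_mult)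
  also have "ln (3 :: real) \<le> 2" using ln_le_minus_one[of 3] by simp
  finally show ?thesis using assms(2) by simp
qed

section \<open>Counting squares times at most two primes\<close>

lemma primes_upto_mono: "x \<le> y \<Longrightarrow> primes_upto x \<subseteq> primes_upto y"
  by (auto simp: primes_upto_def)

definition prime_products :: "nat set" where
  "prime_products = {t. t = 1 \<or> prime t \<or> (\<exists>p q. prime p \<and> prime q \<and> p \<le> q \<and> t = p * q)}"

lemma prime_products_pos: "t \<in> prime_products \<Longrightarrow> t > 0"
  by (auto simp: prime_products_def prime_gt_0_nat)

lemma finite_nat_le_real [simp]: "finite {n. P n \<and> real n \<le> x}"
  by (rule finite_subset[of _ "{..nat \<lfloor>x\<rfloor>}"]) (auto simp: le_nat_floor)

text \<open>In a product p q the smaller prime p is at most \<open>sqrt z\<close>. Then z / p is at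
  least \<open>sqrt z\<close>, its logarithm at least half of ln z, and Chebyshev's bound for q only
  doubles its constant.\<close>

lemma card_prime_products_le:
  assumes "z > 1"
  shows "real (card {t. t \<in> prime_products \<and> real t \<le> z})
    \<le> 1 + 6 * (z / ln z) + 12 * (z / ln z) * (\<Sum>p \<in> primes_upto (sqrt z). 1 / real p)"
proof -
  let ?f = "\<lambda>p. (\<lambda>q. p * q) ` primes_upto (z / real p)"
  let ?U = "\<Union>p \<in> primes_upto (sqrt z). ?f p"
  have "{t. t \<in> prime_products \<and> real t \<le> z} \<subseteq> ({1} \<union> primes_upto z) \<union> ?U"
  proof
    fix t assume "t \<in> {t. t \<in> prime_products \<and> real t \<le> z}"
    then have t: "t \<in> prime_products" "real t \<le> z" by simp_all
    then consider "t = 1" | "prime t" | p q where "prime p" "prime q" "p \<le> q" "t = p * q"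
      unfolding prime_products_def by blast
    then show "t \<in> ({1} \<union> primes_upto z) \<union> ?U"
    proof cases
      case 3
      have p0: "real p > 0" using \<open>prime p\<close> by (simp add: prime_gt_0_nat)
      have pq: "real p * real q \<le> z" using t(2) 3(4) by simp
      have "real p * real p \<le> real p * real q" using 3(3) by (intro mult_left_mono) auto
      with pq have "real p * real p \<le> z" by linarith
      then have "real p \<le> sqrt z" by (intro real_le_rsqrt) (simp add: power2_eq_square)
      then have "p \<in> primes_upto (sqrt z)" using 3(1) by (simp add: primes_upto_def)
      moreover have "q \<in> primes_upto (z / real p)"
        using 3(2) pq p0 by (simp add: primes_upto_def pos_le_divide_eq mult.commute)
      ultimately show ?thesis using 3(4) by blast
    qed (use t in \<open>auto simp: primes_upto_def\<close>)
  qed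
  then have "card {t. t \<in> prime_products \<and> real t \<le> z} \<le> card (({1} \<union> primes_upto z) \<union> ?U)"
    by (intro card_mono) auto
  also have "\<dots> \<le> card ({1} \<union> primes_upto z) + card ?U" by (rule card_Un_le)
  also have "card ({1} \<union> primes_upto z) \<le> 1 + card (primes_upto z)"
    using card_Un_le[of "{1}" "primes_upto z"] by simp
  also have "card ?U \<le> (\<Sum>p \<in> primes_upto (sqrt z). card (?f p))" by (rule card_UN_le) simp
  also have "\<dots> \<le> (\<Sum>p \<in> primes_upto (sqrt z). card (primes_upto (z / real p)))"
    by (intro sum_mono card_image_le) simp
  finally have 1: "card {t. t \<in> prime_products \<and> real t \<le> z} \<le>
      1 + card (primes_upto z) + (\<Sum>p \<in> primes_upto (sqrt z). card (primes_upto (z / real p)))"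
    by simp
  have 2: "(\<Sum>p \<in> primes_upto (sqrt z). real (card (primes_upto (z / real p))))
      \<le> (\<Sum>p \<in> primes_upto (sqrt z). 12 * (z / ln z) * (1 / real p))"
  proof (rule sum_mono)
    fix p assume "p \<in> primes_upto (sqrt z)"
    then have p: "real p > 0" "real p \<le> sqrt z" by (auto simp: primes_upto_def prime_gt_0_nat)
    have "real p * sqrt z \<le> sqrt z * sqrt z" using p(2) assms by (intro mult_right_mono) auto
    then have zp: "sqrt z \<le> z / real p" using p(1) assms by (simp add: pos_le_divide_eq mult.commute)
    have "sqrt z > 1" using assms by simp
    then have zp1: "z / real p > 1" using zp by linarith
    have "ln (sqrt z) \<le> ln (z / real p)" using zp \<open>sqrt z > 1\<close> zp1 by simp
    then have l: "ln z / 2 \<le> ln (z / real p)" using assms by (simp add: ln_sqrt)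
    have "real (card (primes_upto (z / real p))) \<le> 6 * ((z / real p) / ln (z / real p))"
      by (rule chebyshev_upper) fact
    also have "\<dots> \<le> 6 * ((z / real p) / (ln z / 2))"
      using l assms p(1) zp1 by (intro mult_left_mono divide_left_mono mult_pos_pos) auto
    also have "\<dots> = 12 * (z / ln z) * (1 / real p)" by simp
    finally show "real (card (primes_upto (z / real p))) \<le> 12 * (z / ln z) * (1 / real p)" .
  qed
  have "real (card {t. t \<in> prime_products \<and> real t \<le> z}) \<le> real (1 + card (primes_upto z) +
      (\<Sum>p \<in> primes_upto (sqrt z). card (primes_upto (z / real p))))"
    using 1 by (rule of_nat_mono)
  also have "\<dots> = 1 + real (card (primes_upto z)) +
      (\<Sum>p \<in> primes_upto (sqrt z). real (card (primes_upto (z / real p))))" by simp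
  also have "\<dots> \<le> 1 + 6 * (z / ln z) + (\<Sum>p \<in> primes_upto (sqrt z). 12 * (z / ln z) * (1 / real p))"
    using 2 chebyshev_upper[OF assms] by (intro add_mono) auto
  finally show ?thesis by (simp only: sum_distrib_left)
qed

text \<open>Between \<open>sqrt y\<close> and \<open>y\<close> the logarithms of z and y agree up to
  a factor 2. This makes the bound linear in z, so that it can be summed over z = y / m^2.\<close>

lemma card_prime_products_le_uniform:
  assumes "y > 1" "sqrt y \<le> z" "z \<le> y"
  shows "real (card {t. t \<in> prime_products \<and> real t \<le> z})
    \<le> z * ((14 + 24 * (\<Sum>p \<in> primes_upto y. 1 / real p)) / ln y)"
proof -
  let ?S = "\<Sum>p \<in> primes_upto y. 1 / real p"
  have "sqrt y > 1" using assms(1) by simp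
  then have "z > 1" using assms(2) by linarith
  have ly: "ln y > 0" using assms(1) by simp
  have "ln (sqrt y) \<le> ln z"
    by (subst ln_le_cancel_iff) (use assms(2) \<open>z > 1\<close> \<open>sqrt y > 1\<close> in linarith)+
  then have "ln y / 2 \<le> ln z" using assms(1) by (simp add: ln_sqrt)
  then have "z / ln z \<le> z / (ln y / 2)"
    using \<open>z > 1\<close> ly by (intro divide_left_mono mult_pos_pos) auto
  then have 1: "z / ln z \<le> 2 * (z / ln y)" by (simp add: mult.commute)
  have "y * 1 \<le> y * y" using assms(1) by (intro mult_left_mono) auto
  then have "z \<le> y\<^sup>2" using assms(3) by (simp add: power2_eq_square)
  then have "sqrt z \<le> y" using assms(1) by (intro real_le_lsqrt) auto
  then have 2: "(\<Sum>p \<in> primes_upto (sqrt z). 1 / real p) \<le> ?S"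
    by (intro sum_mono2 primes_upto_mono) auto
  have "ln y \<le> 2 * z" using ln_le_2_sqrt[of y] assms by linarith
  then have 3: "1 \<le> 2 * (z / ln y)" using ly by (simp add: field_simps)
  have 4: "12 * (z / ln z) * (\<Sum>p \<in> primes_upto (sqrt z). 1 / real p) \<le> 12 * (2 * (z / ln y)) * ?S"
    using 1 2 \<open>z > 1\<close> ly by (intro mult_mono mult_left_mono) (auto intro: sum_nonneg)
  have "real (card {t. t \<in> prime_products \<and> real t \<le> z})
      \<le> 2 * (z / ln y) + 6 * (2 * (z / ln y)) + 12 * (2 * (z / ln y)) * ?S"
    using card_prime_products_le[OF \<open>z > 1\<close>] 1 3 4 by linarith
  also have "\<dots> = z * ((14 + 24 * ?S) / ln y)" using ly by (simp add: field_simps)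
  finally show ?thesis .
qed

lemma sum_inverse_squares_le:
  assumes "a > 0" "a \<le> N" shows "(\<Sum>m \<in> {a<..N}. 1 / (real m)\<^sup>2) \<le> 1 / real a - 1 / real N"
  using assms(2)
proof (induction N rule: dec_induct)
  case (step N)
  have "N > 0" using step assms(1) by simp
  have "1 / (real (Suc N))\<^sup>2 \<le> 1 / (real N * real (Suc N))"
    using \<open>N > 0\<close> by (intro divide_left_mono) (auto simp: power2_eq_square)
  also have "\<dots> = 1 / real N - 1 / real (Suc N)" using \<open>N > 0\<close> by (simp add: field_simps)
  finally have "1 / (real (Suc N))\<^sup>2 \<le> 1 / real N - 1 / real (Suc N)" .
  moreover have "{a<..Suc N} = insert (Suc N) {a<..N}" using step by auto
  ultimately show ?case using step.IH by simp
qed simp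

lemma card_square_times_prime_products_le:
  assumes "y > 1" "ln y \<ge> 2" "ln (ln y) \<ge> 1"
  shows "real (card {n. (0 < n \<and> (\<exists>m. \<exists>t \<in> prime_products. n = m\<^sup>2 * t)) \<and> real n \<le> y})
    \<le> 5000 * (y * ln (ln y) / ln y)"
proof -
  let ?V = "{n. (0 < n \<and> (\<exists>m. \<exists>t \<in> prime_products. n = m\<^sup>2 * t)) \<and> real n \<le> y}"
  define S where "S = (\<Sum>p \<in> primes_upto y. 1 / real p)"
  define M where "M = (14 + 24 * S) / ln y"
  have S: "0 \<le> S" "S \<le> 96 * ln (ln y)"
    using sum_prime_reciprocals[of y] assms by (auto simp: S_def intro: sum_nonneg)
  have M: "M \<ge> 0" using S assms by (simp add: M_def)
  define N where "N = nat \<lfloor>y\<rfloor>"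
  \<comment> \<open>The fourth root of y separates two ranges. Up to it y / m^2 is at least
    \<open>sqrt y\<close> and the uniform bound applies; beyond it the trivial bounds y / m^2 sum to
    at most y / a, and ln y is at most 8 a.\<close>
  define a where "a = nat \<lfloor>sqrt (sqrt y)\<rfloor>"
  have r1: "sqrt (sqrt y) > 1" using assms(1) by simp
  have "\<lfloor>sqrt (sqrt y)\<rfloor> \<ge> 1" using r1 by (simp only: le_floor_iff of_int_1)
  moreover from this have "real a = of_int \<lfloor>sqrt (sqrt y)\<rfloor>" by (simp add: a_def)
  ultimately have a: "a \<ge> 1" "real a \<le> sqrt (sqrt y)" "sqrt (sqrt y) \<le> 2 * real a"
    by linarith+
  let ?c = "\<lambda>m. {t. t \<in> prime_products \<and> real t \<le> y / (real m)\<^sup>2}"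
  have "?V \<subseteq> (\<Union>m \<in> {1..N}. (\<lambda>t. m\<^sup>2 * t) ` ?c m)"
  proof
    fix n assume "n \<in> ?V"
    then obtain m t where n: "n > 0" "t \<in> prime_products" "n = m\<^sup>2 * t" "real n \<le> y" by blast
    have "m > 0" using n by (intro gr0I) auto
    have "m \<le> m\<^sup>2 * t" using prime_products_pos[OF n(2)] \<open>m > 0\<close>
      by (simp add: power2_eq_square mult.assoc)
    then have "real m \<le> y" using n(3,4) by linarith
    then have "m \<in> {1..N}" using \<open>m > 0\<close> by (simp add: N_def le_nat_floor)
    moreover have "t \<in> ?c m" using n \<open>m > 0\<close> by (simp add: pos_le_divide_eq mult.commute)
    ultimately show "n \<in> (\<Union>m \<in> {1..N}. (\<lambda>t. m\<^sup>2 * t) ` ?c m)" using n(3) by blast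
  qed
  then have "card ?V \<le> card (\<Union>m \<in> {1..N}. (\<lambda>t. m\<^sup>2 * t) ` ?c m)" by (intro card_mono) auto
  also have "\<dots> \<le> (\<Sum>m \<in> {1..N}. card ((\<lambda>t. m\<^sup>2 * t) ` ?c m))" by (rule card_UN_le) simp
  also have "\<dots> \<le> (\<Sum>m \<in> {1..N}. card (?c m))" by (intro sum_mono card_image_le) simp
  finally have "real (card ?V) \<le> (\<Sum>m \<in> {1..N}. real (card (?c m)))" by (simp flip: of_nat_sum)
  also have "\<dots> \<le> (\<Sum>m \<in> {1..a} \<union> {a<..N}. real (card (?c m)))"
    by (rule sum_mono2) auto
  also have "\<dots> = (\<Sum>m \<in> {1..a}. real (card (?c m))) + (\<Sum>m \<in> {a<..N}. real (card (?c m)))"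
    by (rule sum.union_disjoint) auto
  also have "(\<Sum>m \<in> {1..a}. real (card (?c m))) \<le> (\<Sum>m \<in> {1..a}. y * M * (1 / (real m)\<^sup>2))"
  proof (rule sum_mono)
    fix m assume m: "m \<in> {1..a}"
    then have "real m \<le> sqrt (sqrt y)" using a(2) by simp
    then have "(real m)\<^sup>2 \<le> (sqrt (sqrt y))\<^sup>2" by (intro power_mono) auto
    then have m2: "(real m)\<^sup>2 \<le> sqrt y" using assms(1) by simp
    have mp: "(real m)\<^sup>2 \<ge> 1" using m by simp
    have "sqrt y * (real m)\<^sup>2 \<le> sqrt y * sqrt y" using m2 assms(1) by (intro mult_left_mono) auto
    moreover have "sqrt y * sqrt y = y" using assms(1) by simp
    ultimately have 1: "sqrt y \<le> y / (real m)\<^sup>2" using mp by (subst pos_le_divide_eq) linarith+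
    have "y / (real m)\<^sup>2 \<le> y / 1" by (intro divide_left_mono) (use mp assms(1) in linarith)+
    then have 2: "y / (real m)\<^sup>2 \<le> y" by simp
    show "real (card (?c m)) \<le> y * M * (1 / (real m)\<^sup>2)"
      using card_prime_products_le_uniform[OF assms(1) 1 2] by (simp add: M_def S_def mult.commute)
  qed
  also have "\<dots> \<le> y * M * 2"
  proof -
    have "{1..a} = insert 1 {1<..a}" using a(1) by auto
    then have "(\<Sum>m \<in> {1..a}. 1 / (real m)\<^sup>2) = 1 + (\<Sum>m \<in> {1<..a}. 1 / (real m)\<^sup>2)" by simp
    also have "\<dots> \<le> 2" using sum_inverse_squares_le[of 1 a] a(1) by (simp add: order_trans)
    finally show ?thesis
      using assms(1) M unfolding sum_distrib_left[symmetric] by (intro mult_left_mono) auto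
  qed
  also have "(\<Sum>m \<in> {a<..N}. real (card (?c m))) \<le> (\<Sum>m \<in> {a<..N}. y * (1 / (real m)\<^sup>2))"
  proof (rule sum_mono)
    fix m
    have "card (?c m) \<le> card {1..nat \<lfloor>y / (real m)\<^sup>2\<rfloor>}"
      using prime_products_pos by (intro card_mono) (auto simp: le_nat_floor Suc_le_eq)
    then have "real (card (?c m)) \<le> real (nat \<lfloor>y / (real m)\<^sup>2\<rfloor>)" by simp
    also have "\<dots> \<le> y / (real m)\<^sup>2" using assms(1) by simp
    finally show "real (card (?c m)) \<le> y * (1 / (real m)\<^sup>2)" by simp
  qed
  also have "\<dots> \<le> y * (1 / real a)"
  proof -
    have "(\<Sum>m \<in> {a<..N}. 1 / (real m)\<^sup>2) \<le> 1 / real a"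
    proof (cases "a \<le> N")
      case True
      then have "(\<Sum>m \<in> {a<..N}. 1 / (real m)\<^sup>2) \<le> 1 / real a - 1 / real N"
        using a(1) by (intro sum_inverse_squares_le) auto
      also have "\<dots> \<le> 1 / real a" by simp
      finally show ?thesis .
    qed simp
    then show ?thesis
      using assms(1) unfolding sum_distrib_left[symmetric] by (intro mult_left_mono) auto
  qed
  finally have 1: "real (card ?V) \<le> y * M * 2 + y * (1 / real a)" by simp
  have "ln y = 4 * ln (sqrt (sqrt y))" using assms(1) by (simp add: ln_sqrt)
  also have "\<dots> \<le> 4 * sqrt (sqrt y)" using ln_le_minus_one[of "sqrt (sqrt y)"] r1 by linarith
  also have "\<dots> \<le> 8 * real a" using a by simp
  finally have "1 / real a \<le> 8 / ln y" using a(1) assms(2) by (simp add: field_simps)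
  then have "y * (1 / real a) \<le> y * (8 / ln y)" using assms(1) by (intro mult_left_mono) auto
  then have "real (card ?V) \<le> y * M * 2 + y * (8 / ln y)" using 1 by linarith
  also have "\<dots> = (y / ln y) * (36 + 48 * S)" using assms(2) by (simp add: M_def field_simps)
  \<comment> \<open>With S at most 96 ln ln y and ln ln y at least 1, the bracket is at most (36 +
    48 * 96) ln ln y = 4644 ln ln y.\<close>
  also have "\<dots> \<le> (y / ln y) * (5000 * ln (ln y))"
    using S assms by (intro mult_left_mono) auto
  also have "\<dots> = 5000 * (y * ln (ln y) / ln y)" by simp
  finally show ?thesis .
qed

section \<open>Shape of the exponents and the density bound\<close>

text \<open>The prime factors of the squarefree part are exactly the primes of odd multiplicity in
  n, so by assumption there are at most two of them.\<close>

lemma square_times_prime_product: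
  assumes "n > 0" "\<not> (\<exists>p q r. prime p \<and> prime q \<and> prime r \<and> p \<noteq> q \<and> p \<noteq> r \<and> q \<noteq> r \<and>
     odd (multiplicity p n) \<and> odd (multiplicity q n) \<and> odd (multiplicity r n))"
  shows "\<exists>m. \<exists>t \<in> prime_products. n = m\<^sup>2 * t"
proof -
  define t where "t = squarefree_part n"
  have n: "n = (square_part n)\<^sup>2 * t"
    using squarefree_decompose[of n] by (simp add: t_def mult.commute)
  have "t \<noteq> 0" by (simp add: t_def)
  define P where "P = prime_factors t"
  have mult: "multiplicity p t = multiplicity p n mod 2" if "prime p" for p
    using prime_multiplicity_squarefree_part[OF that, of n] by (simp add: t_def)
  have P: "prime p \<and> odd (multiplicity p n)" if "p \<in> P" for p
  proof -
    have "prime p" "multiplicity p t > 0"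
      using that by (simp_all add: P_def prime_factors_multiplicity)
    then show ?thesis using mult[of p] by (simp add: odd_iff_mod_2_eq_one)
  qed
  have "t = (\<Prod>p \<in> P. p ^ multiplicity p t)"
    using prod_prime_factors[OF \<open>t \<noteq> 0\<close>] by (simp add: P_def)
  also have "\<dots> = \<Prod>P"
    by (rule prod.cong) (use P mult in \<open>auto simp: odd_iff_mod_2_eq_one\<close>)
  finally have t: "t = \<Prod>P" .
  have "card P \<le> 2"
  proof (rule ccontr)
    assume "\<not> card P \<le> 2"
    then obtain T where "T \<subseteq> P" "card T = 3" using obtain_subset_with_card_n[of 3 P] by auto
    then obtain p q r where "p \<in> P" "q \<in> P" "r \<in> P" "p \<noteq> q" "p \<noteq> r" "q \<noteq> r"
      unfolding card_3_iff by blast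
    with P assms(2) show False by blast
  qed
  then consider "card P = 0" | "card P = 1" | "card P = 2" by linarith
  then have "t \<in> prime_products"
  proof cases
    case 1
    then have "P = {}" by (simp add: P_def)
    then show ?thesis by (simp add: t prime_products_def)
  next
    case 2
    then obtain p where "P = {p}" using card_1_singletonE by blast
    then show ?thesis using P by (simp add: t prime_products_def)
  next
    case 3
    then obtain p q where pq: "P = {p, q}" "p \<noteq> q" unfolding card_2_iff by blast
    then have "prime p" "prime q" "t = p * q" "t = q * p" using P by (simp_all add: t)
    then show ?thesis unfolding prime_products_def
      by (cases "p \<le> q") (metis (mono_tags, lifting) mem_Collect_eq nat_le_linear)+
  qed
  with n show ?thesis by blast
qed

text \<open>Only odd primes enter \<open>three_odd_primes\<close>, so for even n its negation would
  leave room for two odd primes besides 2. Even exponents are instead settled by g^2, all other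
  summands being supported on odd classes.\<close>

lemma inverse_g_series_even:
  assumes "fps_nth (inverse g_series) n \<noteq> 0" "\<not> [n = 15] (mod 16)" "even n"
  shows "\<exists>m. n = 2 * m\<^sup>2"
proof -
  have "fps_nth (g_series ^ 2) n \<noteq> 0"
  proof (rule ccontr)
    assume "\<not> ?thesis"
    then have "n mod 4 = 1 \<or> n mod 8 = 3 \<or> n mod 16 = 7" using inverse_g_series_nth[OF assms(1,2)] by blast
    moreover have "even (n mod 4)" "even (n mod 8)" "even (n mod 16)"
      using assms(3) by (simp_all add: dvd_mod_iff)
    ultimately show False by auto
  qed
  then show ?thesis by (rule g_series_square_nth)
qed

lemma B_set_form:
  assumes "n \<in> B_set" "\<not> [n = 15] (mod 16)" "n > 0"
  shows "\<exists>m. \<exists>t \<in> prime_products. n = m\<^sup>2 * t"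
proof (cases "even n")
  case True
  have "fps_nth (inverse g_series) n \<noteq> 0" using assms(1) by (simp add: B_set_def b_coeff_def)
  then obtain m where "n = 2 * m\<^sup>2" using inverse_g_series_even assms(2) True by blast
  then have "n = m\<^sup>2 * 2" by simp
  moreover have "2 \<in> prime_products" by (simp add: prime_products_def)
  ultimately show ?thesis by blast
next
  case False
  have "fps_nth (inverse g_series) n \<noteq> 0" using assms(1) by (simp add: B_set_def b_coeff_def)
  then have "\<not> three_odd_primes n" using inverse_g_series_support assms(2) by blast
  moreover have "odd p" if "odd (multiplicity p n)" for p
  proof -
    have "p dvd n" using that by (metis even_zero not_dvd_imp_multiplicity_0)
    with False show ?thesis using dvd_trans by blast
  qed
  ultimately show ?thesis
    using assms(3) unfolding three_odd_primes_def by (intro square_times_prime_product) blast+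
qed

lemma card_B_set_le:
  assumes "y > 1" "ln y \<ge> 2" "ln (ln y) \<ge> 1"
  shows "real (card {n \<in> B_set. real n \<le> y \<and> \<not> [n = 15] (mod 16)}) \<le> 5001 * (y * ln (ln y) / ln y)"
proof -
  let ?V = "{n. (0 < n \<and> (\<exists>m. \<exists>t \<in> prime_products. n = m\<^sup>2 * t)) \<and> real n \<le> y}"
  have "{n \<in> B_set. real n \<le> y \<and> \<not> [n = 15] (mod 16)} \<subseteq> insert 0 ?V"
    using B_set_form by auto
  then have "card {n \<in> B_set. real n \<le> y \<and> \<not> [n = 15] (mod 16)} \<le> card (insert 0 ?V)"
    by (intro card_mono) auto
  also have "\<dots> \<le> 1 + card ?V" by (simp add: card_insert_if)
  finally have "real (card {n \<in> B_set. real n \<le> y \<and> \<not> [n = 15] (mod 16)}) \<le> 1 + real (card ?V)"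
    by linarith
  also have "real (card ?V) \<le> 5000 * (y * ln (ln y) / ln y)"
    by (rule card_square_times_prime_products_le) fact+
  \<comment> \<open>The exponent 0 was counted separately; it is absorbed by raising the constant
    from 5000 to 5001.\<close>
  also have "1 \<le> y * ln (ln y) / ln y"
  proof -
    have "ln y \<le> y" using ln_le_minus_one[of y] assms(1) by simp
    moreover have "y * 1 \<le> y * ln (ln y)" using assms by (intro mult_left_mono) auto
    ultimately have "ln y \<le> y * ln (ln y)" by linarith
    then show ?thesis using assms(2) by (simp add: pos_le_divide_eq)
  qed
  finally show ?thesis by simp
qed

lemma eventually_card_B_set_le:
  "\<forall>\<^sub>F y in at_top. real (card {n \<in> B_set. real n \<le> y \<and> \<not> [n = 15] (mod 16)})
     \<le> 5001 * (y * ln (ln y) / ln y)"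
proof -
  have "\<forall>\<^sub>F y :: real in at_top. y > 1" "\<forall>\<^sub>F y :: real in at_top. ln y \<ge> 2"
    "\<forall>\<^sub>F y :: real in at_top. ln (ln y) \<ge> 1" by real_asymp+
  then show ?thesis by eventually_elim (rule card_B_set_le)
qed

lemma card_15_mod_16_le:
  assumes "y \<ge> 0" shows "real (card {n. [n = 15] (mod 16) \<and> real n \<le> y}) \<le> y / 16 + 1"
proof -
  have "{n. [n = 15] (mod 16) \<and> real n \<le> y} \<subseteq> (\<lambda>k. 16 * k + 15) ` {..nat \<lfloor>y / 16\<rfloor>}"
  proof
    fix n assume "n \<in> {n. [n = 15] (mod 16) \<and> real n \<le> y}"
    then have cong: "[n = 15] (mod 16)" and y: "real n \<le> y" by blast+
    have n: "n mod 16 = 15" using cong unfolding unique_euclidean_semiring_class.cong_def by simp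
    have "n = 16 * (n div 16) + 15" using n mult_div_mod_eq[of 16 n] by simp
    moreover have "16 * (n div 16) \<le> n" by simp
    then have "real (16 * (n div 16)) \<le> real n" by (rule of_nat_mono)
    then have "real (n div 16) \<le> y / 16" using y by simp
    then have "n div 16 \<in> {..nat \<lfloor>y / 16\<rfloor>}" by (simp add: le_nat_floor)
    ultimately show "n \<in> (\<lambda>k. 16 * k + 15) ` {..nat \<lfloor>y / 16\<rfloor>}" by blast
  qed
  then have "card {n. [n = 15] (mod 16) \<and> real n \<le> y} \<le> card ((\<lambda>k :: nat. 16 * k + 15) ` {..nat \<lfloor>y / 16\<rfloor>})"
    by (intro card_mono) auto
  also have "\<dots> \<le> card {..nat \<lfloor>y / 16\<rfloor>}" by (rule card_image_le) simp
  finally have "real (card {n. [n = 15] (mod 16) \<and> real n \<le> y}) \<le> real (nat \<lfloor>y / 16\<rfloor>) + 1" by simp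
  also have "real (nat \<lfloor>y / 16\<rfloor>) \<le> y / 16" using assms by (intro of_nat_floor) simp
  finally show ?thesis by simp
qed

lemma eventually_density_B_set_le:
  "\<forall>\<^sub>F y in at_top. real (card {n \<in> B_set. real n \<le> y}) / y \<le> 1 / 16 + 1 / y + 5001 * (ln (ln y) / ln y)"
  using eventually_card_B_set_le eventually_gt_at_top[of 0]
proof eventually_elim
  case (elim y)
  let ?N = "{n \<in> B_set. real n \<le> y \<and> \<not> [n = 15] (mod 16)}"
  let ?C = "{n. [n = 15] (mod 16) \<and> real n \<le> y}"
  have "{n \<in> B_set. real n \<le> y} \<subseteq> ?N \<union> ?C" by auto
  moreover have "finite ?N"
    by (rule finite_subset[OF _ finite_nat_le_real[of "\<lambda>_. True" y]]) blast
  ultimately have "card {n \<in> B_set. real n \<le> y} \<le> card (?N \<union> ?C)" by (intro card_mono) auto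
  also have "\<dots> \<le> card ?N + card ?C" by (rule card_Un_le)
  finally have "real (card {n \<in> B_set. real n \<le> y}) \<le> real (card ?N) + real (card ?C)" by linarith
  also have "\<dots> \<le> 5001 * (y * ln (ln y) / ln y) + (y / 16 + 1)"
    using elim card_15_mod_16_le[of y] by (intro add_mono) auto
  finally have "real (card {n \<in> B_set. real n \<le> y}) / y
      \<le> (5001 * (y * ln (ln y) / ln y) + (y / 16 + 1)) / y"
    using elim(2) by (intro divide_right_mono) auto
  also have "\<dots> = 1 / 16 + 1 / y + 5001 * (ln (ln y) / ln y)"
    using elim(2) by (simp add: add_divide_distrib)
  finally show ?case .
qed

lemma upper_density_B_set: "upper_density B_set \<le> ereal (1 / 16)"
proof -
  let ?f = "\<lambda>y :: real. 1 / 16 + 1 / y + 5001 * (ln (ln y) / ln y)"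
  have "(?f \<longlongrightarrow> 1 / 16) at_top" by real_asymp
  then have lim: "((\<lambda>y. ereal (?f y)) \<longlongrightarrow> ereal (1 / 16)) at_top" by simp
  have "upper_density B_set \<le> Limsup at_top (\<lambda>y. ereal (?f y))"
    unfolding upper_density_def
    by (rule Limsup_mono) (use eventually_density_B_set_le in \<open>simp add: eventually_mono\<close>)
  also have "\<dots> = ereal (1 / 16)" by (rule lim_imp_Limsup[OF _ lim]) simp
  finally show ?thesis .
qed

theorem theorem3p12:
  shows "(\<lambda>y::real. real (card {n \<in> B_set. real n \<le> y \<and> \<not> [n = 15] (mod 16)}))
           \<in> O[at_top](\<lambda>y. y * ln (ln y) / ln y)
         \<and> upper_density B_set \<le> ereal (1 / 16)"
proof
  show "(\<lambda>y::real. real (card {n \<in> B_set. real n \<le> y \<and> \<not> [n = 15] (mod 16)}))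
      \<in> O[at_top](\<lambda>y. y * ln (ln y) / ln y)"
  proof (rule bigoI[where c = 5001], rule eventually_mono[OF eventually_card_B_set_le])
    fix y :: real
    assume "real (card {n \<in> B_set. real n \<le> y \<and> \<not> [n = 15] (mod 16)}) \<le> 5001 * (y * ln (ln y) / ln y)"
    also have "\<dots> \<le> 5001 * \<bar>y * ln (ln y) / ln y\<bar>" by (intro mult_left_mono abs_ge_self) simp
    finally show "norm (real (card {n \<in> B_set. real n \<le> y \<and> \<not> [n = 15] (mod 16)}))
        \<le> 5001 * norm (y * ln (ln y) / ln y)" by simp
  qed
qed (rule upper_density_B_set)

end
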